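(* There exists a polynomial-time algorithm that achieves an approximation factor greater than $0.0878$ for the Budgeted Influence Maximization with Augmentation problem (BIMA), i.e. there is a constant $\rho>0.0878$ such that on every instance the algorithm returns a feasible solution $(A,S)$ with $\sigma(A,S)\ge \rho\cdot\sigma(A^*,S^* )$, where $(A^*,S^* )$ is an optimal solution.
   Context: Setting. $G=(V,E,p,c)$ is a finite directed graph with propagation probabilities $p:V\times V\to[0,1]$ and edge-addition costs $c:V\times V\to[0,1]$. Independent Cascade Model: for a set $S\subseteq (V\times V)\setminus E$, let $G(S)=(V,E\cup S)$. A live-edge graph $X$ of $G(S)$ is the random subgraph on $V$ in which each edge $e\in E\cup S$ is kept independently with probability $p_e$; $\chi(S)$ is the set of all possible live-edge graphs of $G(S)$. For $A\subseteq V$, $R(A,X)$ is the set of nodes reachable in $X$ from some node of $A$ (including $A$), and $\sigma(A,S)=\sum_{X\in\chi(S)}\mathbb P[X]\,|R(A,X)|$ is the expected number of active nodes when $A$ is the set of seeds in $G(S)$. BIMA problem: given $G$ and a budget $k\in\mathbb N$, find $A\subseteq V$ and $S\subseteq (A\times V)\setminus E$ with $c(A,S):=|A|+\sum_{e\in S}c_e\le k$ maximizing $\sigma(A,S)$. Convention: the value $\sigma(A,S)$ is assumed to be computable (oracle access to $\sigma$); the additional factor $1+\epsilon$, for any $\epsilon>0$, coming from estimating $\sigma$ by sampling is omitted from approximation factors. *)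

theory Defs
  imports
    "HOL-Probability.Probability"
    "HOL-Computational_Algebra.Polynomial"
    "HOL-Library.Log_Nat"
begin

section \<open>Influence maximization with augmentation\<close>

record 'v network =
  verts :: "'v set"
  edges :: "('v \<times> 'v) set"
  prob :: "'v \<times> 'v \<Rightarrow> real"
  cost :: "'v \<times> 'v \<Rightarrow> real"

definition wf_network :: "'v network \<Rightarrow> bool" where
  "wf_network G \<longleftrightarrow> finite (verts G) \<and> edges G \<subseteq> verts G \<times> verts G \<and>
     (\<forall>e \<in> verts G \<times> verts G. prob G e \<in> {0..1} \<and> cost G e \<in> {0..1})"

definition augment :: "'v network \<Rightarrow> ('v \<times> 'v) set \<Rightarrow> 'v network" where
  "augment G S = G\<lparr>edges := edges G \<union> S\<rparr>"

text \<open>A live-edge graph has the vertex set of \<open>G\<close>, so it is given by its edge set.\<close>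

definition live_edge_pmf :: "'v network \<Rightarrow> ('v \<times> 'v) set pmf" where
  "live_edge_pmf G =
     map_pmf (\<lambda>f. {e \<in> edges G. f e}) (Pi_pmf (edges G) False (\<lambda>e. bernoulli_pmf (prob G e)))"

lemma pmf_live_edge_pmf:
  assumes "wf_network G" "X \<subseteq> edges G"
 shows "pmf (live_edge_pmf G) X = (\<Prod>e\<in>X. prob G e) * (\<Prod>e\<in>edges G - X. 1 - prob G e)"
proof -
  have f: "finite (edges G)" using assms(1) unfolding wf_network_def by (meson finite_SigmaI finite_subset)
  let ?P = "Pi_pmf (edges G) False (\<lambda>e. bernoulli_pmf (prob G e))"
  have p: "e \<in> edges G \<Longrightarrow> 0 \<le> prob G e \<and> prob G e \<le> 1" for e using assms(1) unfolding wf_network_def by auto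
  have "pmf (live_edge_pmf G) X = measure ?P ((\<lambda>f. {e \<in> edges G. f e}) -` {X})"
    unfolding live_edge_pmf_def pmf_map by simp
  also have "\<dots> = measure ?P {\<lambda>e. e \<in> X}"
  proof (rule measure_prob_cong_0)
    fix x assume x: "x \<in> (\<lambda>f. {e \<in> edges G. f e}) -` {X} - {\<lambda>e. e \<in> X}"
    have "\<exists>e. e \<notin> edges G \<and> x e" using x by (auto simp: fun_eq_iff)
    then show "pmf ?P x = 0" using f by (auto simp: pmf_Pi)
  qed (use assms(2) in auto)
  also have "\<dots> = (\<Prod>e\<in>edges G. pmf (bernoulli_pmf (prob G e)) (e \<in> X))"
    using f assms(2) by (subst measure_pmf_single, subst pmf_Pi) auto
  also have "\<dots> = (\<Prod>e\<in>X. pmf (bernoulli_pmf (prob G e)) (e \<in> X)) * (\<Prod>e\<in>edges G - X. pmf (bernoulli_pmf (prob G e)) (e \<in> X))"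
    by (subst prod.subset_diff[OF assms(2) f]) (rule mult.commute)
  also have "\<dots> = (\<Prod>e\<in>X. prob G e) * (\<Prod>e\<in>edges G - X. 1 - prob G e)"
    using p assms(2) by (intro arg_cong2[of _ _ _ _ "(*)"] prod.cong) auto
  finally show ?thesis .
qed

definition live_edge_graphs :: "'v network \<Rightarrow> ('v \<times> 'v) set set" where
  "live_edge_graphs G = Pow (edges G)"

definition reachable :: "'v set \<Rightarrow> ('v \<times> 'v) set \<Rightarrow> 'v set" where
  "reachable A X = X\<^sup>* `` A"

definition spread :: "'v network \<Rightarrow> 'v set \<Rightarrow> ('v \<times> 'v) set \<Rightarrow> real" where
  "spread G A S =
     (\<Sum>X \<in> live_edge_graphs (augment G S).
        pmf (live_edge_pmf (augment G S)) X * real (card (reachable A X)))"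

definition solution_cost :: "'v network \<Rightarrow> 'v set \<Rightarrow> ('v \<times> 'v) set \<Rightarrow> real" where
  "solution_cost G A S = real (card A) + (\<Sum>e\<in>S. cost G e)"

definition feasible :: "'v network \<Rightarrow> nat \<Rightarrow> 'v set \<Rightarrow> ('v \<times> 'v) set \<Rightarrow> bool" where
  "feasible G k A S \<longleftrightarrow>
     A \<subseteq> verts G \<and> S \<subseteq> (A \<times> verts G) - edges G \<and> solution_cost G A S \<le> real k"

definition optimal :: "'v network \<Rightarrow> nat \<Rightarrow> 'v set \<Rightarrow> ('v \<times> 'v) set \<Rightarrow> bool" where
  "optimal G k A S \<longleftrightarrow>
     feasible G k A S \<and> (\<forall>A' S'. feasible G k A' S' \<longrightarrow> spread G A' S' \<le> spread G A S)"

lemma optimal_exists: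
  assumes "wf_network G" shows "\<exists>A S. optimal G k A S"
proof -
  let ?F = "{x. feasible G k (fst x) (snd x)}" and ?f = "\<lambda>x. spread G (fst x) (snd x)"
  have "finite (Pow (verts G) \<times> Pow (verts G \<times> verts G))"
    using assms by (simp add: wf_network_def)
  moreover have "?F \<subseteq> Pow (verts G) \<times> Pow (verts G \<times> verts G)"
    by (auto simp: feasible_def)
  ultimately have fin: "finite (?f ` ?F)"
    by (intro finite_imageI) (rule finite_subset)
  have "({}, {}) \<in> ?F"
    by (simp add: feasible_def solution_cost_def)
  then have "?f ` ?F \<noteq> {}"
    by blast
  from Max_in[OF fin this] obtain x where x: "x \<in> ?F" "?f x = Max (?f ` ?F)"
    by (metis (no_types, lifting) imageE)
  have "optimal G k (fst x) (snd x)"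
    unfolding optimal_def
  proof (intro conjI allI impI)
    show "feasible G k (fst x) (snd x)" using x(1) by simp
  next
    fix A S assume "feasible G k A S"
    then have "?f (A, S) \<in> ?f ` ?F" by (intro imageI) simp
    then show "spread G A S \<le> ?f x" unfolding x(2) using Max_ge[OF fin] by simp
  qed
  then show ?thesis by blast
qed


section \<open>Oracle random access machines\<close>

text \<open>
  Algorithms are while programs over a random access memory made of finitely many (as many as the
  program mentions) unbounded arrays of natural numbers and of numbers.  Only natural numbers are
  used as addresses, and there is no conversion (rounding) from numbers to natural numbers.
  The constants of a program are rational.

  Natural numbers are always charged by their bit length.  The charge \<open>w\<close> for the other numbers
  is a parameter: \<open>\<lambda>_. 1\<close> counts arithmetic operations on reals, and \<open>bit_size\<close> is the logarithmic
  cost criterion on rationals, for which running times agree with those of Turing machines up to a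
  polynomial.
\<close>

record memory =
  nats :: "nat \<Rightarrow> nat \<Rightarrow> nat"
  nums :: "nat \<Rightarrow> nat \<Rightarrow> real"

datatype nexp =
    NConst nat
  | NLoad nat nexp
  | NPlus nexp nexp
  | NMinus nexp nexp
  | NTimes nexp nexp
  | NDiv nexp nexp

datatype rexp =
    RConst rat
  | RLoad nat nexp
  | ROfNat nexp
  | RPlus rexp rexp
  | RMinus rexp rexp
  | RTimes rexp rexp
  | RDivide rexp rexp

datatype test = NLess nexp nexp | RLess rexp rexp

text \<open>In an assignment, the first argument is the array and the second one is the index.\<close>

datatype com =
    Skip
  | NAssign nat nexp nexp
  | RAssign nat nexp rexp
  | Query nat nat nat
  | Seq com com
  | If test com com
  | While test com

primrec nval :: "memory \<Rightarrow> nexp \<Rightarrow> nat" where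
  "nval m (NConst n) = n"
| "nval m (NLoad x e) = nats m x (nval m e)"
| "nval m (NPlus d e) = nval m d + nval m e"
| "nval m (NMinus d e) = nval m d - nval m e"
| "nval m (NTimes d e) = nval m d * nval m e"
| "nval m (NDiv d e) = nval m d div nval m e"

primrec rval :: "memory \<Rightarrow> rexp \<Rightarrow> real" where
  "rval m (RConst q) = of_rat q"
| "rval m (RLoad x e) = nums m x (nval m e)"
| "rval m (ROfNat e) = real (nval m e)"
| "rval m (RPlus d e) = rval m d + rval m e"
| "rval m (RMinus d e) = rval m d - rval m e"
| "rval m (RTimes d e) = rval m d * rval m e"
| "rval m (RDivide d e) = rval m d / rval m e"

primrec holds :: "memory \<Rightarrow> test \<Rightarrow> bool" where
  "holds m (NLess d e) \<longleftrightarrow> nval m d < nval m e"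
| "holds m (RLess d e) \<longleftrightarrow> rval m d < rval m e"

definition nat_size :: "nat \<Rightarrow> nat" where
  "nat_size n = 1 + floorlog 2 n"

definition rat_size :: "rat \<Rightarrow> nat" where
  "rat_size q = (case quotient_of q of (a, b) \<Rightarrow> nat_size (nat \<bar>a\<bar>) + nat_size (nat b))"

text \<open>Only meaningful on rational numbers.\<close>

definition bit_size :: "real \<Rightarrow> nat" where
  "bit_size x = rat_size (THE q. of_rat q = x)"

primrec ntime :: "memory \<Rightarrow> nexp \<Rightarrow> nat" where
  "ntime m (NConst n) = nat_size n"
| "ntime m (NLoad x e) = ntime m e + nat_size (nval m (NLoad x e))"
| "ntime m (NPlus d e) = ntime m d + ntime m e + nat_size (nval m (NPlus d e))"
| "ntime m (NMinus d e) = ntime m d + ntime m e + nat_size (nval m (NMinus d e))"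
| "ntime m (NTimes d e) = ntime m d + ntime m e + nat_size (nval m (NTimes d e))"
| "ntime m (NDiv d e) = ntime m d + ntime m e + nat_size (nval m (NDiv d e))"

primrec rtime :: "(real \<Rightarrow> nat) \<Rightarrow> memory \<Rightarrow> rexp \<Rightarrow> nat" where
  "rtime w m (RConst q) = w (of_rat q)"
| "rtime w m (RLoad x e) = ntime m e + w (rval m (RLoad x e))"
| "rtime w m (ROfNat e) = ntime m e + w (rval m (ROfNat e))"
| "rtime w m (RPlus d e) = rtime w m d + rtime w m e + w (rval m (RPlus d e))"
| "rtime w m (RMinus d e) = rtime w m d + rtime w m e + w (rval m (RMinus d e))"
| "rtime w m (RTimes d e) = rtime w m d + rtime w m e + w (rval m (RTimes d e))"
| "rtime w m (RDivide d e) = rtime w m d + rtime w m e + w (rval m (RDivide d e))"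

primrec test_time :: "(real \<Rightarrow> nat) \<Rightarrow> memory \<Rightarrow> test \<Rightarrow> nat" where
  "test_time w m (NLess d e) = 1 + ntime m d + ntime m e"
| "test_time w m (RLess d e) = 1 + rtime w m d + rtime w m e"

definition nset :: "memory \<Rightarrow> nat \<Rightarrow> nat \<Rightarrow> nat \<Rightarrow> memory" where
  "nset m x i v = m\<lparr>nats := (nats m)(x := (nats m x)(i := v))\<rparr>"

definition rset :: "memory \<Rightarrow> nat \<Rightarrow> nat \<Rightarrow> real \<Rightarrow> memory" where
  "rset m x i v = m\<lparr>nums := (nums m)(x := (nums m x)(i := v))\<rparr>"

text \<open>
  Sets of vertices and of edges over \<open>{..<n}\<close> are represented by arrays, with zero standing for
  non-membership; pairs \<open>(u, v)\<close> are stored at index \<open>u * n + v\<close>.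
\<close>

definition node_set :: "nat \<Rightarrow> (nat \<Rightarrow> nat) \<Rightarrow> nat set" where
  "node_set n a = {v. v < n \<and> a v \<noteq> 0}"

definition edge_set :: "nat \<Rightarrow> (nat \<Rightarrow> nat) \<Rightarrow> (nat \<times> nat) set" where
  "edge_set n a = {(u, v). u < n \<and> v < n \<and> a (u * n + v) \<noteq> 0}"

text \<open>
  \<open>exec n \<sigma> w c m m' t\<close>: program \<open>c\<close> started in memory \<open>m\<close> halts in memory \<open>m'\<close> after time \<open>t\<close>.
  \<open>Query x y z\<close> asks the oracle \<open>\<sigma>\<close> about the node set in array \<open>x\<close> and the edge set in array \<open>y\<close>
  and puts the answer into cell 0 of array \<open>z\<close>; it is charged the length of query and answer.
\<close>

inductive exec ::
  "nat \<Rightarrow> (nat set \<Rightarrow> (nat \<times> nat) set \<Rightarrow> real) \<Rightarrow> (real \<Rightarrow> nat) \<Rightarrow>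
    com \<Rightarrow> memory \<Rightarrow> memory \<Rightarrow> nat \<Rightarrow> bool"
  for n :: nat and \<sigma> :: "nat set \<Rightarrow> (nat \<times> nat) set \<Rightarrow> real" and w :: "real \<Rightarrow> nat"
where
  Skip: "exec n \<sigma> w Skip m m 1"
| NAssign: "exec n \<sigma> w (NAssign x i e) m (nset m x (nval m i) (nval m e))
     (1 + ntime m i + ntime m e)"
| RAssign: "exec n \<sigma> w (RAssign x i e) m (rset m x (nval m i) (rval m e))
     (1 + ntime m i + rtime w m e)"
| Query: "a = \<sigma> (node_set n (nats m x)) (edge_set n (nats m y)) \<Longrightarrow>
     exec n \<sigma> w (Query x y z) m (rset m z 0 a) (1 + n + n * n + w a)"
| Seq: "exec n \<sigma> w c m m' t \<Longrightarrow> exec n \<sigma> w d m' m'' t' \<Longrightarrow>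
     exec n \<sigma> w (Seq c d) m m'' (t + t')"
| IfTrue: "holds m b \<Longrightarrow> exec n \<sigma> w c m m' t \<Longrightarrow>
     exec n \<sigma> w (If b c d) m m' (test_time w m b + t)"
| IfFalse: "\<not> holds m b \<Longrightarrow> exec n \<sigma> w d m m' t \<Longrightarrow>
     exec n \<sigma> w (If b c d) m m' (test_time w m b + t)"
| WhileFalse: "\<not> holds m b \<Longrightarrow> exec n \<sigma> w (While b c) m m (test_time w m b)"
| WhileTrue: "holds m b \<Longrightarrow> exec n \<sigma> w c m m' t \<Longrightarrow> exec n \<sigma> w (While b c) m' m'' t' \<Longrightarrow>
     exec n \<sigma> w (While b c) m m'' (test_time w m b + t + t')"

inductive_cases exec_SkipE: "exec n \<sigma> w Skip m m' t"
inductive_cases exec_NAssignE: "exec n \<sigma> w (NAssign x i e) m m' t"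
inductive_cases exec_RAssignE: "exec n \<sigma> w (RAssign x i e) m m' t"
inductive_cases exec_QueryE: "exec n \<sigma> w (Query x y z) m m' t"
inductive_cases exec_SeqE: "exec n \<sigma> w (Seq c d) m m' t"
inductive_cases exec_IfE: "exec n \<sigma> w (If b c d) m m' t"
inductive_cases exec_WhileE: "exec n \<sigma> w (While b c) m m' t"

lemma exec_deterministic:
  "exec n \<sigma> w c m m1 t1 \<Longrightarrow> exec n \<sigma> w c m m2 t2 \<Longrightarrow> m1 = m2 \<and> t1 = t2"
proof (induction arbitrary: m2 t2 rule: exec.induct)
  case (Seq c m m' t d m'' t')
  from Seq.prems show ?case by (rule exec_SeqE) (use Seq.IH in blast)
next
  case (IfTrue m b c m' t d)
  from IfTrue.prems show ?case by (rule exec_IfE) (use IfTrue.hyps IfTrue.IH in blast)+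
next
  case (IfFalse m b d m' t c)
  from IfFalse.prems show ?case by (rule exec_IfE) (use IfFalse.hyps IfFalse.IH in blast)+
next
  case (WhileTrue m b c m' t m'' t')
  from WhileTrue.prems show ?case by (rule exec_WhileE) (use WhileTrue.hyps WhileTrue.IH in blast)+
next
  case (WhileFalse m b c)
  from WhileFalse.prems show ?case by (rule exec_WhileE) (use WhileFalse.hyps in blast)+
next
  case Skip
  then show ?case by (rule exec_SkipE) simp
next
  case NAssign
  then show ?case by (rule exec_NAssignE) simp
next
  case RAssign
  then show ?case by (rule exec_RAssignE) simp
next
  case Query
  from Query.prems show ?case by (rule exec_QueryE) (simp add: Query.hyps)
qed


section \<open>Polynomial-time approximation algorithms for BIMA\<close>

text \<open>Inputs of algorithms are networks whose nodes are numbered consecutively.\<close>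

definition input_network :: "nat network \<Rightarrow> bool" where
  "input_network G \<longleftrightarrow> wf_network G \<and> verts G = {..<card (verts G)}"

text \<open>
  Input: \<open>|V|\<close> and \<open>k\<close> in natural-number array 0, the adjacency matrix in natural-number array 1,
  \<open>p\<close> and \<open>c\<close> in number arrays 0 and 1.
\<close>

definition input_memory :: "nat network \<Rightarrow> nat \<Rightarrow> memory" where
  "input_memory G k = (let n = card (verts G) in
     \<lparr>nats = (\<lambda>x i.
        if x = 0 \<and> i = 0 then n
        else if x = 0 \<and> i = 1 then k
        else if x = 1 \<and> i < n * n \<and> (i div n, i mod n) \<in> edges G then 1
        else 0),
      nums = (\<lambda>x i.
        if x = 0 \<and> i < n * n then prob G (i div n, i mod n)
        else if x = 1 \<and> i < n * n then cost G (i div n, i mod n)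
        else 0)\<rparr>)"

definition output_nodes :: "nat network \<Rightarrow> memory \<Rightarrow> nat set" where
  "output_nodes G m = node_set (card (verts G)) (nats m 2)"

definition output_edges :: "nat network \<Rightarrow> memory \<Rightarrow> (nat \<times> nat) set" where
  "output_edges G m = edge_set (card (verts G)) (nats m 3)"

definition runs :: "(real \<Rightarrow> nat) \<Rightarrow> com \<Rightarrow> nat network \<Rightarrow> nat \<Rightarrow> memory \<Rightarrow> nat \<Rightarrow> bool" where
  "runs w alg G k m t \<longleftrightarrow> exec (card (verts G)) (spread G) w alg (input_memory G k) m t"

definition input_size :: "(real \<Rightarrow> nat) \<Rightarrow> nat network \<Rightarrow> nat \<Rightarrow> nat" where
  "input_size w G k = nat_size (card (verts G)) + nat_size k +
     (\<Sum>e \<in> verts G \<times> verts G. 1 + w (prob G e) + w (cost G e))"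

definition polynomial_time_on :: "(real \<Rightarrow> nat) \<Rightarrow> nat network set \<Rightarrow> com \<Rightarrow> bool" where
  "polynomial_time_on w \<G> alg \<longleftrightarrow>
     (\<exists>q :: nat poly. \<forall>G\<in>\<G>. \<forall>k. \<exists>m t. runs w alg G k m t \<and> t \<le> poly q (input_size w G k))"

text \<open>
  On arbitrary real inputs, the number of arithmetic operations is polynomial; on rational inputs,
  so is the number of bit operations.
\<close>

definition polynomial_time :: "com \<Rightarrow> bool" where
  "polynomial_time alg \<longleftrightarrow>
     polynomial_time_on (\<lambda>_. 1) {G. input_network G} alg \<and>
     polynomial_time_on bit_size
       {G. input_network G \<and> (\<forall>e \<in> verts G \<times> verts G. prob G e \<in> \<rat> \<and> cost G e \<in> \<rat>)} alg"

definition BIMA_approximation :: "real \<Rightarrow> com \<Rightarrow> bool" where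
  "BIMA_approximation \<rho> alg \<longleftrightarrow>
     (\<forall>G k. input_network G \<longrightarrow>
        (\<exists>m t. runs (\<lambda>_. 1) alg G k m t \<and>
           feasible G k (output_nodes G m) (output_edges G m) \<and>
           (\<forall>A S. optimal G k A S \<longrightarrow>
              spread G (output_nodes G m) (output_edges G m) \<ge> \<rho> * spread G A S)))"

end

(*
  An edge out of a seed acts only by activating its head, so for S <= A x V the spread is the expected
  size of a union indexed by A and S: a monotone submodular function of the set of nodes and edges.
  A solution is a union of stars (a, T), a seed with some of its edges, of total cost |A| + c(S).

  An outer greedy algorithm repeatedly adds the star of (approximately) largest ratio of gain to cost
  1 + c(T), until the accounted costs reach k. The stars are found by an inner greedy algorithm that
  starts with the free edges of a center and adds its edges in the order of their densities; the stars
  made of a center, its free edges and one more edge are candidates, too. Some candidate has at least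
  beta = (1 - 1/e) / 3 times the best density. Hence the outer greedy solution reaches
  (1 - exp(-beta)) OPT with its last star, which may exceed the budget; the better one of that star
  and the solution before it has half of that value. If k >= |V|, all nodes are taken as seeds.

  All numbers that occur are sums of costs and spreads or products of two such numbers, so they have
  polynomial size if the input is rational.
*)
theory Submission
  imports Defs
begin

section \<open>Influence as a coverage function\<close>

text \<open>Stars remove this dependency, but a center has exponentially many of them, hence the
  inner greedy and its loss. The 3 in beta arises when the inner star outgrows the star
  \<open>Q\<close> that it is compared with: the star before the critical edge and the center with
  that edge alone cost at most \<open>1 + weight Q\<close> and 2, together at most three times
  \<open>1 + weight Q\<close>. This is where edge costs of at most 1, the price of a seed, are used.
  Overlapping stars are charged twice by the outer loop, which only overestimates the cost. Each
  star costs at least 1, so there are at most k rounds; as k is given in binary, this is polynomial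
  only after the case k >= |V| is split off. Densities are compared by cross multiplication, which
  avoids quotients. Numerically beta is about 0.21 and the factor about 0.095; the value 0.09 leaves
  room for crude estimates of exp.\<close>

locale monotone_submodular =
  fixes F :: "'i set \<Rightarrow> real"
  assumes empty: "F {} = 0"
    and mono: "I \<subseteq> J \<Longrightarrow> F I \<le> F J"
    and submodular: "F (I \<union> J) + F (I \<inter> J) \<le> F I + F J"
begin

lemma nonneg: "0 \<le> F I"
  using mono[of "{}" I] empty by simp

lemma subadditive: "F (I \<union> J) \<le> F I + F J"
  using submodular[of I J] nonneg[of "I \<inter> J"] by linarith

text \<open>Submodularity is applied to \<open>J\<close> and \<open>I \<union> K\<close>: their
  union is \<open>J \<union> K\<close>, and their intersection contains \<open>I\<close>.\<close>

lemma gain_antimono: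
  assumes "I \<subseteq> J"
  shows "F (J \<union> K) - F J \<le> F (I \<union> K) - F I"
proof -
  have "F (J \<union> K) + F (J \<inter> (I \<union> K)) \<le> F J + F (I \<union> K)"
    using submodular[of J "I \<union> K"] assms by (simp add: Un_absorb2 Un_assoc[symmetric])
  moreover have "F I \<le> F (J \<inter> (I \<union> K))"
    using assms by (intro mono) auto
  ultimately show ?thesis by linarith
qed

text \<open>When the sets \<open>J a\<close> are added one by one, each increment is taken over a
  base containing \<open>I\<close>, so diminishing returns bound it by the increment over
  \<open>I\<close> alone.\<close>

lemma gain_UN:
  assumes "finite A"
  shows "F (I \<union> (\<Union>a\<in>A. J a)) - F I \<le> (\<Sum>a\<in>A. F (I \<union> J a) - F I)"
  using assms
proof (induction A)
  case (insert a A)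
  have "F (I \<union> (\<Union>a\<in>A. J a) \<union> J a) - F (I \<union> (\<Union>a\<in>A. J a)) \<le> F (I \<union> J a) - F I"
    by (rule gain_antimono) auto
  moreover have "I \<union> (\<Union>a\<in>insert a A. J a) = I \<union> (\<Union>a\<in>A. J a) \<union> J a"
    by auto
  ultimately show ?case
    using insert by simp
qed simp

lemma gain_singletons:
  assumes "finite K"
  shows "F (I \<union> K) - F I \<le> (\<Sum>x\<in>K. F (insert x I) - F I)"
  using gain_UN[OF assms, of I "\<lambda>x. {x}"] by simp

end

section \<open>Coupling of all augmentations on one random graph\<close>

definition cover :: "('v \<times> 'v) set \<Rightarrow> 'v set \<Rightarrow> ('v \<times> 'v) set \<Rightarrow> 'v + 'v \<times> 'v \<Rightarrow> 'v set" where
  "cover E V X i = (case i of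
     Inl a \<Rightarrow> reachable {a} (X \<inter> E) \<inter> V
   | Inr (u, v) \<Rightarrow> if (u, v) \<in> X then reachable {v} (X \<inter> E) \<inter> V else {})"

definition items :: "'v set \<Rightarrow> ('v \<times> 'v) set \<Rightarrow> ('v + 'v \<times> 'v) set" where
  "items A S = Inl ` A \<union> Inr ` S"

text \<open>One random graph on all pairs serves every choice of added edges, since the live-edge
  graph of an augmented network is a restriction of it. On this common probability space, spreads
  for different edge sets can be compared pointwise.\<close>

definition full_network :: "'v network \<Rightarrow> 'v network" where
  "full_network G = G\<lparr>edges := verts G \<times> verts G\<rparr>"

text \<open>In \<open>cover\<close> only original edges propagate, and an added edge is a random
  extra seed at its head. The intersection with the vertex set there keeps all covers finite, so
  that submodularity holds for arbitrary item sets and not only for those of legal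
  solutions.\<close>

definition coverage :: "'v network \<Rightarrow> ('v + 'v \<times> 'v) set \<Rightarrow> real" where
  "coverage G I = measure_pmf.expectation (live_edge_pmf (full_network G))
     (\<lambda>X. real (card (\<Union>i\<in>I. cover (edges G) (verts G) X i)))"

lemma items_Un: "items A S \<union> items B T = items (A \<union> B) (S \<union> T)"
  by (auto simp: items_def)

lemma items_empty [simp]: "items {} {} = {}"
  by (simp add: items_def)

lemma items_mono: "A \<subseteq> B \<Longrightarrow> S \<subseteq> T \<Longrightarrow> items A S \<subseteq> items B T"
  by (auto simp: items_def)

lemma Inl_in_items [simp]: "Inl a \<in> items A S \<longleftrightarrow> a \<in> A"
  by (auto simp: items_def)

lemma Inr_in_items [simp]: "Inr e \<in> items A S \<longleftrightarrow> e \<in> S"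
  by (auto simp: items_def)

lemma finite_set_live_edge_pmf:
  assumes "finite (edges G)"
  shows "finite (set_pmf (live_edge_pmf G))"
proof -
  have "set_pmf (live_edge_pmf G) \<subseteq> Pow (edges G)"
    by (auto simp: live_edge_pmf_def)
  then show ?thesis
    using assms by (meson finite_Pow_iff finite_subset)
qed

lemma wf_network_finite: "wf_network G \<Longrightarrow> finite (verts G) \<and> finite (edges G)"
  unfolding wf_network_def by (meson finite_SigmaI finite_subset)

lemma wf_full_network: "wf_network G \<Longrightarrow> wf_network (full_network G)"
  by (simp add: wf_network_def full_network_def)

text \<open>For a fixed live-edge graph the size of a union is submodular in the index set, because
  the union over \<open>I \<inter> J\<close> lies in the intersection of the two unions. Taking
  expectations preserves this.\<close>

lemma monotone_submodular_coverage:
  assumes "wf_network G"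
  shows "monotone_submodular (coverage G)"
proof -
  let ?P = "live_edge_pmf (full_network G)"
  let ?U = "\<lambda>I X. \<Union>i\<in>I. cover (edges G) (verts G) X i"
  have fin: "finite (set_pmf ?P)"
    using assms wf_full_network wf_network_finite by (blast intro: finite_set_live_edge_pmf)
  have int: "integrable (measure_pmf ?P) f" for f :: "_ \<Rightarrow> real"
    by (rule integrable_measure_pmf_finite[OF fin])
  have sub: "?U I X \<subseteq> verts G" for I X
    by (auto simp: cover_def split: sum.splits if_splits)
  have finU: "finite (?U I X)" for I X
    using finite_subset[OF sub] assms by (simp add: wf_network_def)
  show ?thesis
  proof
    show "coverage G {} = 0"
      by (simp add: coverage_def)
    show "coverage G I \<le> coverage G J" if "I \<subseteq> J" for I J
      unfolding coverage_def using that
      by (intro integral_mono int) (auto intro!: card_mono finU)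
    show "coverage G (I \<union> J) + coverage G (I \<inter> J) \<le> coverage G I + coverage G J" for I J
    proof -
      have "real (card (?U (I \<union> J) X)) + real (card (?U (I \<inter> J) X))
          \<le> real (card (?U I X)) + real (card (?U J X))" for X
      proof -
        have "card (?U (I \<union> J) X) + card (?U I X \<inter> ?U J X) = card (?U I X) + card (?U J X)"
          unfolding UN_Un by (rule card_Un_Int[symmetric]) (rule finU)+
        moreover have "card (?U (I \<inter> J) X) \<le> card (?U I X \<inter> ?U J X)"
          by (intro card_mono finite_Int disjI1 finU) auto
        ultimately show ?thesis by linarith
      qed
      then show ?thesis
        unfolding coverage_def
        by (subst (1 2) Bochner_Integration.integral_add[symmetric, OF int int])
          (intro integral_mono int)
    qed
  qed
qed

text \<open>The coins of different edges are independent, so forgetting those outside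
  \<open>F\<close> leaves the product distribution on \<open>F\<close>.\<close>

lemma live_edge_pmf_restrict:
  assumes "wf_network G" "F \<subseteq> verts G \<times> verts G"
  shows "live_edge_pmf (G\<lparr>edges := F\<rparr>) = map_pmf (\<lambda>X. X \<inter> F) (live_edge_pmf (full_network G))"
proof -
  have "Pi_pmf F False (\<lambda>e. bernoulli_pmf (prob G e)) =
      map_pmf (\<lambda>f x. if x \<in> F then f x else False)
        (Pi_pmf (verts G \<times> verts G) False (\<lambda>e. bernoulli_pmf (prob G e)))"
    using assms by (intro Pi_pmf_subset) (auto simp: wf_network_def)
  then show ?thesis
    using assms(2)
    by (auto simp: live_edge_pmf_def full_network_def map_pmf_comp intro!: map_pmf_cong)
qed

lemma spread_eq_expectation:
  assumes "wf_network G" "S \<subseteq> verts G \<times> verts G"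
  shows "spread G A S = measure_pmf.expectation (live_edge_pmf (full_network G))
     (\<lambda>X. real (card (reachable A (X \<inter> (edges G \<union> S)))))"
proof -
  let ?F = "edges G \<union> S"
  have F: "?F \<subseteq> verts G \<times> verts G" "finite ?F"
    using assms wf_network_finite[OF assms(1)]
    by (simp_all add: wf_network_def finite_subset[OF assms(2)])
  have "set_pmf (live_edge_pmf (augment G S)) \<subseteq> Pow ?F"
    by (auto simp: live_edge_pmf_def augment_def)
  then have "spread G A S = measure_pmf.expectation (live_edge_pmf (augment G S)) (\<lambda>X. real (card (reachable A X)))"
    unfolding spread_def live_edge_graphs_def
    using F(2) by (subst integral_measure_pmf_real[where A = "Pow ?F"])
      (auto simp: augment_def mult.commute)
  also have "live_edge_pmf (augment G S) = map_pmf (\<lambda>X. X \<inter> ?F) (live_edge_pmf (full_network G))"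
    unfolding augment_def by (rule live_edge_pmf_restrict[OF assms(1) F(1)])
  finally show ?thesis
    by simp
qed

text \<open>
  A live edge out of a seed acts only by activating its head, so it can be replaced by a further
  (random) seed.
\<close>

lemma reachable_added_edges:
  assumes "wf_network G" "A \<subseteq> verts G" "S \<subseteq> A \<times> verts G"
  shows "reachable A (X \<inter> (edges G \<union> S)) = (\<Union>i\<in>items A S. cover (edges G) (verts G) X i)"
proof -
  let ?E = "edges G" and ?V = "verts G"
  \<comment> \<open>The seeds together with the heads of live added edges: from this set the
    original edges alone reach everything.\<close>
  let ?B = "A \<union> {v. \<exists>u. (u, v) \<in> S \<inter> X}"
  have E: "?E \<subseteq> ?V \<times> ?V"
    using assms(1) by (simp add: wf_network_def)
  have BV: "?B \<subseteq> ?V"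
    using assms by auto
  have "(\<Union>i\<in>items A S. cover ?E ?V X i) = reachable ?B (X \<inter> ?E) \<inter> ?V"
    unfolding items_def cover_def reachable_def
    by (auto split: if_splits; blast)
  also have "\<dots> = reachable ?B (X \<inter> ?E)"
  proof -
    have "v \<in> ?V" if "(u, v) \<in> (X \<inter> ?E)\<^sup>*" "u \<in> ?B" for u v
      using that E BV by (induction rule: rtrancl_induct) auto
    then show ?thesis
      by (auto simp: reachable_def)
  qed
  also have "\<dots> = reachable A (X \<inter> (?E \<union> S))"
  proof
    have "(X \<inter> ?E)\<^sup>* \<subseteq> (X \<inter> (?E \<union> S))\<^sup>*"
      by (rule rtrancl_mono) auto
    moreover have "\<exists>a\<in>A. (a, v) \<in> (X \<inter> (?E \<union> S))\<^sup>*" if "v \<in> ?B" for v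
      using that assms(3) by blast
    ultimately show "reachable ?B (X \<inter> ?E) \<subseteq> reachable A (X \<inter> (?E \<union> S))"
      unfolding reachable_def by (blast intro: rtrancl_trans)
  next
    have "v \<in> reachable ?B (X \<inter> ?E)" if "(u, v) \<in> (X \<inter> (?E \<union> S))\<^sup>*" "u \<in> A" for u v
      using that
    proof (induction rule: rtrancl_induct)
      case (step v w)
      \<comment> \<open>A live added edge makes the path before it irrelevant, since its head
        already belongs to \<open>?B\<close>.\<close>
      then consider "(v, w) \<in> X \<inter> ?E" | "w \<in> ?B"
        by auto
      then show ?case
        using step by cases (auto simp: reachable_def intro: rtrancl_into_rtrancl)
    qed (auto simp: reachable_def)
    then show "reachable A (X \<inter> (?E \<union> S)) \<subseteq> reachable ?B (X \<inter> ?E)"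
      by (auto simp: reachable_def)
  qed
  finally show ?thesis ..
qed

text \<open>The tails of \<open>S\<close> have to lie in \<open>A\<close>: an edge with another tail
  would act only once its tail is active, whereas its item always contributes when the edge is
  live.\<close>

lemma spread_eq_coverage:
  assumes "wf_network G" "A \<subseteq> verts G" "S \<subseteq> A \<times> verts G"
  shows "spread G A S = coverage G (items A S)"
proof -
  have "S \<subseteq> verts G \<times> verts G"
    using assms by auto
  then show ?thesis
    unfolding coverage_def
    by (simp add: spread_eq_expectation[OF assms(1)] reachable_added_edges[OF assms])
qed

lemma reachable_subset:
  assumes "A \<subseteq> V" "X \<subseteq> V \<times> V"
  shows "reachable A X \<subseteq> V"
proof -
  have "v \<in> V" if "(u, v) \<in> X\<^sup>*" "u \<in> A" for u v
    using that assms by (induction rule: rtrancl_induct) auto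
  then show ?thesis
    by (auto simp: reachable_def)
qed

lemma spread_bounds:
  assumes "wf_network G" "A \<subseteq> verts G" "S \<subseteq> verts G \<times> verts G"
  shows "0 \<le> spread G A S" "spread G A S \<le> real (card (verts G))"
proof -
  let ?P = "live_edge_pmf (full_network G)"
  have int: "integrable (measure_pmf ?P) f" for f :: "_ \<Rightarrow> real"
    using assms wf_full_network wf_network_finite
    by (blast intro: integrable_measure_pmf_finite finite_set_live_edge_pmf)
  have "card (reachable A (X \<inter> (edges G \<union> S))) \<le> card (verts G)" for X
    using assms by (intro card_mono reachable_subset) (auto simp: wf_network_def)
  then have "measure_pmf.expectation ?P (\<lambda>X. real (card (reachable A (X \<inter> (edges G \<union> S)))))
      \<le> measure_pmf.expectation ?P (\<lambda>X. real (card (verts G)))"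
    by (intro integral_mono int) auto
  then show "spread G A S \<le> real (card (verts G))"
    by (simp add: spread_eq_expectation[OF assms(1,3)])
  show "0 \<le> spread G A S"
    by (simp add: spread_eq_expectation[OF assms(1,3)])
qed

lemma spread_all_nodes:
  assumes "wf_network G"
  shows "spread G (verts G) {} = real (card (verts G))"
proof -
  have "reachable (verts G) (X \<inter> edges G) = verts G" for X
    using assms by (intro equalityI reachable_subset)
      (auto simp: wf_network_def reachable_def)
  then show ?thesis
    by (simp add: spread_eq_expectation[OF assms])
qed

section \<open>A calculus for running times\<close>

text \<open>Time is charged by the size of each intermediate value. If all of them respect one
  bound, the time of an expression is at most its length times a constant; \<open>nfit\<close>,
  \<open>rfit\<close> and \<open>tfit\<close> are these bounds for the three kinds of
  expressions.\<close>

primrec nfit :: "nat \<Rightarrow> memory \<Rightarrow> nexp \<Rightarrow> bool" where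
  "nfit K m (NConst c) \<longleftrightarrow> c \<le> K"
| "nfit K m (NLoad x e) \<longleftrightarrow> nfit K m e \<and> nats m x (nval m e) \<le> K"
| "nfit K m (NPlus d e) \<longleftrightarrow> nfit K m d \<and> nfit K m e \<and> nval m d + nval m e \<le> K"
| "nfit K m (NMinus d e) \<longleftrightarrow> nfit K m d \<and> nfit K m e \<and> nval m d - nval m e \<le> K"
| "nfit K m (NTimes d e) \<longleftrightarrow> nfit K m d \<and> nfit K m e \<and> nval m d * nval m e \<le> K"
| "nfit K m (NDiv d e) \<longleftrightarrow> nfit K m d \<and> nfit K m e \<and> nval m d div nval m e \<le> K"

primrec rfit :: "(real \<Rightarrow> nat) \<Rightarrow> nat \<Rightarrow> nat \<Rightarrow> memory \<Rightarrow> rexp \<Rightarrow> bool" where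
  "rfit w W K m (RConst q) \<longleftrightarrow> w (of_rat q) \<le> W"
| "rfit w W K m (RLoad x e) \<longleftrightarrow> nfit K m e \<and> w (nums m x (nval m e)) \<le> W"
| "rfit w W K m (ROfNat e) \<longleftrightarrow> nfit K m e \<and> w (real (nval m e)) \<le> W"
| "rfit w W K m (RPlus d e) \<longleftrightarrow> rfit w W K m d \<and> rfit w W K m e \<and> w (rval m d + rval m e) \<le> W"
| "rfit w W K m (RMinus d e) \<longleftrightarrow> rfit w W K m d \<and> rfit w W K m e \<and> w (rval m d - rval m e) \<le> W"
| "rfit w W K m (RTimes d e) \<longleftrightarrow> rfit w W K m d \<and> rfit w W K m e \<and> w (rval m d * rval m e) \<le> W"
| "rfit w W K m (RDivide d e) \<longleftrightarrow> rfit w W K m d \<and> rfit w W K m e \<and> w (rval m d / rval m e) \<le> W"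

primrec tfit :: "(real \<Rightarrow> nat) \<Rightarrow> nat \<Rightarrow> nat \<Rightarrow> memory \<Rightarrow> test \<Rightarrow> bool" where
  "tfit w W K m (NLess d e) \<longleftrightarrow> nfit K m d \<and> nfit K m e"
| "tfit w W K m (RLess d e) \<longleftrightarrow> rfit w W K m d \<and> rfit w W K m e"

primrec nlength :: "nexp \<Rightarrow> nat" where
  "nlength (NConst c) = 1"
| "nlength (NLoad x e) = Suc (nlength e)"
| "nlength (NPlus d e) = Suc (nlength d + nlength e)"
| "nlength (NMinus d e) = Suc (nlength d + nlength e)"
| "nlength (NTimes d e) = Suc (nlength d + nlength e)"
| "nlength (NDiv d e) = Suc (nlength d + nlength e)"

primrec rlength :: "rexp \<Rightarrow> nat" where
  "rlength (RConst q) = 1"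
| "rlength (RLoad x e) = Suc (nlength e)"
| "rlength (ROfNat e) = Suc (nlength e)"
| "rlength (RPlus d e) = Suc (rlength d + rlength e)"
| "rlength (RMinus d e) = Suc (rlength d + rlength e)"
| "rlength (RTimes d e) = Suc (rlength d + rlength e)"
| "rlength (RDivide d e) = Suc (rlength d + rlength e)"

primrec tlength :: "test \<Rightarrow> nat" where
  "tlength (NLess d e) = nlength d + nlength e"
| "tlength (RLess d e) = rlength d + rlength e"

lemma nat_size_mono: "a \<le> b \<Longrightarrow> nat_size a \<le> nat_size b"
  by (simp add: nat_size_def floorlog_mono)

lemma ntime_le: "nfit K m e \<Longrightarrow> ntime m e \<le> nlength e * nat_size K"
proof (induction e)
  case (NLoad x e)
  then show ?case
    using nat_size_mono[of "nats m x (nval m e)" K] by simp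
next
  case (NPlus d e)
  then show ?case
    using nat_size_mono[of "nval m d + nval m e" K] by (simp add: add_mult_distrib)
next
  case (NMinus d e)
  then show ?case
    using nat_size_mono[of "nval m d - nval m e" K] by (simp add: add_mult_distrib)
next
  case (NTimes d e)
  then show ?case
    using nat_size_mono[of "nval m d * nval m e" K] by (simp add: add_mult_distrib)
next
  case (NDiv d e)
  then show ?case
    using nat_size_mono[of "nval m d div nval m e" K] by (simp add: add_mult_distrib)
qed (simp add: nat_size_mono)

lemma rtime_le: "rfit w W K m e \<Longrightarrow> rtime w m e \<le> rlength e * (nat_size K + W)"
proof (induction e)
  case (RLoad x e)
  then show ?case
    using ntime_le[of K m e] by (simp add: add_mult_distrib2)
next
  case (ROfNat e)
  then show ?case
    using ntime_le[of K m e] by (simp add: add_mult_distrib2)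
qed (simp_all add: add_mult_distrib)

lemma test_time_le:
  assumes "tfit w W K m b"
  shows "test_time w m b \<le> 1 + tlength b * (nat_size K + W)"
proof (cases b)
  case (NLess d e)
  then have "ntime m d + ntime m e \<le> (nlength d + nlength e) * nat_size K"
    using assms ntime_le[of K m d] ntime_le[of K m e] by (simp add: add_mult_distrib)
  also have "\<dots> \<le> (nlength d + nlength e) * (nat_size K + W)"
    by simp
  finally show ?thesis
    using NLess by simp
next
  case (RLess d e)
  then show ?thesis
    using assms rtime_le[of w W K m d] rtime_le[of w W K m e] by (simp add: add_mult_distrib)
qed

section \<open>The program\<close>

abbreviation nvar :: "nat \<Rightarrow> nexp" where
  "nvar x \<equiv> NLoad x (NConst 0)"

abbreviation rvar :: "nat \<Rightarrow> rexp" where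
  "rvar x \<equiv> RLoad x (NConst 0)"

abbreviation nassign :: "nat \<Rightarrow> nexp \<Rightarrow> com" where
  "nassign x \<equiv> NAssign x (NConst 0)"

abbreviation rassign :: "nat \<Rightarrow> rexp \<Rightarrow> com" where
  "rassign x \<equiv> RAssign x (NConst 0)"

text \<open>The counter is an ordinary cell and the bound is reevaluated in every round, so
  reasoning about this loop requires a body that preserves the counter and a bound with a constant
  value.\<close>

definition repeat :: "nat \<Rightarrow> nexp \<Rightarrow> com \<Rightarrow> com" where
  "repeat x b c = Seq (nassign x (NConst 0))
     (While (NLess (nvar x) b) (Seq c (nassign x (NPlus (nvar x) (NConst 1)))))"

abbreviation n_exp :: nexp where
  "n_exp \<equiv> NLoad 0 (NConst 0)"

abbreviation k_exp :: nexp where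
  "k_exp \<equiv> NLoad 0 (NConst 1)"

text \<open>
  Arrays of natural numbers: 2/3 hold the nodes/edges of the best solution found so far, 4/5 the
  current greedy solution, 6/7 the star under consideration, 8/9 the densest star found, 10/11 a
  union to be evaluated; 12 is always zero; 13 to 17 are loop counters (14 is the center of the
  star, 15 its forced edge, 16 the head of the edge under consideration), and 18 is the head of the
  densest edge.

  Arrays of numbers: 2 is the last answer of the oracle, 3 the value of the best solution found so
  far, 4 the value and 5 the accounted cost of the greedy solution, 6/7 gain and cost of the densest
  star, 8 the cost of the star under consideration, 9 the value of its union with the greedy
  solution, 10/11 gain and cost of the densest edge.
\<close>

definition unite :: "nat \<Rightarrow> nat \<Rightarrow> nat \<Rightarrow> com" where
  "unite x y z = repeat 13 (NTimes n_exp n_exp)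
     (NAssign x (nvar 13)
       (NMinus (NPlus (NLoad y (nvar 13)) (NLoad z (nvar 13)))
         (NTimes (NLoad y (nvar 13)) (NLoad z (nvar 13)))))"

abbreviation copy :: "nat \<Rightarrow> nat \<Rightarrow> com" where
  "copy x y \<equiv> unite x y 12"

definition evaluate :: "nat \<Rightarrow> nat \<Rightarrow> com" where
  "evaluate x y = Seq (Query x y 2)
     (If (RLess (rvar 3) (rvar 2))
       (Seq (copy 2 x) (Seq (copy 3 y) (rassign 3 (rvar 2)))) Skip)"

abbreviation head_index :: nexp where
  "head_index \<equiv> NPlus (NTimes (nvar 14) n_exp) (nvar 16)"

text \<open>Tests offer only strict comparison. With truncated subtraction this is |d - e|, which is
  positive iff the two values differ.\<close>

abbreviation distance :: "nexp \<Rightarrow> nexp \<Rightarrow> nexp" where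
  "distance d e \<equiv> NPlus (NMinus d e) (NMinus e d)"

definition add_edge :: com where
  "add_edge = Seq (NAssign 7 head_index (NConst 1)) (rassign 8 (RPlus (rvar 8) (RLoad 1 head_index)))"

text \<open>Free edges enter every star, as a gain per cost is meaningless at cost zero. Array 15
  names one further edge, taken if it fits the budget; its value \<open>n\<close> is no head and
  forces no edge.\<close>

definition start_edge :: com where
  "start_edge =
     If (NLess (NConst 0) (NLoad 1 head_index)) Skip
       (If (RLess (RConst 0) (RLoad 1 head_index))
         (If (NLess (NConst 0) (distance (nvar 15) (nvar 16))) Skip
           (If (RLess (ROfNat k_exp) (RPlus (RConst 1) (RLoad 1 head_index))) Skip add_edge))
         add_edge)"

definition start_star :: com where
  "start_star = Seq (copy 6 12) (Seq (copy 7 12) (Seq (NAssign 6 (nvar 14) (NConst 1))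
     (Seq (rassign 8 (RConst 1)) (repeat 16 n_exp start_edge))))"

text \<open>Cross multiplication compares the densities, so products of two sums of costs and
  spreads are the largest numbers that occur. The union in arrays 10/11 and its value stay in place
  for the scan of edges.\<close>

definition try_star :: com where
  "try_star = Seq (unite 10 4 6) (Seq (unite 11 5 7) (Seq (Query 10 11 9)
     (If (RLess (RTimes (rvar 6) (rvar 8)) (RTimes (RMinus (rvar 9) (rvar 4)) (rvar 7)))
       (Seq (rassign 6 (RMinus (rvar 9) (rvar 4))) (Seq (rassign 7 (rvar 8))
         (Seq (copy 8 6) (copy 9 7)))) Skip)))"

text \<open>An edge is rated by switching it on in the union, asking the oracle and switching it off
  again. The initial test excludes edges of the union, so switching off restores the array.\<close>

definition try_edge :: com where
  "try_edge =
     If (NLess (NConst 0) (NPlus (NLoad 1 head_index) (NLoad 11 head_index))) Skip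
       (If (RLess (RConst 0) (RLoad 1 head_index))
         (If (RLess (ROfNat k_exp) (RPlus (RConst 1) (RLoad 1 head_index))) Skip
           (Seq (NAssign 11 head_index (NConst 1)) (Seq (Query 10 11 2)
             (Seq (NAssign 11 head_index (NConst 0))
               (If (RLess (RTimes (rvar 10) (RLoad 1 head_index)) (RTimes (RMinus (rvar 2) (rvar 9)) (rvar 11)))
                 (Seq (rassign 10 (RMinus (rvar 2) (rvar 9))) (Seq (rassign 11 (RLoad 1 head_index))
                   (nassign 18 (nvar 16)))) Skip)))))
         Skip)"

text \<open>The start values stand for no edge: gain \<open>- 1\<close> over the positive cost
  \<open>k\<close> is beaten by every candidate, and a cost of \<open>k\<close> never fits next to a
  star, which itself costs at least 1.\<close>

definition scan_edges :: com where
  "scan_edges = Seq (rassign 10 (RConst (- 1))) (Seq (rassign 11 (ROfNat k_exp)) (repeat 16 n_exp try_edge))"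

definition extend_star :: com where
  "extend_star = If (RLess (ROfNat k_exp) (RPlus (rvar 8) (rvar 11))) Skip
     (Seq (NAssign 7 (NPlus (NTimes (nvar 14) n_exp) (nvar 18)) (NConst 1))
       (rassign 8 (RPlus (rvar 8) (rvar 11))))"

text \<open>A star has at most \<open>n\<close> edges, so among \<open>n + 1\<close> rounds at least
  one leaves the star unchanged. The star is rated before it is extended.\<close>

definition grow_star :: com where
  "grow_star = repeat 17 (NPlus n_exp (NConst 1)) (Seq try_star (Seq scan_edges extend_star))"

text \<open>Array 15 runs through the forced edges and reaches \<open>n\<close>, no forced edge, at
  the end. This order matters: the analysis of the pure greedy star uses that all single edges of
  its center have been rated before.\<close>

definition seek_star :: com where
  "seek_star = Seq (rassign 6 (RConst (- 1))) (Seq (rassign 7 (RConst 1))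
     (repeat 14 n_exp (repeat 15 (NPlus n_exp (NConst 1)) (Seq start_star grow_star))))"

text \<open>The solution is evaluated before a star is added, while its accounted cost is below the
  budget, and the star is evaluated alone. The union may be too expensive and becomes a candidate
  for the output only if another round follows.\<close>

definition greedy_step :: com where
  "greedy_step = Seq (evaluate 4 5) (Seq (Query 4 5 4) (Seq seek_star (Seq (evaluate 8 9)
     (Seq (unite 4 4 8) (Seq (unite 5 5 9) (rassign 5 (RPlus (rvar 5) (rvar 7))))))))"

definition star_greedy :: com where
  "star_greedy = If (NLess k_exp n_exp)
     (While (RLess (rvar 5) (ROfNat k_exp)) greedy_step)
     (repeat 14 n_exp (NAssign 2 (nvar 14) (NConst 1)))"

lemma memory_update_simps [simp]:
  "nats (nset m x i v) y = (if y = x then (nats m x)(i := v) else nats m y)"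
  "nums (nset m x i v) = nums m"
  "nums (rset m x i r) y = (if y = x then (nums m x)(i := r) else nums m y)"
  "nats (rset m x i r) = nats m"
  by (simp_all add: nset_def rset_def)

text \<open>A frame condition: \<open>X\<close> and \<open>Y\<close> list the arrays of naturals and
  of numbers that may change.\<close>

definition same :: "nat set \<Rightarrow> nat set \<Rightarrow> memory \<Rightarrow> memory \<Rightarrow> bool" where
  "same X Y m m' \<longleftrightarrow> (\<forall>x. x \<notin> X \<longrightarrow> nats m' x = nats m x) \<and> (\<forall>y. y \<notin> Y \<longrightarrow> nums m' y = nums m y)"

lemma index_less: "u < n \<Longrightarrow> v < n \<Longrightarrow> u * n + v < n * (n :: nat)"
proof -
  assume "u < n" "v < n"
  then have "u * n + v < Suc u * n" "Suc u * n \<le> n * n"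
    by (simp, intro mult_le_mono1) simp
  then show ?thesis
    by (rule less_le_trans)
qed

lemma index_eq_iff:
  fixes n :: nat
  assumes "v < n" "v' < n"
  shows "u * n + v = u' * n + v' \<longleftrightarrow> u = u' \<and> v = v'"
proof
  assume "u * n + v = u' * n + v'"
  then have "(u * n + v) div n = (u' * n + v') div n" "(u * n + v) mod n = (u' * n + v') mod n"
    by simp_all
  then show "u = u' \<and> v = v'"
    using assms by simp
qed simp

lemma node_set_insert: "u < n \<Longrightarrow> b \<noteq> 0 \<Longrightarrow> node_set n (a(u := b)) = insert u (node_set n a)"
  by (auto simp: node_set_def)

lemma edge_set_insert:
  "u < n \<Longrightarrow> v < n \<Longrightarrow> b \<noteq> 0 \<Longrightarrow> edge_set n (a(u * n + v := b)) = insert (u, v) (edge_set n a)"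
  by (auto simp: edge_set_def index_eq_iff)

lemma in_edge_set: "(u, v) \<in> edge_set n a \<longleftrightarrow> u < n \<and> v < n \<and> a (u * n + v) \<noteq> 0"
  by (simp add: edge_set_def)

text \<open>Abstracts from the two cost measures. \<open>Z\<close> contains all sums and differences
  of costs and spreads, and \<open>W\<close> bounds the charge of a product of two moderately large
  elements of \<open>Z\<close>. The instances are all reals with charge 1, and the multiples of a
  common unit fraction with their bit size. The bound 3 |V| + 3 leaves room for every sum that the
  program forms.\<close>

locale bima =
  fixes G :: "nat network" and k :: nat and w :: "real \<Rightarrow> nat" and Z :: "real set" and W :: nat
  assumes input: "input_network G"
    and one_Z: "1 \<in> Z"
    and add_Z: "x \<in> Z \<Longrightarrow> y \<in> Z \<Longrightarrow> x + y \<in> Z"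
    and diff_Z: "x \<in> Z \<Longrightarrow> y \<in> Z \<Longrightarrow> x - y \<in> Z"
    and cost_Z: "e \<in> verts G \<times> verts G \<Longrightarrow> cost G e \<in> Z"
    and spread_Z: "A \<subseteq> verts G \<Longrightarrow> S \<subseteq> verts G \<times> verts G \<Longrightarrow> spread G A S \<in> Z"
    and w_mult: "x \<in> Z \<Longrightarrow> y \<in> Z \<Longrightarrow> \<bar>x\<bar> \<le> 3 * real (card (verts G)) + 3 \<Longrightarrow>
      \<bar>y\<bar> \<le> 3 * real (card (verts G)) + 3 \<Longrightarrow> w (x * y) \<le> W"
begin

section \<open>Resource bounds and the memory invariant\<close>

definition n :: nat where
  "n = card (verts G)"

text \<open>The square makes room for indices and for the counter of \<open>unite\<close>, which
  climbs to \<open>n * n\<close>. The budget is only added, so that no more than its bit length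
  enters the running time.\<close>

definition K :: nat where
  "K = (n + 2)\<^sup>2 + k"

text \<open>The unit of time: every single instruction or test costs at most one unit, because its
  expressions have total length at most 39; the last summand pays for an oracle query.\<close>

definition U :: nat where
  "U = 40 * (nat_size K + W + (n + 1)\<^sup>2)"

text \<open>Total correctness with the postcondition as a predicate on memories: it may be the
  \<open>run\<close> of a second command, so sequencing needs no separate intermediate
  assertion.\<close>

definition run :: "com \<Rightarrow> nat \<Rightarrow> (memory \<Rightarrow> bool) \<Rightarrow> memory \<Rightarrow> bool" where
  "run c s P m \<longleftrightarrow> (\<exists>m' t. exec n (spread G) w c m m' t \<and> t \<le> s * U \<and> P m')"

definition fits :: "real \<Rightarrow> bool" where
  "fits x \<longleftrightarrow> x \<in> Z \<and> \<bar>x\<bar> \<le> 3 * real n + 3"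

lemma verts: "verts G = {..<n}"
  using input by (simp add: input_network_def n_def)

lemma wf: "wf_network G"
  using input by (simp add: input_network_def)

lemma cost_bounds: "u < n \<Longrightarrow> v < n \<Longrightarrow> 0 \<le> cost G (u, v) \<and> cost G (u, v) \<le> 1"
  using wf by (auto simp: wf_network_def verts)

lemma zero_Z: "0 \<in> Z"
  using diff_Z[OF one_Z one_Z] by simp

lemma nat_Z: "real i \<in> Z"
  by (induction i) (auto simp: zero_Z one_Z add_Z)

lemma fits_w: "fits x \<Longrightarrow> w x \<le> W"
  using w_mult[of x 1] one_Z by (simp add: fits_def n_def)

lemma fits_mult_w: "fits x \<Longrightarrow> fits y \<Longrightarrow> w (x * y) \<le> W"
  by (simp add: fits_def n_def w_mult)

lemma fits_nat: "i \<le> 3 * n + 3 \<Longrightarrow> fits (real i)"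
  by (simp add: fits_def nat_Z)

lemma fits_cost: "u < n \<Longrightarrow> v < n \<Longrightarrow> fits (cost G (u, v))"
  using cost_bounds[of u v] cost_Z[of "(u, v)"] by (simp add: fits_def verts)

lemma fits_spread: "A \<subseteq> {..<n} \<Longrightarrow> S \<subseteq> {..<n} \<times> {..<n} \<Longrightarrow> fits (spread G A S)"
  using spread_bounds[OF wf, of A S] spread_Z[of A S] by (simp add: fits_def verts)

text \<open>The bounds on all cells make the expressions of the program fit, and the bit condition
  on arrays 2 to 11 makes the arithmetic union correct.\<close>

definition ok :: "memory \<Rightarrow> bool" where
  "ok m \<longleftrightarrow> nats m 0 0 = n \<and> nats m 0 (Suc 0) = k \<and>
     (\<forall>u<n. \<forall>v<n. nats m (Suc 0) (u * n + v) = (if (u, v) \<in> edges G then 1 else 0)) \<and>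
     (\<forall>u<n. \<forall>v<n. nums m (Suc 0) (u * n + v) = cost G (u, v)) \<and>
     (\<forall>i. nats m 12 i = 0) \<and> (\<forall>x i. nats m x i \<le> K) \<and>
     (\<forall>x\<in>{2..11}. \<forall>i. nats m x i \<le> 1) \<and> (\<forall>y\<ge>2. fits (nums m y 0))"

definition nodes :: "nat \<Rightarrow> memory \<Rightarrow> nat set" where
  "nodes x m = node_set n (nats m x)"

definition arcs :: "nat \<Rightarrow> memory \<Rightarrow> (nat \<times> nat) set" where
  "arcs x m = edge_set n (nats m x)"

lemma K_bounds: "n * n < K" "n + 1 < K" "1 < K" "k \<le> K"
  by (auto simp: K_def power2_eq_square)

lemma ok_nset: "ok m \<Longrightarrow> 13 \<le> x \<Longrightarrow> v \<le> K \<Longrightarrow> ok (nset m x i v)"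
  by (auto simp: ok_def)

lemma ok_nset_bit: "ok m \<Longrightarrow> 2 \<le> x \<Longrightarrow> x \<le> 11 \<Longrightarrow> v \<le> 1 \<Longrightarrow> ok (nset m x i v)"
  using K_bounds by (auto simp: ok_def)

lemma ok_rset: "ok m \<Longrightarrow> 2 \<le> y \<Longrightarrow> fits r \<Longrightarrow> ok (rset m y 0 r)"
  by (auto simp: ok_def)

lemma
  assumes "ok m"
  shows ok_n: "nats m 0 0 = n" and ok_k: "nats m 0 (Suc 0) = k"
    and ok_edge: "u < n \<Longrightarrow> v < n \<Longrightarrow> nats m (Suc 0) (u * n + v) = (if (u, v) \<in> edges G then 1 else 0)"
    and ok_cost: "u < n \<Longrightarrow> v < n \<Longrightarrow> nums m (Suc 0) (u * n + v) = cost G (u, v)"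
    and ok_zero: "nats m 12 i = 0" and ok_K: "nats m x i \<le> K"
    and ok_bit: "2 \<le> x \<Longrightarrow> x \<le> 11 \<Longrightarrow> nats m x i \<le> Suc 0"
    and ok_fits: "2 \<le> y \<Longrightarrow> fits (nums m y 0)"
  using assms by (auto simp: ok_def)

lemma nodes_subset: "nodes x m \<subseteq> {..<n}"
  by (auto simp: nodes_def node_set_def)

lemma arcs_subset: "arcs x m \<subseteq> {..<n} \<times> {..<n}"
  by (auto simp: arcs_def edge_set_def)

lemma finite_arcs: "finite (arcs x m)"
  using arcs_subset finite_subset by blast

section \<open>Rules for total correctness with time bounds\<close>

lemma runI: "exec n (spread G) w c m m' t \<Longrightarrow> t \<le> s * U \<Longrightarrow> P m' \<Longrightarrow> run c s P m"
  unfolding run_def by blast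

lemma runE:
  assumes "run c s P m"
  obtains m' t where "exec n (spread G) w c m m' t" "t \<le> s * U" "P m'"
  using assms unfolding run_def by blast

lemma run_mono: "run c s P m \<Longrightarrow> (\<And>m'. P m' \<Longrightarrow> Q m') \<Longrightarrow> run c s Q m"
  by (auto simp: run_def)

lemma run_weaken:
  assumes "run c s P m" "s \<le> s'"
  shows "run c s' P m"
proof -
  have "s * U \<le> s' * U"
    using assms(2) by (rule mult_le_mono1)
  then show ?thesis
    using assms(1) le_trans unfolding run_def by blast
qed

lemma U_ge: "i \<le> 39 \<Longrightarrow> 1 + i * (nat_size K + W) \<le> U"
proof -
  assume "i \<le> 39"
  then have "i * (nat_size K + W) \<le> 39 * (nat_size K + W)"
    by (rule mult_le_mono1)
  moreover have "1 \<le> nat_size K"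
    by (simp add: nat_size_def)
  ultimately show ?thesis
    by (simp add: U_def)
qed

lemma run_Skip: "P m \<Longrightarrow> run Skip 1 P m"
  using U_ge[of 0] by (intro runI[OF exec.Skip]) auto

lemma run_NAssign:
  assumes "nfit K m i" "nfit K m e" "nlength i + nlength e \<le> 39"
    "P (nset m x (nval m i) (nval m e))"
  shows "run (NAssign x i e) 1 P m"
proof -
  have "1 + ntime m i + ntime m e \<le> 1 + (nlength i + nlength e) * nat_size K"
    using ntime_le[OF assms(1)] ntime_le[OF assms(2)] by (simp add: add_mult_distrib)
  also have "\<dots> \<le> 1 + (nlength i + nlength e) * (nat_size K + W)"
    by simp
  also have "\<dots> \<le> U"
    by (rule U_ge[OF assms(3)])
  finally show ?thesis
    by (rule runI[where s = 1 and P = P, OF exec.NAssign _ assms(4), unfolded mult_1])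
qed

lemma run_RAssign:
  assumes "nfit K m i" "rfit w W K m e" "nlength i + rlength e \<le> 39"
    "P (rset m x (nval m i) (rval m e))"
  shows "run (RAssign x i e) 1 P m"
proof -
  have "1 + ntime m i + rtime w m e \<le> 1 + nlength i * nat_size K + rlength e * (nat_size K + W)"
    using ntime_le[OF assms(1)] rtime_le[OF assms(2)] by simp
  also have "\<dots> \<le> 1 + (nlength i + rlength e) * (nat_size K + W)"
    by (simp add: add_mult_distrib add_mult_distrib2)
  also have "\<dots> \<le> U"
    by (rule U_ge[OF assms(3)])
  finally show ?thesis
    by (rule runI[where s = 1 and P = P, OF exec.RAssign _ assms(4), unfolded mult_1])
qed

lemma run_Query:
  assumes "P (rset m z 0 (spread G (nodes x m) (arcs y m)))"
  shows "run (Query x y z) 1 P m"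
proof -
  have "w (spread G (nodes x m) (arcs y m)) \<le> W"
    by (intro fits_w fits_spread nodes_subset arcs_subset)
  then have "1 + n + n * n + w (spread G (nodes x m) (arcs y m)) \<le> U"
    by (simp add: U_def power2_eq_square)
  then show ?thesis
    by (rule runI[where s = 1 and P = P, OF exec.Query _ assms, unfolded mult_1, rotated])
      (simp add: nodes_def arcs_def)
qed

lemma run_Seq:
  assumes "run c s (run d s' P) m"
  shows "run (Seq c d) (s + s') P m"
proof -
  obtain m' t where 1: "exec n (spread G) w c m m' t" "t \<le> s * U" "run d s' P m'"
    using assms by (rule runE)
  obtain m'' t' where 2: "exec n (spread G) w d m' m'' t'" "t' \<le> s' * U" "P m''"
    using 1(3) by (rule runE)
  show ?thesis
    using 1(2) 2(2,3) by (intro runI[OF exec.Seq[OF 1(1) 2(1)]]) (simp_all add: add_mult_distrib)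
qed

lemma test_time_U: "tfit w W K m b \<Longrightarrow> tlength b \<le> 39 \<Longrightarrow> test_time w m b \<le> U"
  using test_time_le U_ge le_trans by blast

lemma run_If:
  assumes "tfit w W K m b" "tlength b \<le> 39"
    and "holds m b \<Longrightarrow> run c s P m" "\<not> holds m b \<Longrightarrow> run d s' P m"
  shows "run (If b c d) (1 + s + s') P m"
proof (cases "holds m b")
  case True
  obtain m' t where 1: "exec n (spread G) w c m m' t" "t \<le> s * U" "P m'"
    using assms(3)[OF True] by (rule runE)
  show ?thesis
    using 1(2,3) test_time_U[OF assms(1,2)]
    by (intro runI[OF exec.IfTrue[OF True 1(1)]]) (simp_all add: add_mult_distrib)
next
  case False
  obtain m' t where 1: "exec n (spread G) w d m m' t" "t \<le> s' * U" "P m'"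
    using assms(4)[OF False] by (rule runE)
  show ?thesis
    using 1(2,3) test_time_U[OF assms(1,2)]
    by (intro runI[OF exec.IfFalse[OF False 1(1)]]) (simp_all add: add_mult_distrib)
qed

text \<open>\<open>j\<close> counts the completed rounds and \<open>d\<close> those still allowed.
  The invariant must imply \<open>j < N\<close> whenever the test holds, so that the test fails at
  \<open>d = 0\<close>.\<close>

lemma run_While_aux:
  assumes step: "\<And>j m. I j m \<Longrightarrow> holds m b \<Longrightarrow> j < N \<and> run c s (I (Suc j)) m"
    and test: "\<And>j m. I j m \<Longrightarrow> tfit w W K m b" "tlength b \<le> 39"
    and fin: "\<And>j m. I j m \<Longrightarrow> \<not> holds m b \<Longrightarrow> Q m"
  shows "I j m \<Longrightarrow> j + d = N \<Longrightarrow> run (While b c) (d * (s + 1) + 1) Q m"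
proof (induction d arbitrary: j m)
  case 0
  then have F: "\<not> holds m b"
    using step[OF 0(1)] by auto
  show ?case
    using test_time_U[OF test(1)[OF 0(1)] test(2)]
    by (intro runI[where P = Q, OF exec.WhileFalse[OF F] _ fin[OF 0(1) F]]) simp
next
  case (Suc d)
  show ?case
  proof (cases "holds m b")
    case True
    then have "run c s (I (Suc j)) m"
      using step[OF Suc.prems(1)] by blast
    then obtain m' t where 1: "exec n (spread G) w c m m' t" "t \<le> s * U" "I (Suc j) m'"
      by (rule runE)
    have "run (While b c) (d * (s + 1) + 1) Q m'"
      using Suc.IH[OF 1(3)] Suc.prems(2) by simp
    then obtain m'' t' where 2: "exec n (spread G) w (While b c) m' m'' t'" "t' \<le> (d * (s + 1) + 1) * U" "Q m''"
      by (rule runE)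
    have "test_time w m b + t + t' \<le> (Suc d * (s + 1) + 1) * U"
      using 1(2) 2(2) test_time_U[OF test(1)[OF Suc.prems(1)] test(2)] by (simp add: algebra_simps)
    then show ?thesis
      by (rule runI[OF exec.WhileTrue[OF True 1(1) 2(1)]]) (rule 2(3))
  next
    case False
    then have "test_time w m b \<le> (Suc d * (s + 1) + 1) * U"
      using test_time_U[OF test(1)[OF Suc.prems(1)] test(2)] by (simp add: algebra_simps)
    then show ?thesis
      by (rule runI[OF exec.WhileFalse[OF False]]) (rule fin[OF Suc.prems(1) False])
  qed
qed

lemma run_While:
  assumes "I 0 m"
    and "\<And>j m. I j m \<Longrightarrow> holds m b \<Longrightarrow> j < N \<and> run c s (I (Suc j)) m"
    and "\<And>j m. I j m \<Longrightarrow> tfit w W K m b" "tlength b \<le> 39"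
    and "\<And>j m. I j m \<Longrightarrow> \<not> holds m b \<Longrightarrow> Q m"
  shows "run (While b c) (N * (s + 1) + 1) Q m"
  using run_While_aux[of I b N c s Q 0 m N, OF assms(2,3,4,5,1)] by simp

text \<open>The body has to establish the invariant for the memory with the counter already
  advanced, which absorbs the increment appended by \<open>repeat\<close>. By \<open>N < K\<close>
  the final value of the counter fits.\<close>

lemma run_repeat:
  assumes start: "I 0 (nset m x 0 0)"
    and I_ok: "\<And>j m. I j m \<Longrightarrow> ok m"
    and bound: "\<And>m. ok m \<Longrightarrow> nval m b = N \<and> nfit K m b" "nlength b \<le> 20" "N < K"
    and step: "\<And>j m. I j m \<Longrightarrow> j < N \<Longrightarrow> nats m x 0 = j \<Longrightarrow>
      run c s (\<lambda>m'. ok m' \<and> nats m' x 0 = j \<and> I (Suc j) (nset m' x 0 (Suc j))) m"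
    and fin: "\<And>m. I N m \<Longrightarrow> Q m"
  shows "run (repeat x b c) (N * (s + 2) + 2) Q m"
proof -
  let ?b = "NLess (nvar x) b"
  let ?c = "Seq c (nassign x (NPlus (nvar x) (NConst 1)))"
  let ?I = "\<lambda>j m. I j m \<and> nats m x 0 = j \<and> j \<le> N"
  have "run (While ?b ?c) (N * ((s + 1) + 1) + 1) Q m" if "?I 0 m" for m
  proof (rule run_While[where I = ?I])
    fix j m assume I: "?I j m" and "holds m ?b"
    then have j: "j < N"
      using bound(1) I_ok by auto
    have "run ?c (s + 1) (?I (Suc j)) m"
    proof (rule run_Seq, rule run_mono, rule step)
      fix m' assume *: "ok m' \<and> nats m' x 0 = j \<and> I (Suc j) (nset m' x 0 (Suc j))"
      show "run (nassign x (NPlus (nvar x) (NConst 1))) 1 (?I (Suc j)) m'"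
        by (rule run_NAssign) (use * j bound(3) in auto)
    qed (use I j in auto)
    then show "j < N \<and> run ?c (s + 1) (?I (Suc j)) m"
      using j by blast
  next
    fix j m assume *: "?I j m"
    then show "tfit w W K m ?b"
      using bound I_ok by auto
    show "Q m" if "\<not> holds m ?b"
    proof -
      have "j = N"
        using * that bound(1) I_ok by auto
      then show ?thesis
        using * fin by blast
    qed
  qed (use that bound(2) in auto)
  note W = this
  have "run (repeat x b c) (1 + (N * ((s + 1) + 1) + 1)) Q m"
    unfolding repeat_def
    by (rule run_Seq, rule run_NAssign) (use W start in auto)
  then show ?thesis
    by (simp add: add_ac)
qed

lemma nodes_insert: "u < n \<Longrightarrow> nodes x (nset m x u 1) = insert u (nodes x m)"
  by (simp add: nodes_def node_set_insert)

definition t_unite :: nat where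
  "t_unite = 3 * n * n + 2"

lemma run_unite:
  assumes "ok m" "x \<in> {2..11}" "y \<in> {2..12}" "z \<in> {2..12}"
  shows "run (unite x y z) t_unite (\<lambda>m'. ok m' \<and> same {x, 13} {} m m' \<and>
    nodes x m' = nodes y m \<union> nodes z m \<and> arcs x m' = arcs y m \<union> arcs z m) m"
proof -
  \<comment> \<open>On bits, \<open>a + b - a * b\<close> is disjunction, so the union needs no
    branching.\<close>
  define r where "r i = nats m y i + nats m z i - nats m y i * nats m z i" for i
  have bit: "nats m y i \<le> 1" "nats m z i \<le> 1" for i
    using assms ok_bit[OF assms(1), of y i] ok_bit[OF assms(1), of z i] ok_zero[OF assms(1), of i]
    by (cases "y = 12"; cases "z = 12"; auto)+
  have r: "r i \<le> 1" "r i \<noteq> 0 \<longleftrightarrow> nats m y i \<noteq> 0 \<or> nats m z i \<noteq> 0" for i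
    using bit[of i] by (auto simp: r_def le_Suc_eq)
  let ?I = "\<lambda>j m'. ok m' \<and> same {x, 13} {} m m' \<and>
     (\<forall>i. nats m' x i = (if i < j then r i else nats m x i))"
  have "run (unite x y z) (n * n * (1 + 2) + 2) (\<lambda>m'. ok m' \<and> same {x, 13} {} m m' \<and>
    nodes x m' = nodes y m \<union> nodes z m \<and> arcs x m' = arcs y m \<union> arcs z m) m"
    unfolding unite_def
  proof (rule run_repeat[where I = ?I])
    show "?I 0 (nset m 13 0 0)"
      using assms by (auto simp: same_def intro: ok_nset)
    show "nval m (NTimes n_exp n_exp) = n * n \<and> nfit K m (NTimes n_exp n_exp)" if "ok m" for m
      using that K_bounds by (auto simp: ok_n)
  next
    fix j m' assume I: "?I j m'" and j: "j < n * n" and m': "nats m' 13 0 = j"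
    \<comment> \<open>The target may coincide with a source: cell \<open>j\<close> is not
      overwritten before round \<open>j\<close>, so a union in place is correct.\<close>
    have yz: "nats m' y j = nats m y j" "nats m' z j = nats m z j"
      using I assms by (cases "y = x"; cases "z = x"; auto simp: same_def)+
    have b: "nats m y j + nats m z j \<le> K" "nats m y j * nats m z j \<le> K"
       "r j \<le> K" "j \<le> K"
      using bit[of j] K_bounds r(1)[of j] j by (auto simp: le_Suc_eq)
    have 1: "ok (nset m' x j (r j))"
      using I assms r(1)[of j] by (intro ok_nset_bit) auto
    have 2: "ok (nset (nset m' x j (r j)) 13 0 (Suc j))"
      using j K_bounds by (intro ok_nset[OF 1]) auto
    show "run (NAssign x (nvar 13)
          (NMinus (NPlus (NLoad y (nvar 13)) (NLoad z (nvar 13)))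
            (NTimes (NLoad y (nvar 13)) (NLoad z (nvar 13)))))
        1 (\<lambda>m'. ok m' \<and> nats m' 13 0 = j \<and> ?I (Suc j) (nset m' 13 0 (Suc j))) m'"
      apply (rule run_NAssign)
      subgoal using I ok_K by auto
      subgoal using I ok_K b by (auto simp: m' yz r_def)
      subgoal by simp
      subgoal using I assms 1 2 by (auto simp: m' yz r_def[symmetric] same_def less_Suc_eq)
      done
  next
    fix m' assume I: "?I (n * n) m'"
    \<comment> \<open>All \<open>n * n\<close> cells are processed, whether the array stores nodes
      or edges; the node cells are among them.\<close>
    have "i < n \<Longrightarrow> i < n * n" for i
      by (metis bot_nat_0.extremum_strict le_square order_less_le_trans)
    then have "nodes x m' = nodes y m \<union> nodes z m"
      using I r(2) by (auto simp: nodes_def node_set_def)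
    moreover have "arcs x m' = arcs y m \<union> arcs z m"
      using I r(2) by (auto simp: arcs_def edge_set_def index_less)
    ultimately show "ok m' \<and> same {x, 13} {} m m' \<and>
      nodes x m' = nodes y m \<union> nodes z m \<and> arcs x m' = arcs y m \<union> arcs z m"
      using I by blast
  qed (use K_bounds in auto)
  then show ?thesis
    unfolding t_unite_def by (rule run_weaken) simp
qed

lemma nodes_zero: "ok m \<Longrightarrow> nodes 12 m = {}"
  by (simp add: nodes_def node_set_def ok_zero)

lemma arcs_zero: "ok m \<Longrightarrow> arcs 12 m = {}"
  by (simp add: arcs_def edge_set_def ok_zero)

lemma run_copy:
  assumes "ok m" "x \<in> {2..11}" "y \<in> {2..12}"
  shows "run (copy x y) t_unite (\<lambda>m'. ok m' \<and> same {x, 13} {} m m' \<and>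
    nodes x m' = nodes y m \<and> arcs x m' = arcs y m) m"
  using run_unite[OF assms, of 12] assms by (simp add: nodes_zero arcs_zero)

end

section \<open>The inner greedy algorithm\<close>

context bima
begin

abbreviation F :: "(nat + nat \<times> nat) set \<Rightarrow> real" where
  "F \<equiv> coverage G"

sublocale F: monotone_submodular F
  by (rule monotone_submodular_coverage[OF wf])

section \<open>Weights and densities of stars\<close>

definition valid :: "nat set \<Rightarrow> (nat \<times> nat) set \<Rightarrow> bool" where
  "valid A S \<longleftrightarrow> A \<subseteq> {..<n} \<and> S \<subseteq> A \<times> {..<n} - edges G"

definition weight :: "(nat \<times> nat) set \<Rightarrow> real" where
  "weight S = (\<Sum>e\<in>S. cost G e)"

definition \<beta> :: real where
  "\<beta> = (1 - exp (- 1)) / 3"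

lemma valid_Un: "valid A S \<Longrightarrow> valid B T \<Longrightarrow> valid (A \<union> B) (S \<union> T)"
  by (auto simp: valid_def)

lemma spread_valid: "valid A S \<Longrightarrow> spread G A S = F (items A S)"
  by (intro spread_eq_coverage wf) (auto simp: valid_def verts)

lemma F_le: "valid A S \<Longrightarrow> F (items A S) \<le> n"
  using spread_bounds(2)[OF wf, of A S] by (auto simp: valid_def verts spread_valid[symmetric])

lemma F_Z:
  assumes "valid A S"
  shows "F (items A S) \<in> Z"
proof -
  have "spread G A S \<in> Z"
    using assms by (intro spread_Z) (auto simp: valid_def verts)
  then show ?thesis
    by (simp add: spread_valid[OF assms])
qed

lemma fits_gain:
  assumes "valid A S" "valid B T"
  shows "fits (F (items A S) - F (items B T))"
  using assms F_le[OF assms(1)] F_le[OF assms(2)] F.nonneg[of "items A S"] F.nonneg[of "items B T"]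
  by (auto simp: fits_def F_Z diff_Z)

lemma
  assumes "S \<subseteq> {..<n} \<times> {..<n}"
  shows weight_nonneg: "0 \<le> weight S" and weight_Z: "weight S \<in> Z"
    and finite_arc_set: "finite S"
    and weight_insert: "u < n \<Longrightarrow> v < n \<Longrightarrow> (u, v) \<notin> S \<Longrightarrow> weight (insert (u, v) S) = cost G (u, v) + weight S"
    and weight_ge: "e \<in> S \<Longrightarrow> cost G e \<le> weight S"
    and weight_mono: "T \<subseteq> S \<Longrightarrow> weight T \<le> weight S"
proof -
  show fin: "finite S"
    using assms by (rule finite_subset) auto
  have pos: "0 \<le> cost G e" if "e \<in> S" for e
    using that assms cost_bounds by (cases e) auto
  show "0 \<le> weight S"
    by (simp add: weight_def sum_nonneg pos)
  show "weight (insert (u, v) S) = cost G (u, v) + weight S" if "(u, v) \<notin> S"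
    using fin that by (simp add: weight_def)
  show "cost G e \<le> weight S" if "e \<in> S"
    unfolding weight_def using that fin pos by (intro member_le_sum) auto
  show "weight T \<le> weight S" if "T \<subseteq> S"
    unfolding weight_def using that fin pos by (intro sum_mono2) auto
  have "(\<Sum>e\<in>S. cost G e) \<in> Z"
    using fin assms by (induction S) (auto simp: zero_Z cost_Z verts intro!: add_Z)
  then show "weight S \<in> Z"
    by (simp add: weight_def)
qed

lemma weight_star:
  assumes "S \<subseteq> {a} \<times> {..<n}" "a < n"
  shows "weight S \<le> n" "fits (1 + weight S)"
proof -
  have sub: "S \<subseteq> {..<n} \<times> {..<n}"
    using assms by auto
  have "weight S \<le> (\<Sum>e\<in>S. 1)"
    unfolding weight_def using sub cost_bounds by (intro sum_mono) auto
  also have "card S \<le> card ({a} \<times> {..<n})"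
    using assms by (intro card_mono) auto
  then have "(\<Sum>e\<in>S. 1) \<le> real n"
    by simp
  finally show "weight S \<le> n" .
  then show "fits (1 + weight S)"
    using weight_nonneg[OF sub] weight_Z[OF sub] by (simp add: fits_def add_Z one_Z)
qed

text \<open>The aim of the search for one star \<open>(a, Q)\<close>, where \<open>d\<close> is the
  recorded density. Once reached it survives, since recorded densities only increase.\<close>

definition claim :: "(nat + nat \<times> nat) set \<Rightarrow> nat \<Rightarrow> (nat \<times> nat) set \<Rightarrow> real \<Rightarrow> bool" where
  "claim I a Q d \<longleftrightarrow> \<beta> * ((F (I \<union> items {a} Q) - F I) / (1 + weight Q)) \<le> d"

definition fitting :: "nat \<Rightarrow> (nat \<times> nat) set \<Rightarrow> bool" where
  "fitting a Q \<longleftrightarrow> Q \<subseteq> {a} \<times> {..<n} - edges G \<and> 1 + weight Q \<le> k"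

text \<open>Costs are nonnegative, so these edges cost nothing; the inequality is the negation of
  the test in the program. Putting them into every star leaves only edges of positive cost to be
  compared by density.\<close>

definition free_arcs :: "nat \<Rightarrow> (nat \<times> nat) set" where
  "free_arcs a = {e \<in> {a} \<times> {..<n} - edges G. cost G e \<le> 0}"

lemma \<beta>_bounds: "0 < \<beta>" "3 * \<beta> \<le> 1"
proof -
  have "exp (- 1 :: real) < 1" "0 < exp (- 1 :: real)"
    by simp_all
  then show "0 < \<beta>" "3 * \<beta> \<le> 1"
    unfolding \<beta>_def by auto
qed

lemma claim_mono: "claim I a Q d \<Longrightarrow> d \<le> d' \<Longrightarrow> claim I a Q d'"
  by (simp add: claim_def)

text \<open>Gains \<open>x\<close> and \<open>y\<close> at costs \<open>r\<close> and
  \<open>s\<close> with density at most \<open>d\<close> sum up to at most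
  \<open>d * (r + s)\<close>, and \<open>r + s\<close> is at most three times
  \<open>1 + weight Q\<close>, because \<open>s\<close> is at most 2.\<close>

lemma claimI:
  assumes Q: "Q \<subseteq> {..<n} \<times> {..<n}"
    and le: "3 * \<beta> * (F (I \<union> items {a} Q) - F I) \<le> x + y"
    and x: "x / r \<le> d" "0 < r" "r \<le> 1 + weight Q"
    and y: "y / s \<le> d" "0 < s" "s \<le> 2"
    and "0 \<le> d"
  shows "claim I a Q d"
proof -
  have "x \<le> d * r" "y \<le> d * s"
    using x y by (simp_all add: divide_le_eq)
  moreover have "d * r \<le> d * (1 + weight Q)" "d * s \<le> d * (2 * (1 + weight Q))"
    using x y weight_nonneg[OF Q] \<open>0 \<le> d\<close> by (auto intro!: mult_left_mono)
  ultimately have "3 * \<beta> * (F (I \<union> items {a} Q) - F I) \<le> d * (1 + weight Q) + d * (2 * (1 + weight Q))"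
    using le by linarith
  then have "\<beta> * (F (I \<union> items {a} Q) - F I) \<le> d * (1 + weight Q)"
    by (simp add: algebra_simps)
  then show ?thesis
    using weight_nonneg[OF Q] by (simp add: claim_def divide_le_eq)
qed

text \<open>
  One round of the inner greedy algorithm, compared with a fixed star \<open>Q\<close>. As long as the greedy
  star is lighter than \<open>Q\<close>, its missing gain decays exponentially in its weight. The edge \<open>e\<close> with
  which it becomes heavier than \<open>Q\<close> may not fit into the budget, but then the gain \<open>1 - 1 / e\<close> of the
  extended star is shared by the star before (cost at most that of \<open>Q\<close>) and the single edge (cost at
  most 2), one of which is dense.
\<close>

lemma star_step:
  fixes I T Q a
  defines "H \<equiv> I \<union> items {a} T"
  defines "gain \<equiv> \<lambda>v. F (insert (Inr (a, v)) H) - F H"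
  defines "V \<equiv> F (I \<union> items {a} Q) - F I"
  defines "cand \<equiv> \<lambda>v. v < n \<and> (a, v) \<notin> edges G \<and> Inr (a, v) \<notin> H \<and> 0 < cost G (a, v) \<and> 1 + cost G (a, v) \<le> k"
  assumes a: "a < n" and T: "free_arcs a \<subseteq> T" "T \<subseteq> {a} \<times> {..<n}" and Q: "fitting a Q"
    and light: "weight T \<le> weight Q"
    and decay: "V - (F H - F I) \<le> V * exp (- weight T / weight Q)"
    and d: "(F H - F I) / (1 + weight T) \<le> d"
  shows "(\<And>v. \<not> cand v) \<Longrightarrow> claim I a Q d"
    and "cand e \<Longrightarrow> (\<And>v. cand v \<Longrightarrow> gain v / cost G (a, v) \<le> gain e / cost G (a, e)) \<Longrightarrow>
      (F (I \<union> items {a} {(a, e)}) - F I) / (1 + cost G (a, e)) \<le> d \<Longrightarrow> \<not> claim I a Q d \<Longrightarrow>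
      weight T + cost G (a, e) \<le> weight Q \<and>
      V - (F (insert (Inr (a, e)) H) - F I) \<le> V * exp (- (weight T + cost G (a, e)) / weight Q)"
proof -
  have Tn: "T \<subseteq> {..<n} \<times> {..<n}" and Qn: "Q \<subseteq> {..<n} \<times> {..<n}"
    using a T Q by (auto simp: fitting_def)
  have finQ: "finite Q"
    by (rule finite_arc_set[OF Qn])
  note w0 = weight_nonneg[OF Tn] weight_nonneg[OF Qn]
  have h0: "0 \<le> F H - F I" and V0: "0 \<le> V"
    using F.mono[of I H] F.mono[of I "I \<union> items {a} Q"] by (auto simp: H_def V_def)
  have d0: "0 \<le> d"
    using order_trans[OF _ d] h0 w0 by simp
  \<comment> \<open>If the greedy star already gains as much as \<open>Q\<close>, no second star is
    needed; \<open>y = 0\<close> stands in for it.\<close>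
  have early: "claim I a Q d" if "V \<le> F H - F I"
  proof (rule claimI[OF Qn, where r = "1 + weight T" and s = 1])
    have "3 * \<beta> * V \<le> 1 * V"
      by (rule mult_right_mono) (use \<beta>_bounds V0 in auto)
    then show "3 * \<beta> * (F (I \<union> items {a} Q) - F I) \<le> (F H - F I) + 0"
      using that unfolding V_def[symmetric] by linarith
    show "0 / 1 \<le> d" "0 < (1 :: real)" "1 \<le> (2 :: real)"
      using d0 by simp_all
  qed (use d w0 light d0 in auto)
  let ?C = "{x \<in> Q. cand (snd x)}"
  \<comment> \<open>An edge of \<open>Q\<close> is free and hence in \<open>T\<close>, already in
    \<open>H\<close>, or a candidate; it fits the budget next to the center because all of
    \<open>Q\<close> does.\<close>
  have "F (I \<union> items {a} Q) \<le> F (H \<union> Inr ` ?C)"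
  proof (rule F.mono, rule subsetI)
    fix x assume x: "x \<in> I \<union> items {a} Q"
    show "x \<in> H \<union> Inr ` ?C"
    proof (cases "x \<in> I \<or> x = Inl a")
      case False
      then have "x \<in> Inr ` Q"
        using x unfolding items_def by blast
      then obtain u v where uv: "x = Inr (u, v)" "(u, v) \<in> Q"
        by auto
      moreover have Q': "Q \<subseteq> {a} \<times> {..<n} - edges G" "1 + weight Q \<le> k"
        using Q by (simp_all add: fitting_def)
      ultimately have v: "x = Inr (a, v)" "(a, v) \<in> Q"
        by blast+
      have "v < n" "(a, v) \<notin> edges G"
        using Q'(1) v(2) by blast+
      moreover have "1 + cost G (a, v) \<le> k"
        using Q'(2) weight_ge[OF Qn v(2)] by linarith
      moreover have "Inr (a, v) \<in> H" if "\<not> 0 < cost G (a, v)"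
      proof -
        have "(a, v) \<in> free_arcs a"
          using that \<open>v < n\<close> \<open>(a, v) \<notin> edges G\<close> by (simp add: free_arcs_def)
        then show ?thesis
          using T(1) unfolding H_def items_def by blast
      qed
      ultimately have "Inr (a, v) \<in> H \<or> cand v"
        unfolding cand_def by blast
      then show ?thesis
        using v by force
    qed (auto simp: H_def)
  qed
  also have "F (H \<union> Inr ` ?C) \<le> F H + (\<Sum>x\<in>Inr ` ?C. F (insert x H) - F H)"
    using F.gain_singletons[of "Inr ` ?C" H] finQ by simp
  also have "(\<Sum>x\<in>Inr ` ?C. F (insert x H) - F H) = (\<Sum>x\<in>?C. gain (snd x))"
    using Q by (subst sum.reindex) (auto simp: gain_def fitting_def intro!: sum.cong)
  finally have gains: "V - (F H - F I) \<le> (\<Sum>x\<in>?C. gain (snd x))"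
    by (simp add: V_def)
  show "claim I a Q d" if "\<And>v. \<not> cand v"
    using that gains by (intro early) simp
  assume e: "cand e" and best: "\<And>v. cand v \<Longrightarrow> gain v / cost G (a, v) \<le> gain e / cost G (a, e)"
    and pair: "(F (I \<union> items {a} {(a, e)}) - F I) / (1 + cost G (a, e)) \<le> d"
    and nclaim: "\<not> claim I a Q d"
  let ?ce = "cost G (a, e)"
  have ce: "0 < ?ce" "?ce \<le> 1"
    using e cost_bounds[of a e] a by (auto simp: cand_def)
  have ge: "0 \<le> gain e"
    unfolding gain_def using F.mono[of H "insert (Inr (a, e)) H"] by auto
  have "(\<Sum>x\<in>?C. gain (snd x)) \<le> (\<Sum>x\<in>?C. gain e / ?ce * cost G x)"
  proof (rule sum_mono)
    fix x assume x: "x \<in> ?C"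
    then obtain v where v: "x = (a, v)" "cand v"
      using Q by (auto simp: fitting_def)
    then show "gain (snd x) \<le> gain e / ?ce * cost G x"
      using best[OF v(2)] by (simp add: cand_def divide_le_eq)
  qed
  also have "\<dots> = gain e / ?ce * weight ?C"
    by (simp add: weight_def sum_distrib_left)
  also have "\<dots> \<le> gain e / ?ce * weight Q"
    using weight_mono[OF Qn, of ?C] ge ce by (intro mult_left_mono) auto
  finally have main: "V - (F H - F I) \<le> gain e / ?ce * weight Q"
    using gains by linarith
  have pos: "0 < V - (F H - F I)"
    using early nclaim by force
  \<comment> \<open>Weight zero would make the right side of \<open>main\<close> vanish. Positivity
    justifies the quotients by \<open>weight Q\<close> from here on.\<close>
  then have Qpos: "0 < weight Q"
    using main w0 by (cases "weight Q = 0") auto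
  \<comment> \<open>The best edge closes at least the fraction \<open>?ce / weight Q\<close> of the
    gap; with \<open>1 - x \<le> exp (- x)\<close> this becomes exponential decay.\<close>
  have "(V - (F H - F I)) * (?ce / weight Q) \<le> gain e"
    using main Qpos ce by (simp add: field_simps)
  then have "V - (F H - F I) - gain e \<le> (V - (F H - F I)) * (1 - ?ce / weight Q)"
    by (simp add: right_diff_distrib)
  also have "\<dots> \<le> (V - (F H - F I)) * exp (- ?ce / weight Q)"
    using exp_ge_add_one_self[of "- ?ce / weight Q"] pos by (intro mult_left_mono) auto
  also have "\<dots> \<le> V * exp (- weight T / weight Q) * exp (- ?ce / weight Q)"
    using decay by (intro mult_right_mono) auto
  also have "\<dots> = V * exp (- (weight T + ?ce) / weight Q)"
    by (simp add: exp_add[symmetric] add_divide_distrib diff_divide_distrib)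
  finally have step: "V - (F H - F I) - gain e \<le> V * exp (- (weight T + ?ce) / weight Q)" .
  have "weight T + ?ce \<le> weight Q"
  proof (rule ccontr)
    assume over: "\<not> weight T + ?ce \<le> weight Q"
    \<comment> \<open>Overshooting \<open>weight Q\<close> pushes the exponent to at most -1, so the
      star with the edge gains the fraction \<open>1 - exp (- 1)\<close> of \<open>V\<close>, which
      is \<open>3 * \<beta>\<close>.\<close>
    have "exp (- (weight T + ?ce) / weight Q) \<le> exp (- 1)"
      using over Qpos by (simp add: divide_le_eq)
    then have "V * exp (- (weight T + ?ce) / weight Q) \<le> V * exp (- 1)"
      using V0 by (rule mult_left_mono)
    moreover have "3 * \<beta> * V = V - V * exp (- 1)"
      by (simp add: \<beta>_def left_diff_distrib)
    ultimately have "3 * \<beta> * V \<le> (F H - F I) + gain e"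
      using step by linarith
    \<comment> \<open>By diminishing returns, the edge gains on top of the greedy star at most what
      the center with this edge gains over \<open>I\<close>.\<close>
    also have "gain e \<le> F (I \<union> items {a} {(a, e)}) - F I"
    proof -
      have "F (H \<union> items {a} {(a, e)}) - F H \<le> F (I \<union> items {a} {(a, e)}) - F I"
        by (rule F.gain_antimono) (auto simp: H_def)
      moreover have "H \<union> items {a} {(a, e)} = insert (Inr (a, e)) H"
        by (auto simp: H_def items_def)
      ultimately show ?thesis
        by (simp add: gain_def)
    qed
    finally have "claim I a Q d"
      using d pair w0 ce d0 light unfolding V_def
      by (intro claimI[OF Qn, where r = "1 + weight T" and s = "1 + ?ce"]) auto
    then show False
      using nclaim by blast
  qed
  then show "weight T + ?ce \<le> weight Q \<and>
      V - (F (insert (Inr (a, e)) H) - F I) \<le> V * exp (- (weight T + ?ce) / weight Q)"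
    using step by (simp add: gain_def)
qed

section \<open>Invariants of the search\<close>

definition sol :: "nat \<Rightarrow> memory \<Rightarrow> (nat + nat \<times> nat) set" where
  "sol x m = items (nodes x m) (arcs (Suc x) m)"

definition valid_at :: "nat \<Rightarrow> memory \<Rightarrow> bool" where
  "valid_at x m \<longleftrightarrow> valid (nodes x m) (arcs (Suc x) m)"

definition cost_at :: "nat \<Rightarrow> memory \<Rightarrow> real" where
  "cost_at x m = real (card (nodes x m)) + weight (arcs (Suc x) m)"

definition output_inv :: "memory \<Rightarrow> bool" where
  "output_inv m \<longleftrightarrow> valid_at 2 m \<and> cost_at 2 m \<le> k \<and> nums m 3 0 = F (sol 2 m)"

definition greedy_inv :: "memory \<Rightarrow> bool" where
  "greedy_inv m \<longleftrightarrow> valid_at 4 m \<and> nums m 4 0 = F (sol 4 m)"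

text \<open>Gain \<open>- 1\<close> marks that no star has been recorded; true gains are nonnegative
  by monotonicity and cannot be mistaken for it. The stored cost is at least 1 even then, so cross
  multiplication is always sound.\<close>

definition best_inv :: "memory \<Rightarrow> bool" where
  "best_inv m \<longleftrightarrow> 1 \<le> nums m 7 0 \<and> nums m 7 0 \<le> k \<and>
    (nums m 6 0 = - 1 \<or>
      (valid_at 8 m \<and> nums m 7 0 = cost_at 8 m \<and> nums m 6 0 = F (sol 4 m \<union> sol 8 m) - F (sol 4 m)))"

definition star_inv :: "nat \<Rightarrow> memory \<Rightarrow> bool" where
  "star_inv a m \<longleftrightarrow> a < n \<and> nats m 14 0 = a \<and> nodes 6 m = {a} \<and>
     arcs 7 m \<subseteq> {a} \<times> {..<n} - edges G \<and> free_arcs a \<subseteq> arcs 7 m \<and>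
     nums m 8 0 = 1 + weight (arcs 7 m) \<and> nums m 8 0 \<le> k"

definition density :: "memory \<Rightarrow> real" where
  "density m = nums m 6 0 / nums m 7 0"

text \<open>This and the following congruence lemmas list the arrays that each notion reads;
  together with \<open>same\<close> they act as a frame rule.\<close>

lemma sol_cong: "nats m' x = nats m x \<Longrightarrow> nats m' (Suc x) = nats m (Suc x) \<Longrightarrow> sol x m' = sol x m"
  by (simp add: sol_def nodes_def arcs_def)

lemma valid_at_cong: "nats m' x = nats m x \<Longrightarrow> nats m' (Suc x) = nats m (Suc x) \<Longrightarrow> valid_at x m' = valid_at x m"
  by (simp add: valid_at_def nodes_def arcs_def)

lemma cost_at_cong: "nats m' x = nats m x \<Longrightarrow> nats m' (Suc x) = nats m (Suc x) \<Longrightarrow> cost_at x m' = cost_at x m"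
  by (simp add: cost_at_def nodes_def arcs_def)

lemma output_inv_cong:
  "nats m' 2 = nats m 2 \<Longrightarrow> nats m' 3 = nats m 3 \<Longrightarrow> nums m' 3 = nums m 3 \<Longrightarrow> output_inv m' = output_inv m"
  by (simp add: output_inv_def sol_def valid_at_def cost_at_def nodes_def arcs_def)

lemma greedy_inv_cong:
  "nats m' 4 = nats m 4 \<Longrightarrow> nats m' 5 = nats m 5 \<Longrightarrow> nums m' 4 = nums m 4 \<Longrightarrow> greedy_inv m' = greedy_inv m"
  by (simp add: greedy_inv_def sol_def valid_at_def nodes_def arcs_def)

lemma best_inv_cong:
  "nats m' 4 = nats m 4 \<Longrightarrow> nats m' 5 = nats m 5 \<Longrightarrow> nats m' 8 = nats m 8 \<Longrightarrow> nats m' 9 = nats m 9 \<Longrightarrow>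
   nums m' 6 = nums m 6 \<Longrightarrow> nums m' 7 = nums m 7 \<Longrightarrow> best_inv m' = best_inv m"
  by (simp add: best_inv_def sol_def valid_at_def cost_at_def nodes_def arcs_def)

lemma star_inv_cong:
  "nats m' 6 = nats m 6 \<Longrightarrow> nats m' 7 = nats m 7 \<Longrightarrow> nats m' 14 = nats m 14 \<Longrightarrow>
   nums m' 8 = nums m 8 \<Longrightarrow> star_inv a m' = star_inv a m"
  by (simp add: star_inv_def nodes_def arcs_def)

lemma density_cong: "nums m' 6 = nums m 6 \<Longrightarrow> nums m' 7 = nums m 7 \<Longrightarrow> density m' = density m"
  by (simp add: density_def)

lemma spread_at: "valid_at x m \<Longrightarrow> spread G (nodes x m) (arcs (Suc x) m) = F (sol x m)"
  by (simp add: valid_at_def sol_def spread_valid)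

lemma fits_F: "valid_at x m \<Longrightarrow> fits (F (sol x m))"
  unfolding valid_at_def sol_def
  using F_le[of "nodes x m"] F_Z F.nonneg[of "items (nodes x m) (arcs (Suc x) m)"]
  by (force simp: fits_def)

lemma star_valid: "star_inv a m \<Longrightarrow> valid_at 6 m"
  by (auto simp: star_inv_def valid_at_def valid_def)

lemma star_sol: "star_inv a m \<Longrightarrow> sol 6 m = items {a} (arcs 7 m)"
  by (simp add: star_inv_def sol_def)

end

section \<open>Correctness of the program\<close>

context bima
begin

text \<open>Step counts are bracketed as the rules for \<open>Seq\<close> and \<open>If\<close>
  produce them, where an \<open>If\<close> pays for both branches, so that they match by
  unification.\<close>

definition t_evaluate :: nat where
  "t_evaluate = 1 + (1 + (t_unite + (t_unite + 1)) + 1)"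

lemma arcs_cong: "nats m' x = nats m y \<Longrightarrow> arcs x m' = arcs y m"
  by (simp add: arcs_def)

lemma run_evaluate:
  assumes m: "ok m" "output_inv m" "valid_at x m" "cost_at x m \<le> k"
    and x: "4 \<le> x" "x \<le> 10" "y = Suc x"
  shows "run (evaluate x y) t_evaluate (\<lambda>m'. ok m' \<and> same {2, 3, 13} {2, 3} m m' \<and> output_inv m' \<and>
    nums m 3 0 \<le> nums m' 3 0 \<and> F (sol x m) \<le> nums m' 3 0) m"
    (is "run _ _ ?Q m")
proof -
  define r where "r = F (sol x m)"
  define m1 where "m1 = rset m 2 0 r"
  have r: "spread G (nodes x m) (arcs y m) = r" "fits r"
    using m x by (simp_all add: r_def spread_at fits_F)
  have m1: "ok m1" "nats m1 = nats m" "nums m1 2 0 = r" "\<And>z. z \<noteq> 2 \<Longrightarrow> nums m1 z = nums m z"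
    using m r by (simp_all add: m1_def ok_rset)
  have better: "run (Seq (copy 2 x) (Seq (copy 3 y) (rassign 3 (rvar 2)))) (t_unite + (t_unite + 1)) ?Q m1"
    if less: "nums m 3 0 < r"
  proof (rule run_Seq, rule run_mono, rule run_copy)
    fix m2 assume m2: "ok m2 \<and> same {2, 13} {} m1 m2 \<and> nodes 2 m2 = nodes x m1 \<and> arcs 2 m2 = arcs x m1"
    show "run (Seq (copy 3 y) (rassign 3 (rvar 2))) (t_unite + 1) ?Q m2"
    proof (rule run_Seq, rule run_mono, rule run_copy)
      fix m3 assume m3: "ok m3 \<and> same {3, 13} {} m2 m3 \<and> nodes 3 m3 = nodes y m2 \<and> arcs 3 m3 = arcs y m2"
      have nats3: "nats m3 z = nats m z" if "z \<notin> {2, 3, 13}" for z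
        using m2 m3 m1(2) that by (simp add: same_def)
      have nums3: "nums m3 = nums m1"
        using m2 m3 by (simp add: same_def fun_eq_iff)
      have sol: "nodes 2 m3 = nodes x m" "arcs 3 m3 = arcs (Suc x) m"
        using m2 m3 m1(2) x by (simp_all add: same_def nodes_def arcs_def)
      show "run (rassign 3 (rvar 2)) 1 ?Q m3"
      proof (rule run_RAssign)
        let ?m4 = "rset m3 3 (nval m3 (NConst 0)) (rval m3 (rvar 2))"
        have m4: "?m4 = rset m3 3 0 r"
          using nums3 m1 by simp
        have "ok ?m4"
          unfolding m4 using m3 r by (intro ok_rset) auto
        moreover have "same {2, 3, 13} {2, 3} m ?m4"
          unfolding m4 using nats3 nums3 m1(4) by (simp add: same_def)
        moreover have "output_inv ?m4"
          using m sol x unfolding m4 output_inv_def valid_at_def cost_at_def sol_def r_def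
          by (simp add: nodes_def arcs_def)
        ultimately show "?Q ?m4"
          using less unfolding m4 by (simp add: r_def)
      qed (use nums3 m1 r fits_w in auto)
    qed (use m2 x in auto)
  qed (use m1 x in auto)
  have "run (If (RLess (rvar 3) (rvar 2)) (Seq (copy 2 x) (Seq (copy 3 y) (rassign 3 (rvar 2)))) Skip)
    (1 + (t_unite + (t_unite + 1)) + 1) ?Q m1"
  proof (rule run_If, goal_cases)
    case 1
    then show ?case
      using ok_fits[OF m1(1)] by (auto intro!: fits_w)
  next
    case 3
    then show ?case
      using m1 by (intro better) simp
  next
    case 4
    have "output_inv m1"
      using m m1 by (simp add: output_inv_cong[of m1 m])
    then show ?case
      using 4 m1 by (intro run_Skip) (auto simp: same_def r_def)
  qed simp
  then show ?thesis
    unfolding evaluate_def t_evaluate_def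
    by (intro run_Seq run_Query) (simp add: r m1_def)
qed

lemma fits_add_cost: "u < n \<Longrightarrow> v < n \<Longrightarrow> fits (1 + cost G (u, v))"
  using cost_bounds[of u v] cost_Z[of "(u, v)"] by (simp add: fits_def verts add_Z one_Z)

lemma fits_const: "fits 0" "fits 1" "fits (- 1)"
  using diff_Z[OF zero_Z one_Z] by (simp_all add: fits_def zero_Z one_Z)

lemma head_index:
  assumes "ok m" "nats m 14 0 = a" "a < n" "nats m 16 0 = v" "v < n"
  shows "nval m head_index = a * n + v" "nfit K m head_index"
proof -
  show "nval m head_index = a * n + v"
    using assms by (simp add: ok_n)
  have "a * n + v < K" "v < K" "n < K" "a < K"
    using index_less[OF assms(3,5)] K_bounds assms by linarith+
  then show "nfit K m head_index"
    using assms by (simp add: ok_n)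
qed

end

text \<open>For \<open>k < n\<close> the budget is small enough to be used as a number. Otherwise it
  is never converted to one, as the branch is chosen by a test on naturals.\<close>

locale bima_small = bima +
  assumes k_less: "k < n"
begin

lemma fits_k: "fits (real k)"
  using k_less by (intro fits_nat) simp

text \<open>For \<open>b = n\<close>, which is no head, only the free edges remain; a forced edge
  that does not fit the budget is dropped.\<close>

definition start_arcs :: "nat \<Rightarrow> nat \<Rightarrow> (nat \<times> nat) set" where
  "start_arcs a b = {e \<in> {a} \<times> {..<n} - edges G. cost G e \<le> 0 \<or> snd e = b \<and> 1 + cost G e \<le> k}"

lemma run_add_edge:
  assumes m: "ok m" "nats m 14 0 = a" "a < n" "nats m 16 0 = v" "v < n"
    and f: "fits (nums m 8 0 + cost G (a, v))"
  shows "run add_edge (1 + 1) (\<lambda>m'. ok m' \<and> same {7} {8} m m' \<and>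
    arcs 7 m' = insert (a, v) (arcs 7 m) \<and> nums m' 8 0 = nums m 8 0 + cost G (a, v)) m"
    (is "run _ _ ?Q m")
proof -
  note idx = head_index[OF m]
  let ?m1 = "nset m 7 (a * n + v) 1"
  have m1: "ok ?m1"
    using m by (intro ok_nset_bit) auto
  have idx1: "nval ?m1 head_index = a * n + v" "nfit K ?m1 head_index"
    by (rule head_index[OF m1]; use m in simp)+
  have ca: "nums m 1 (a * n + v) = cost G (a, v)"
    using ok_cost[OF m(1), of a v] m by simp
  show ?thesis
    unfolding add_edge_def
  proof (rule run_Seq, rule run_NAssign)
    show "nfit K m head_index"
      by (rule idx)
    have "run (rassign 8 (RPlus (rvar 8) (RLoad 1 head_index))) 1 ?Q ?m1"
    proof (rule run_RAssign)
      show "rfit w W K ?m1 (RPlus (rvar 8) (RLoad 1 head_index))"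
        using idx1 ca f fits_w fits_cost[OF m(3,5)] ok_fits[OF m(1), of 8]
        by (simp del: nval.simps nfit.simps) simp
      have "rset ?m1 8 (nval ?m1 (NConst 0)) (rval ?m1 (RPlus (rvar 8) (RLoad 1 head_index)))
          = rset ?m1 8 0 (nums m 8 0 + cost G (a, v))"
        using idx1(1) ca by simp
      moreover have "?Q (rset ?m1 8 0 (nums m 8 0 + cost G (a, v)))"
      proof (intro conjI)
        show "ok (rset ?m1 8 0 (nums m 8 0 + cost G (a, v)))"
          using m1 f by (intro ok_rset) auto
        show "arcs 7 (rset ?m1 8 0 (nums m 8 0 + cost G (a, v))) = insert (a, v) (arcs 7 m)"
          using m by (simp add: arcs_def edge_set_insert)
      qed (simp_all add: same_def)
      ultimately show "?Q (rset ?m1 8 (nval ?m1 (NConst 0)) (rval ?m1 (RPlus (rvar 8) (RLoad 1 head_index))))"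
        by metis
    qed simp_all
    then show "run (rassign 8 (RPlus (rvar 8) (RLoad 1 head_index))) 1 ?Q
        (nset m 7 (nval m head_index) (nval m (NConst 1)))"
      using idx by simp
  qed (use K_bounds in simp_all)
qed

definition t_start_edge :: nat where
  "t_start_edge = 1 + 1 + (1 + (1 + 1 + (1 + 1 + (1 + 1))) + (1 + 1))"

lemma run_start_edge:
  assumes m: "ok m" "nats m 14 0 = a" "a < n" "nats m 16 0 = v" "v < n" "nats m 15 0 = b" "b \<le> n"
    and f: "fits (nums m 8 0 + cost G (a, v))"
  shows "run start_edge t_start_edge (\<lambda>m'. ok m' \<and> same {7} {8} m m' \<and>
    (if (a, v) \<in> start_arcs a b
     then arcs 7 m' = insert (a, v) (arcs 7 m) \<and> nums m' 8 0 = nums m 8 0 + cost G (a, v)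
     else arcs 7 m' = arcs 7 m \<and> nums m' 8 0 = nums m 8 0)) m"
    (is "run _ _ ?Q m")
proof -
  note idx = head_index[OF m(1-5)]
  have vals: "nval m (NLoad 1 head_index) = (if (a, v) \<in> edges G then 1 else 0)"
    "rval m (RLoad 1 head_index) = cost G (a, v)"
    "nval m (distance (nvar 15) (nvar 16)) = (b - v) + (v - b)"
    using m ok_n[OF m(1)] ok_edge[OF m(1,3,5)] ok_cost[OF m(1,3,5)] by simp_all
  have fit: "nfit K m (NLoad 1 head_index)" "rfit w W K m (RLoad 1 head_index)"
    "nfit K m (distance (nvar 15) (nvar 16))"
    using idx m K_bounds vals(2) fits_cost[OF m(3,5)] ok_K[OF m(1)] by (auto simp: fits_w)
  have cons: "w 0 \<le> W" "w 1 \<le> W" "w (real k) \<le> W" "w (1 + cost G (a, v)) \<le> W"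
    using fits_const fits_k fits_add_cost[OF m(3,5)] by (auto intro: fits_w)
  have add: "run add_edge (1 + 1) ?Q m" if "(a, v) \<in> start_arcs a b"
    by (rule run_mono[OF run_add_edge[OF m(1-5) f]]) (use that in auto)
  have skip: "run Skip 1 ?Q m" if "(a, v) \<notin> start_arcs a b"
    by (rule run_Skip) (use that m in \<open>auto simp: same_def\<close>)
  have mem: "(a, v) \<in> start_arcs a b \<longleftrightarrow>
      (a, v) \<notin> edges G \<and> (cost G (a, v) \<le> 0 \<or> v = b \<and> 1 + cost G (a, v) \<le> k)"
    using m by (auto simp: start_arcs_def)
  show ?thesis
    unfolding start_edge_def t_start_edge_def
    apply (rule run_If)
    subgoal using fit by simp
    subgoal by simp
    subgoal using vals by (intro skip) (auto simp: mem split: if_splits)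
    apply (rule run_If)
    subgoal using fit cons by simp
    subgoal by simp
    subgoal
      apply (rule run_If)
      subgoal using fit by simp
      subgoal by simp
      subgoal using vals by (intro skip) (auto simp: mem split: if_splits)
      apply (rule run_If)
      subgoal using fit cons vals K_bounds m by (simp add: ok_n ok_k)
      subgoal by simp
      subgoal using vals m by (intro skip) (auto simp: mem ok_k split: if_splits)
      subgoal using vals m by (intro add) (auto simp: mem ok_k split: if_splits)
      done
    subgoal using vals by (intro add) (auto simp: mem split: if_splits)
    done
qed

lemma finite_start_arcs: "finite (start_arcs a b)"
  by (rule finite_subset[of _ "{a} \<times> {..<n}"]) (auto simp: start_arcs_def)

text \<open>All members other than \<open>(a, b)\<close> are free, so at most one edge
  contributes.\<close>

lemma weight_start_arcs:
  assumes "a < n"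
  shows "weight (start_arcs a b) =
    (if b < n \<and> (a, b) \<notin> edges G \<and> 1 + cost G (a, b) \<le> k then cost G (a, b) else 0)"
proof -
  have zero: "cost G e = 0" if e: "e \<in> start_arcs a b - {(a, b)}" for e
  proof -
    obtain v where v: "e = (a, v)" "v < n" "cost G e \<le> 0"
      using e by (auto simp: start_arcs_def)
    then show ?thesis
      using cost_bounds[OF assms v(2)] by simp
  qed
  have "weight (start_arcs a b) = (\<Sum>e\<in>start_arcs a b \<inter> {(a, b)}. cost G e)"
    unfolding weight_def using zero finite_start_arcs by (intro sum.mono_neutral_right) auto
  also have "\<dots> = (if (a, b) \<in> start_arcs a b then cost G (a, b) else 0)"
    by (cases "(a, b) \<in> start_arcs a b") simp_all
  also have "\<dots> = (if b < n \<and> (a, b) \<notin> edges G \<and> 1 + cost G (a, b) \<le> k then cost G (a, b) else 0)"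
    using cost_bounds[OF assms, of b] by (auto simp: start_arcs_def)
  finally show ?thesis .
qed

definition t_start_star :: nat where
  "t_start_star = t_unite + (t_unite + (1 + (1 + (n * (t_start_edge + 2) + 2))))"

lemma n_exp_bound: "ok m \<Longrightarrow> nval m n_exp = n \<and> nfit K m n_exp"
  using K_bounds by (auto simp: ok_n)

lemma n1_exp_bound: "ok m \<Longrightarrow> nval m (NPlus n_exp (NConst 1)) = n + 1 \<and> nfit K m (NPlus n_exp (NConst 1))"
  using K_bounds by (auto simp: ok_n)

lemma run_start_star:
  assumes m: "ok m" "nats m 14 0 = a" "a < n" "nats m 15 0 = b" "b \<le> n" "1 \<le> k"
  shows "run start_star t_start_star (\<lambda>m'. ok m' \<and> same {6, 7, 13, 16} {8} m m' \<and>
    star_inv a m' \<and> arcs 7 m' = start_arcs a b) m"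
    (is "run _ _ ?Q m")
proof -
  let ?A = "\<lambda>j. start_arcs a b \<inter> {a} \<times> {..<j}"
  let ?I = "\<lambda>j m'. ok m' \<and> same {6, 7, 13, 16} {8} m m' \<and> nodes 6 m' = {a} \<and>
    arcs 7 m' = ?A j \<and> nums m' 8 0 = 1 + weight (?A j)"
  have sub: "?A j \<subseteq> {a} \<times> {..<n}" "?A j \<subseteq> {..<n} \<times> {..<n}" for j
    using m by (auto simp: start_arcs_def)
  have loop: "run (repeat 16 n_exp start_edge) (n * (t_start_edge + 2) + 2) ?Q m'"
    if "ok m'" "same {6, 7, 13, 16} {8} m m'" "nodes 6 m' = {a}" "arcs 7 m' = {}" "nums m' 8 0 = 1" for m'
  proof (rule run_repeat[where I = ?I])
    show "?I 0 (nset m' 16 0 0)"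
      using that by (auto simp: same_def nodes_def arcs_def weight_def intro: ok_nset)
  next
    fix j m2 assume I: "?I j m2" and j: "j < n" and m2: "nats m2 16 0 = j"
    have A_Suc: "?A (Suc j) = (if (a, j) \<in> start_arcs a b then insert (a, j) (?A j) else ?A j)"
      by (auto simp: less_Suc_eq)
    have w_Suc: "weight (insert (a, j) (?A j)) = cost G (a, j) + weight (?A j)"
      using sub(2)[of j] m j by (intro weight_insert) auto
    have "weight (?A j) \<le> n" "weight (?A j) \<in> Z" "0 \<le> weight (?A j)"
      using weight_star(1)[OF sub(1)] weight_Z[OF sub(2)] weight_nonneg[OF sub(2)] m by auto
    then have "fits (nums m2 8 0 + cost G (a, j))"
      using I cost_bounds[OF m(3) j] cost_Z[of "(a, j)"] m j
      by (auto simp: fits_def verts intro!: add_Z one_Z)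
    then show "run start_edge t_start_edge (\<lambda>m'. ok m' \<and> nats m' 16 0 = j \<and> ?I (Suc j) (nset m' 16 0 (Suc j))) m2"
      using I m2 m j K_bounds
      by (intro run_mono[OF run_start_edge[where a = a and v = j and b = b]])
        (auto simp: same_def nodes_def arcs_def A_Suc w_Suc intro!: ok_nset split: if_splits)
  next
    fix m' assume I: "?I n m'"
    have A: "?A n = start_arcs a b"
      by (auto simp: start_arcs_def)
    have "free_arcs a \<subseteq> start_arcs a b"
      by (auto simp: free_arcs_def start_arcs_def)
    moreover have "1 + weight (start_arcs a b) \<le> k"
      using m by (auto simp: weight_start_arcs)
    ultimately show "?Q m'"
      using I m by (auto simp: A star_inv_def same_def) (auto simp: start_arcs_def)
  qed (use n_exp_bound K_bounds in auto)
  show ?thesis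
    unfolding start_star_def t_start_star_def
  proof (rule run_Seq, rule run_mono, rule run_copy)
    fix m1 assume m1: "ok m1 \<and> same {6, 13} {} m m1 \<and> nodes 6 m1 = nodes 12 m \<and> arcs 6 m1 = arcs 12 m"
    show "run (Seq (copy 7 12) (Seq (NAssign 6 (nvar 14) (NConst 1))
      (Seq (rassign 8 (RConst 1)) (repeat 16 n_exp start_edge))))
      (t_unite + (1 + (1 + (n * (t_start_edge + 2) + 2)))) ?Q m1"
    proof (rule run_Seq, rule run_mono, rule run_copy)
      fix m2 assume m2: "ok m2 \<and> same {7, 13} {} m1 m2 \<and> nodes 7 m2 = nodes 12 m1 \<and> arcs 7 m2 = arcs 12 m1"
      have nats2: "nats m2 x = nats m x" if "x \<notin> {6, 7, 13}" for x
        using m1 m2 that by (simp add: same_def)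
      have nums2: "nums m2 = nums m"
        using m1 m2 by (simp add: same_def fun_eq_iff)
      have sets2: "nodes 6 m2 = {}" "arcs 7 m2 = {}"
        using m1 m2 m nodes_zero[of m] arcs_zero[of m1] by (auto simp: same_def nodes_def)
      let ?m3 = "nset m2 6 a 1"
      let ?m4 = "rset ?m3 8 0 1"
      have ok3: "ok ?m3"
        using m2 by (intro ok_nset_bit) auto
      then have ok4: "ok ?m4"
        by (intro ok_rset fits_const) auto
      have "run (repeat 16 n_exp start_edge) (n * (t_start_edge + 2) + 2) ?Q ?m4"
      proof (rule loop)
        show "same {6, 7, 13, 16} {8} m ?m4"
          using nats2 nums2 by (auto simp: same_def)
        show "nodes 6 ?m4 = {a}"
          using nodes_insert[OF m(3), of 6 m2] sets2 by (simp add: nodes_def)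
        show "arcs 7 ?m4 = {}"
          using sets2 by (simp add: arcs_def)
      qed (use ok4 in auto)
      then have "run (Seq (rassign 8 (RConst 1)) (repeat 16 n_exp start_edge)) (1 + (n * (t_start_edge + 2) + 2)) ?Q ?m3"
        using fits_w[OF fits_const(2)] by (intro run_Seq run_RAssign) auto
      then show "run (Seq (NAssign 6 (nvar 14) (NConst 1))
          (Seq (rassign 8 (RConst 1)) (repeat 16 n_exp start_edge)))
          (1 + (1 + (n * (t_start_edge + 2) + 2))) ?Q m2"
        using nats2[of 14] m K_bounds by - (rule run_Seq, rule run_NAssign, auto)
    qed (use m1 in auto)
  qed (use m in auto)
qed

section \<open>Rating a star\<close>

definition t_try_star :: nat where
  "t_try_star = t_unite + (t_unite + (1 + (1 + (1 + (1 + (t_unite + t_unite))) + 1)))"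

lemma run_try_star:
  assumes m: "ok m" "greedy_inv m" "best_inv m" "star_inv a m"
  shows "run try_star t_try_star (\<lambda>m'. ok m' \<and> same {8, 9, 10, 11, 13} {6, 7, 9} m m' \<and>
    best_inv m' \<and> density m \<le> density m' \<and>
    (F (sol 4 m \<union> sol 6 m) - F (sol 4 m)) / nums m 8 0 \<le> density m' \<and>
    nodes 10 m' = nodes 4 m \<union> nodes 6 m \<and> arcs 11 m' = arcs 5 m \<union> arcs 7 m \<and>
    nums m' 9 0 = F (sol 4 m \<union> sol 6 m)) m"
    (is "run _ _ ?Q m")
proof -
  define r where "r = F (sol 4 m \<union> sol 6 m)"
  define g where "g = r - F (sol 4 m)"
  have valid4: "valid (nodes 4 m) (arcs 5 m)"
    using m by (simp add: greedy_inv_def valid_at_def)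
  have valid6: "valid (nodes 6 m) (arcs 7 m)"
    using star_valid[OF m(4)] by (simp add: valid_at_def)
  note valid = valid_Un[OF valid4 valid6]
  have sol_un: "sol 4 m \<union> sol 6 m = items (nodes 4 m \<union> nodes 6 m) (arcs 5 m \<union> arcs 7 m)"
    by (simp add: sol_def items_Un)
  have fits_r: "fits r"
    unfolding r_def sol_un using F_le[OF valid] F_Z[OF valid] F.nonneg[of "items (nodes 4 m \<union> nodes 6 m) (arcs 5 m \<union> arcs 7 m)"]
    by (simp add: fits_def)
  have fits_g: "fits g"
    unfolding g_def r_def sol_un using fits_gain[OF valid valid4] by (simp add: sol_def)
  have g0: "0 \<le> g"
    unfolding g_def r_def using F.mono[of "sol 4 m" "sol 4 m \<union> sol 6 m"] by simp
  define t where "t = nums m 8 0"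
  have t: "1 \<le> t" "t \<le> k" "fits t"
    using m weight_nonneg[of "arcs 7 m"] arcs_subset[of 7 m] ok_fits[OF m(1), of 8]
    by (auto simp: star_inv_def t_def)
  have bc: "1 \<le> nums m 7 0" "nums m 7 0 \<le> k" and fc: "nums m 4 0 = F (sol 4 m)"
    using m by (auto simp: best_inv_def greedy_inv_def)
  show ?thesis
    unfolding try_star_def t_try_star_def
  proof (rule run_Seq, rule run_mono, rule run_unite)
    fix m1 assume m1: "ok m1 \<and> same {10, 13} {} m m1 \<and> nodes 10 m1 = nodes 4 m \<union> nodes 6 m \<and>
      arcs 10 m1 = arcs 4 m \<union> arcs 6 m"
    show "run (Seq (unite 11 5 7) (Seq (Query 10 11 9)
     (If (RLess (RTimes (rvar 6) (rvar 8)) (RTimes (RMinus (rvar 9) (rvar 4)) (rvar 7)))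
       (Seq (rassign 6 (RMinus (rvar 9) (rvar 4))) (Seq (rassign 7 (rvar 8))
         (Seq (copy 8 6) (copy 9 7)))) Skip)))
      (t_unite + (1 + (1 + (1 + (1 + (t_unite + t_unite))) + 1))) ?Q m1"
    proof (rule run_Seq, rule run_mono, rule run_unite)
      fix m2 assume m2: "ok m2 \<and> same {11, 13} {} m1 m2 \<and> nodes 11 m2 = nodes 5 m1 \<union> nodes 7 m1 \<and>
        arcs 11 m2 = arcs 5 m1 \<union> arcs 7 m1"
      have nats2: "nats m2 x = nats m x" if "x \<notin> {10, 11, 13}" for x
        using m1 m2 that by (simp add: same_def)
      have nums2: "nums m2 = nums m"
        using m1 m2 by (simp add: same_def fun_eq_iff)
      have sets2: "nodes 10 m2 = nodes 4 m \<union> nodes 6 m" "arcs 11 m2 = arcs 5 m \<union> arcs 7 m"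
        using m1 m2 by (simp_all add: same_def nodes_def arcs_def)
      have query: "spread G (nodes 10 m2) (arcs 11 m2) = r"
        unfolding sets2 r_def sol_un by (rule spread_valid[OF valid])
      define m3 where "m3 = rset m2 9 0 r"
      have m3: "ok m3" "nats m3 = nats m2" "\<And>x. x \<noteq> 9 \<Longrightarrow> nums m3 x = nums m x" "nums m3 9 0 = r"
        using m2 nums2 fits_r by (simp_all add: m3_def ok_rset)
      have sets3: "nodes 10 m3 = nodes 4 m \<union> nodes 6 m" "arcs 11 m3 = arcs 5 m \<union> arcs 7 m"
        using sets2 m3(2) by (simp_all add: nodes_def arcs_def)
      let ?test = "RLess (RTimes (rvar 6) (rvar 8)) (RTimes (RMinus (rvar 9) (rvar 4)) (rvar 7))"
      \<comment> \<open>Both costs are at least 1, so the cross-multiplied test is the comparison of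
        densities.\<close>
      have holds: "holds m3 ?test \<longleftrightarrow> density m < g / t"
        using m3 t bc by (simp add: fc g_def density_def t_def divide_less_eq less_divide_eq field_simps)
      have w: "w (nums m 6 0 * t) \<le> W" "w (g * nums m 7 0) \<le> W" "w g \<le> W" "w r \<le> W"
        "w t \<le> W" "\<And>x. 2 \<le> x \<Longrightarrow> w (nums m x 0) \<le> W"
        using fits_w fits_mult_w ok_fits[OF m(1)] t fits_g fits_r by auto
      have upd: "run (Seq (rassign 6 (RMinus (rvar 9) (rvar 4))) (Seq (rassign 7 (rvar 8))
         (Seq (copy 8 6) (copy 9 7)))) (1 + (1 + (t_unite + t_unite))) ?Q m3" if better: "density m < g / t"
      proof -
        let ?m4 = "rset m3 6 0 g"
        let ?m5 = "rset ?m4 7 0 t"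
        have ok5: "ok ?m5"
          using m3 fits_g t by (intro ok_rset) auto
        have "run (Seq (copy 8 6) (copy 9 7)) (t_unite + t_unite) ?Q ?m5"
        proof (rule run_Seq, rule run_mono, rule run_copy)
          fix m6 assume m6: "ok m6 \<and> same {8, 13} {} ?m5 m6 \<and> nodes 8 m6 = nodes 6 ?m5 \<and> arcs 8 m6 = arcs 6 ?m5"
          show "run (copy 9 7) t_unite ?Q m6"
          proof (rule run_mono, rule run_copy)
            fix m7 assume m7: "ok m7 \<and> same {9, 13} {} m6 m7 \<and> nodes 9 m7 = nodes 7 m6 \<and> arcs 9 m7 = arcs 7 m6"
            have nats7: "nats m7 x = nats m x" if "x \<notin> {8, 9, 10, 11, 13}" for x
              using m6 m7 m3 nats2[of x] that by (simp add: same_def)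
            have nums7: "nums m7 x = nums ?m5 x" for x
              using m6 m7 by (simp add: same_def)
            have sets7: "nodes 8 m7 = nodes 6 m" "arcs 9 m7 = arcs 7 m"
              "nodes 10 m7 = nodes 10 m3" "arcs 11 m7 = arcs 11 m3"
              using m6 m7 m3 nats2[of 6] nats2[of 7] by (simp_all add: same_def nodes_def arcs_def)
            have sol7: "sol 8 m7 = sol 6 m" "sol 4 m7 = sol 4 m"
              using sets7 nats7[of 4] nats7[of 5] by (simp_all add: sol_def nodes_def arcs_def)
            have "cost_at 8 m7 = t"
              using sets7 m by (simp add: cost_at_def star_inv_def t_def)
            moreover have "valid_at 8 m7"
              using sets7 valid6 by (simp add: valid_at_def)
            ultimately have "best_inv m7"
              using nums7 t sol7 by (simp add: best_inv_def g_def r_def)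
            moreover have "density m7 = g / t"
              using nums7 by (simp add: density_def)
            moreover have "same {8, 9, 10, 11, 13} {6, 7, 9} m m7"
              using nats7 nums7 m3(3) by (simp add: same_def)
            ultimately show "?Q m7"
              using m7 better sets7 sets3 nums7[of 9] m3(4) by (simp add: r_def g_def t_def)
          qed (use m6 in auto)
        qed (use ok5 in auto)
        then have 1: "run (Seq (rassign 7 (rvar 8)) (Seq (copy 8 6) (copy 9 7))) (1 + (t_unite + t_unite)) ?Q ?m4"
          using w m3 by - (rule run_Seq, rule run_RAssign, auto simp: t_def)
        have "run (rassign 6 (RMinus (rvar 9) (rvar 4))) 1
            (run (Seq (rassign 7 (rvar 8)) (Seq (copy 8 6) (copy 9 7))) (1 + (t_unite + t_unite)) ?Q) m3"
        proof (rule run_RAssign)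
          show "rfit w W K m3 (RMinus (rvar 9) (rvar 4))"
            using w w(6)[of 4] m3 by (simp add: fc g_def)
        qed (use 1 m3 in \<open>simp_all add: fc g_def\<close>)
        then show ?thesis
          by (rule run_Seq)
      qed
      have "run (If ?test
       (Seq (rassign 6 (RMinus (rvar 9) (rvar 4))) (Seq (rassign 7 (rvar 8))
         (Seq (copy 8 6) (copy 9 7)))) Skip) (1 + (1 + (1 + (t_unite + t_unite))) + 1) ?Q m3"
      proof (rule run_If, goal_cases)
        case 1
        then show ?case
          using w w(6)[of 4] w(6)[of 6] w(6)[of 7] w(6)[of 8] m3 by (simp add: fc g_def t_def)
      next
        case 3
        then show ?case
          unfolding holds by (rule upd)
      next
        case 4
        have eq: "nats m3 x = nats m x" if "x \<notin> {10, 11, 13}" for x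
          using nats2 m3(2) that by simp
        have "best_inv m3"
          using m(3) eq m3(3) by (simp add: best_inv_cong[of m3 m])
        moreover have "density m3 = density m"
          using m3(3) by (simp add: density_cong[of m3 m])
        moreover have "same {8, 9, 10, 11, 13} {6, 7, 9} m m3"
          using eq m3(3) by (simp add: same_def)
        ultimately show ?case
          using 4(1)[unfolded holds] m3 sets3 by (intro run_Skip) (simp add: r_def g_def t_def)
      qed simp
      then show "run (Seq (Query 10 11 9)
         (If ?test (Seq (rassign 6 (RMinus (rvar 9) (rvar 4))) (Seq (rassign 7 (rvar 8))
         (Seq (copy 8 6) (copy 9 7)))) Skip)) (1 + (1 + (1 + (1 + (t_unite + t_unite))) + 1)) ?Q m2"
        by (intro run_Seq run_Query) (simp add: query m3_def)
    qed (use m1 in auto)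
  qed (use m in auto)
qed

section \<open>The densest additional edge\<close>

definition cand :: "nat \<Rightarrow> memory \<Rightarrow> nat \<Rightarrow> bool" where
  "cand a m v \<longleftrightarrow> v < n \<and> (a, v) \<notin> edges G \<and> (a, v) \<notin> arcs 5 m \<union> arcs 7 m \<and>
     0 < cost G (a, v) \<and> 1 + cost G (a, v) \<le> k"

definition union_sol :: "memory \<Rightarrow> (nat + nat \<times> nat) set" where
  "union_sol m = sol 4 m \<union> sol 6 m"

definition gain :: "nat \<Rightarrow> memory \<Rightarrow> nat \<Rightarrow> real" where
  "gain a m v = F (insert (Inr (a, v)) (union_sol m)) - F (union_sol m)"

definition union_inv :: "memory \<Rightarrow> bool" where
  "union_inv m \<longleftrightarrow> nodes 10 m = nodes 4 m \<union> nodes 6 m \<and> arcs 11 m = arcs 5 m \<union> arcs 7 m \<and>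
     nums m 9 0 = F (union_sol m)"

text \<open>The first alternative describes the start values of the scan. In both alternatives the
  stored cost is positive if \<open>1 \<le> k\<close>, as cross multiplication requires.\<close>

definition edge_inv :: "nat \<Rightarrow> nat \<Rightarrow> memory \<Rightarrow> bool" where
  "edge_inv a j m \<longleftrightarrow>
     (nums m 10 0 = - 1 \<and> nums m 11 0 = k \<and> (\<forall>v<j. \<not> cand a m v)) \<or>
     (\<exists>e. nats m 18 0 = e \<and> cand a m e \<and> nums m 10 0 = gain a m e \<and> nums m 11 0 = cost G (a, e) \<and>
       (\<forall>v<j. cand a m v \<longrightarrow> gain a m v / cost G (a, v) \<le> gain a m e / cost G (a, e)))"

lemma union_sol_cong:
  "nats m' 4 = nats m 4 \<Longrightarrow> nats m' 5 = nats m 5 \<Longrightarrow> nats m' 6 = nats m 6 \<Longrightarrow> nats m' 7 = nats m 7 \<Longrightarrow>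
   union_sol m' = union_sol m"
  by (simp add: union_sol_def sol_def nodes_def arcs_def)

lemma cand_cong: "nats m' 5 = nats m 5 \<Longrightarrow> nats m' 7 = nats m 7 \<Longrightarrow> cand a m' = cand a m"
  by (rule ext) (simp only: cand_def arcs_def)

lemma gain_cong:
  "nats m' 4 = nats m 4 \<Longrightarrow> nats m' 5 = nats m 5 \<Longrightarrow> nats m' 6 = nats m 6 \<Longrightarrow> nats m' 7 = nats m 7 \<Longrightarrow>
   gain a m' = gain a m"
  using union_sol_cong[of m' m] by (simp add: gain_def fun_eq_iff)

definition t_try_edge :: nat where
  "t_try_edge = 1 + 1 + (1 + (1 + 1 + (1 + (1 + (1 + (1 + (1 + (1 + 1)) + 1))))) + 1)"

lemma run_try_edge:
  assumes m: "ok m" "greedy_inv m" "star_inv a m" "union_inv m" "nats m 16 0 = v" "v < n" "edge_inv a v m"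
  shows "run try_edge t_try_edge (\<lambda>m'. ok m' \<and> same {18} {2, 10, 11} m m' \<and> edge_inv a (Suc v) m') m"
    (is "run _ _ ?Q m")
proof -
  have a: "nats m 14 0 = a" "a < n" "nodes 6 m = {a}"
    using m by (simp_all add: star_inv_def)
  have k1: "1 \<le> real k"
    using m weight_nonneg[of "arcs 7 m"] arcs_subset[of 7 m] by (auto simp: star_inv_def)
  note idx = head_index[OF m(1) a(1,2) m(5,6)]
  let ?c = "cost G (a, v)"
  define b where "b = nats m 11 (a * n + v)"
  have b: "b \<le> 1" "b = 0 \<longleftrightarrow> (a, v) \<notin> arcs 5 m \<union> arcs 7 m"
  proof -
    show "b \<le> 1"
      using ok_bit[OF m(1), of 11 "a * n + v"] by (simp add: b_def)
    have "b \<noteq> 0 \<longleftrightarrow> (a, v) \<in> arcs 11 m"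
      using a(2) m(6) by (simp add: b_def arcs_def in_edge_set)
    then show "b = 0 \<longleftrightarrow> (a, v) \<notin> arcs 5 m \<union> arcs 7 m"
      using m(4) by (auto simp: union_inv_def)
  qed
  have vals: "nval m (NPlus (NLoad 1 head_index) (NLoad 11 head_index)) = (if (a, v) \<in> edges G then 1 else 0) + b"
    "rval m (RLoad 1 head_index) = ?c"
    using m a ok_n[OF m(1)] ok_edge[OF m(1) a(2) m(6)] ok_cost[OF m(1) a(2) m(6)]
    by (simp_all add: b_def)
  have fit: "nfit K m (NPlus (NLoad 1 head_index) (NLoad 11 head_index))" "rfit w W K m (RLoad 1 head_index)"
    "nfit K m head_index"
    using idx vals K_bounds b fits_cost[OF a(2) m(6)] ok_K[OF m(1)] by (auto simp: fits_w)
  have cons: "w 0 \<le> W" "w 1 \<le> W" "w (real k) \<le> W" "w (1 + ?c) \<le> W" "w ?c \<le> W"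
    using fits_const fits_k fits_add_cost[OF a(2) m(6)] fits_cost[OF a(2) m(6)] by (auto intro: fits_w)
  have mem: "cand a m v \<longleftrightarrow> (a, v) \<notin> edges G \<and> b = 0 \<and> 0 < ?c \<and> 1 + ?c \<le> k"
    using m(6) b by (auto simp: cand_def)
  have skip: "run Skip 1 ?Q m" if "\<not> cand a m v"
    using that m by (intro run_Skip) (auto simp: same_def edge_inv_def less_Suc_eq)
  let ?test = "RLess (RTimes (rvar 10) (RLoad 1 head_index)) (RTimes (RMinus (rvar 2) (rvar 9)) (rvar 11))"
  let ?upd = "Seq (rassign 10 (RMinus (rvar 2) (rvar 9))) (Seq (rassign 11 (RLoad 1 head_index)) (nassign 18 (nvar 16)))"
  have main: "run (Seq (NAssign 11 head_index (NConst 1)) (Seq (Query 10 11 2)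
             (Seq (NAssign 11 head_index (NConst 0)) (If ?test ?upd Skip))))
      (1 + (1 + (1 + (1 + (1 + (1 + 1)) + 1)))) ?Q m" if c: "cand a m v"
  proof -
    define r where "r = F (insert (Inr (a, v)) (union_sol m))"
    have c0: "0 < ?c" "b = 0" and vE: "(a, v) \<notin> edges G"
      using c mem by auto
    let ?m1 = "nset m 11 (a * n + v) 1"
    let ?m2 = "rset ?m1 2 0 r"
    let ?m3 = "nset ?m2 11 (a * n + v) 0"
    have valid4: "valid (nodes 4 m) (arcs 5 m)"
      using m by (simp add: greedy_inv_def valid_at_def)
    have valid6: "valid (nodes 6 m) (insert (a, v) (arcs 7 m))" "valid (nodes 6 m) (arcs 7 m)"
      using star_valid[OF m(3)] a m(6) vE by (auto simp: valid_at_def valid_def)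
    note valid = valid_Un[OF valid4 valid6(1)]
    have items: "items (nodes 4 m \<union> nodes 6 m) (arcs 5 m \<union> insert (a, v) (arcs 7 m)) = insert (Inr (a, v)) (union_sol m)"
      by (auto simp: union_sol_def sol_def items_def)
    have items': "items (nodes 4 m \<union> nodes 6 m) (arcs 5 m \<union> arcs 7 m) = union_sol m"
      by (simp add: union_sol_def sol_def items_Un)
    have sets1: "nodes 10 ?m1 = nodes 4 m \<union> nodes 6 m" "arcs 11 ?m1 = arcs 5 m \<union> insert (a, v) (arcs 7 m)"
      using m(4) a m(6) by (auto simp: union_inv_def nodes_def arcs_def edge_set_insert)
    have query: "spread G (nodes 10 ?m1) (arcs 11 ?m1) = r"
      unfolding sets1 r_def items[symmetric] by (rule spread_valid[OF valid])
    have r: "fits r"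
      unfolding r_def items[symmetric] using F_le[OF valid] F_Z[OF valid]
        F.nonneg[of "items (nodes 4 m \<union> nodes 6 m) (arcs 5 m \<union> insert (a, v) (arcs 7 m))"]
      by (simp add: fits_def)
    define g where "g = r - nums m 9 0"
    have g: "g = gain a m v"
      using m(4) by (simp add: g_def r_def gain_def union_inv_def)
    have fits_g: "fits g"
      using fits_gain[OF valid valid_Un[OF valid4 valid6(2)]]
      by (simp only: g gain_def items items')
    have g0: "0 \<le> g"
      unfolding g gain_def using F.mono[of "union_sol m" "insert (Inr (a, v)) (union_sol m)"] by auto
    have ok1: "ok ?m1"
      using m by (intro ok_nset_bit) auto
    have ok2: "ok ?m2"
      by (rule ok_rset[OF ok1 _ r]) simp
    have ok3: "ok ?m3"
      by (rule ok_nset_bit[OF ok2]) auto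
    \<comment> \<open>As \<open>b = 0\<close>, the cell was off before, and switching it off
      restores the whole array.\<close>
    have nats3: "nats ?m3 = nats m"
      using c0 by (auto simp: fun_eq_iff b_def)
    have idx2: "nval ?m2 head_index = a * n + v" "nfit K ?m2 head_index"
      by (rule head_index[OF ok2]; use a m in simp)+
    have idx3: "nval ?m3 head_index = a * n + v" "nfit K ?m3 head_index"
      by (rule head_index[OF ok3]; use a m in simp)+
    have c3: "rval ?m3 (RLoad 1 head_index) = ?c"
      using idx3(1) ok_cost[OF m(1) a(2) m(6)] by simp
    have ec: "0 < nums m 11 0"
      using m(7) k1 by (auto simp: edge_inv_def cand_def)
    have holds: "holds ?m3 ?test \<longleftrightarrow> nums m 10 0 / nums m 11 0 < g / ?c"
    proof -
      have "holds ?m3 ?test \<longleftrightarrow> nums m 10 0 * ?c < g * nums m 11 0"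
        using c3 by (simp add: g_def)
      then show ?thesis
        using c0 ec by (simp add: field_simps)
    qed
    have w: "w (nums m 10 0 * ?c) \<le> W" "w (g * nums m 11 0) \<le> W" "w g \<le> W" "w r \<le> W"
      "\<And>x. 2 \<le> x \<Longrightarrow> w (nums m x 0) \<le> W"
      using fits_w fits_mult_w ok_fits[OF m(1)] fits_g r fits_cost[OF a(2) m(6)] by auto
    have fit3: "nfit K ?m3 (NLoad 1 head_index)" "rfit w W K ?m3 (RLoad 1 head_index)"
      using idx3 c3 cons ok_K[OF m(1)] by auto
    have upd: "run ?upd (1 + (1 + 1)) ?Q ?m3" if better: "nums m 10 0 / nums m 11 0 < g / ?c"
    proof -
      let ?m4 = "rset ?m3 10 0 g"
      let ?m5 = "rset ?m4 11 0 ?c"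
      let ?m6 = "nset ?m5 18 0 v"
      have ok4: "ok ?m4"
        by (rule ok_rset[OF ok3 _ fits_g]) simp
      have idx4: "nval ?m4 head_index = a * n + v" "nfit K ?m4 head_index"
        by (rule head_index[OF ok4]; use a m in simp)+
      have "ok ?m5"
        by (rule ok_rset[OF ok4 _ fits_cost[OF a(2) m(6)]]) simp
      then have ok6: "ok ?m6"
        using K_bounds m(6) by (intro ok_nset) auto
      have c4: "rval ?m4 (RLoad 1 head_index) = ?c"
        using idx4(1) ok_cost[OF m(1) a(2) m(6)] by simp
      have "edge_inv a (Suc v) ?m6"
      proof -
        have eq: "cand a ?m6 = cand a m" "gain a ?m6 = gain a m"
          using nats3 by (auto intro!: cand_cong gain_cong)
        have "gain a m u / cost G (a, u) \<le> g / ?c" if "u < Suc v" "cand a m u" for u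
        proof (cases "u = v")
          case False
          then have "u < v"
            using that by simp
          then have "gain a m u / cost G (a, u) \<le> nums m 10 0 / nums m 11 0"
            using m(7) that(2) unfolding edge_inv_def by auto
          then show ?thesis
            using better by linarith
        qed (simp add: g)
        then show ?thesis
          unfolding edge_inv_def eq using c g by simp
      qed
      moreover have "same {18} {2, 10, 11} m ?m6"
        using nats3 by (auto simp: same_def)
      ultimately have "?Q ?m6"
        using ok6 by blast
      then have 1: "run (nassign 18 (nvar 16)) 1 ?Q ?m5"
        using m K_bounds by - (rule run_NAssign, auto)
      have 2: "run (Seq (rassign 11 (RLoad 1 head_index)) (nassign 18 (nvar 16))) (1 + 1) ?Q ?m4"
      proof (rule run_Seq, rule run_RAssign)
        show "rfit w W K ?m4 (RLoad 1 head_index)"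
          using idx4 c4 cons ok_K[OF m(1)] by auto
        show "run (nassign 18 (nvar 16)) 1 ?Q
            (rset ?m4 11 (nval ?m4 (NConst 0)) (rval ?m4 (RLoad 1 head_index)))"
          unfolding c4 using 1 by simp
      qed simp_all
      show ?thesis
      proof (rule run_Seq, rule run_RAssign)
        show "rfit w W K ?m3 (RMinus (rvar 2) (rvar 9))"
          using w w(5)[of 9] by (simp add: g_def)
      qed (use 2 in \<open>simp_all add: g_def\<close>)
    qed
    have "run (If ?test ?upd Skip) (1 + (1 + (1 + 1)) + 1) ?Q ?m3"
    proof (rule run_If, goal_cases)
      case 1
      then show ?case
        using w w(5)[of 9] w(5)[of 10] w(5)[of 11] fit3 c3 by (simp add: g_def)
    next
      case 3
      then show ?case
        unfolding holds by (rule upd)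
    next
      case 4
      then have le: "g / ?c \<le> nums m 10 0 / nums m 11 0"
        unfolding holds by simp
      have "0 \<le> g / ?c"
        using g0 c0 by simp
      then have "0 \<le> nums m 10 0 / nums m 11 0"
        using le by linarith
      \<comment> \<open>A failed comparison with a nonnegative density rules out the start values,
        so a true candidate is stored.\<close>
      then have "nums m 10 0 \<noteq> - 1"
        using ec by (simp add: zero_le_divide_iff)
      then obtain e where e: "nats m 18 0 = e" "cand a m e" "nums m 10 0 = gain a m e"
        "nums m 11 0 = cost G (a, e)"
        "\<forall>u<v. cand a m u \<longrightarrow> gain a m u / cost G (a, u) \<le> gain a m e / cost G (a, e)"
        using m(7) unfolding edge_inv_def by blast
      have eq: "cand a ?m3 = cand a m" "gain a ?m3 = gain a m"
        using nats3 by (auto intro!: cand_cong gain_cong)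
      have "edge_inv a (Suc v) ?m3"
        unfolding edge_inv_def eq nats3 using e le g by (auto simp: less_Suc_eq)
      moreover have "same {18} {2, 10, 11} m ?m3"
        using nats3 by (auto simp: same_def)
      ultimately show ?case
        using ok3 by (intro run_Skip) blast
    qed simp
    then have 3: "run (Seq (NAssign 11 head_index (NConst 0)) (If ?test ?upd Skip)) (1 + (1 + (1 + (1 + 1)) + 1)) ?Q ?m2"
    proof -
      assume "run (If ?test ?upd Skip) (1 + (1 + (1 + 1)) + 1) ?Q ?m3"
      then have "run (If ?test ?upd Skip) (1 + (1 + (1 + 1)) + 1) ?Q
          (nset ?m2 11 (nval ?m2 head_index) (nval ?m2 (NConst 0)))"
        unfolding idx2(1) by (simp only: nval.simps)
      then show ?thesis
        by (rule run_Seq[OF run_NAssign[OF idx2(2)], rotated 2]) simp_all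
    qed
    then have 4: "run (Seq (Query 10 11 2) (Seq (NAssign 11 head_index (NConst 0)) (If ?test ?upd Skip)))
        (1 + (1 + (1 + (1 + (1 + 1)) + 1))) ?Q ?m1"
      by - (rule run_Seq, rule run_Query, unfold query)
    show ?thesis
    proof (rule run_Seq, rule run_NAssign)
      show "run (Seq (Query 10 11 2) (Seq (NAssign 11 head_index (NConst 0)) (If ?test ?upd Skip)))
        (1 + (1 + (1 + (1 + (1 + 1)) + 1))) ?Q (nset m 11 (nval m head_index) (nval m (NConst 1)))"
        unfolding idx(1) using 4 by simp
    qed (use fit K_bounds in simp_all)
  qed
  show ?thesis
    unfolding try_edge_def t_try_edge_def
    apply (rule run_If)
    subgoal using fit by simp
    subgoal by simp
    subgoal using vals by (intro skip) (auto simp: mem split: if_splits)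
    apply (rule run_If)
    subgoal using fit cons by simp
    subgoal by simp
    subgoal
      apply (rule run_If)
      subgoal using fit cons vals K_bounds m by (simp add: ok_n ok_k)
      subgoal by simp
      subgoal using vals m by (intro skip) (auto simp: mem ok_k split: if_splits)
      subgoal using vals m by (intro main) (auto simp: mem ok_k split: if_splits)
      done
    subgoal using vals by (intro skip) (auto simp: mem split: if_splits)
    done
qed

definition t_scan_edges :: nat where
  "t_scan_edges = 1 + (1 + (n * (t_try_edge + 2) + 2))"

lemma run_scan_edges:
  assumes m: "ok m" "greedy_inv m" "star_inv a m" "union_inv m"
  shows "run scan_edges t_scan_edges (\<lambda>m'. ok m' \<and> same {16, 18} {2, 10, 11} m m' \<and> edge_inv a n m') m"
    (is "run _ _ ?Q m")
proof -
  let ?I = "\<lambda>j m'. ok m' \<and> same {16, 18} {2, 10, 11} m m' \<and> edge_inv a j m'"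
  let ?m1 = "rset m 10 0 (- 1)"
  let ?m2 = "rset ?m1 11 0 k"
  have ok1: "ok ?m1"
    by (rule ok_rset[OF m(1) _ fits_const(3)]) simp
  have ok2: "ok ?m2"
    by (rule ok_rset[OF ok1 _ fits_k]) simp
  have "run (repeat 16 n_exp try_edge) (n * (t_try_edge + 2) + 2) ?Q ?m2"
  proof (rule run_repeat[where I = ?I])
    have "ok (nset ?m2 16 0 0)"
      by (rule ok_nset[OF ok2]) auto
    then show "?I 0 (nset ?m2 16 0 0)"
      by (simp add: same_def edge_inv_def)
  next
    fix j m3 assume I: "?I j m3" and j: "j < n" and m3: "nats m3 16 0 = j"
    have s: "nats m3 x = nats m x" if "x \<notin> {16, 18}" for x
      using I that by (simp add: same_def)
    have r: "nums m3 x = nums m x" if "x \<notin> {2, 10, 11}" for x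
      using I that by (simp add: same_def)
    have "greedy_inv m3"
      using m(2) s r by (simp add: greedy_inv_cong[of m3 m])
    moreover have "star_inv a m3"
      using m(3) s r by (simp add: star_inv_cong[of m3 m])
    moreover have "union_inv m3"
      using m(4) s r union_sol_cong[of m3 m] by (simp add: union_inv_def nodes_def arcs_def)
    ultimately show "run try_edge t_try_edge (\<lambda>m'. ok m' \<and> nats m' 16 0 = j \<and> ?I (Suc j) (nset m' 16 0 (Suc j))) m3"
    proof (intro run_mono[OF run_try_edge[where a = a and v = j]])
      fix m4 assume m4: "ok m4 \<and> same {18} {2, 10, 11} m3 m4 \<and> edge_inv a (Suc j) m4"
      let ?m5 = "nset m4 16 0 (Suc j)"
      have "ok ?m5"
        using m4 j K_bounds by (intro ok_nset) auto
      moreover have "same {16, 18} {2, 10, 11} m ?m5"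
        using I m4 by (simp add: same_def)
      moreover have "edge_inv a (Suc j) ?m5"
        using m4 unfolding edge_inv_def by (simp add: cand_cong[of ?m5 m4] gain_cong[of ?m5 m4])
      ultimately show "ok m4 \<and> nats m4 16 0 = j \<and> ?I (Suc j) ?m5"
        using m3 m4 by (simp add: same_def)
    qed (use I j m3 in auto)
  qed (use n_exp_bound K_bounds in auto)
  then have "run (Seq (rassign 11 (ROfNat k_exp)) (repeat 16 n_exp try_edge)) (1 + (n * (t_try_edge + 2) + 2)) ?Q ?m1"
    using fits_w[OF fits_k] ok_k[OF m(1)] K_bounds by - (rule run_Seq, rule run_RAssign, auto)
  then show ?thesis
    unfolding scan_edges_def t_scan_edges_def
    using fits_w[OF fits_const(3)] by - (rule run_Seq, rule run_RAssign, auto)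
qed

definition best_edge :: "nat \<Rightarrow> memory \<Rightarrow> nat \<Rightarrow> bool" where
  "best_edge a m e \<longleftrightarrow> cand a m e \<and>
     (\<forall>v. cand a m v \<longrightarrow> gain a m v / cost G (a, v) \<le> gain a m e / cost G (a, e))"

text \<open>An edge that does not fit leaves the star unchanged but is still reported as the best
  one; what this means for a star \<open>Q\<close> is decided in the analysis of the growth.\<close>

lemma run_extend_star:
  assumes m: "ok m" "star_inv a m" "edge_inv a n m"
  shows "run extend_star (1 + 1 + (1 + 1)) (\<lambda>m'. ok m' \<and> same {7} {8} m m' \<and> star_inv a m' \<and>
    ((\<forall>v. \<not> cand a m v) \<or>
     (\<exists>e. best_edge a m e \<and> (nums m 8 0 + cost G (a, e) \<le> k \<longrightarrow> arcs 7 m' = insert (a, e) (arcs 7 m))))) m"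
    (is "run _ _ ?Q m")
proof -
  let ?t = "nums m 8 0" and ?c = "nums m 11 0"
  have a: "nats m 14 0 = a" "a < n" and t: "?t = 1 + weight (arcs 7 m)" "?t \<le> k"
    using m by (simp_all add: star_inv_def)
  have t1: "1 \<le> ?t"
    using t weight_nonneg[of "arcs 7 m"] arcs_subset[of 7 m] by auto
  have cands: "cand a m v \<Longrightarrow> v < n" for v
    by (simp add: cand_def)
  have cases: "(?c = k \<and> (\<forall>v. \<not> cand a m v)) \<or>
    (best_edge a m (nats m 18 0) \<and> ?c = cost G (a, nats m 18 0))"
    using m(3) cands unfolding edge_inv_def best_edge_def by blast
  have Zt: "?t \<in> Z" "?c \<in> Z"
    using ok_fits[OF m(1), of 8] ok_fits[OF m(1), of 11] by (simp_all add: fits_def)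
  have c: "0 \<le> ?c" "?c \<le> n"
    using cases cost_bounds[OF a(2), of "nats m 18 0"] cands[of "nats m 18 0"] k_less
    by (auto simp: best_edge_def)
  have f: "fits (?t + ?c)"
    using Zt c t t1 k_less by (auto simp: fits_def add_Z)
  have w: "w (real k) \<le> W" "w ?t \<le> W" "w ?c \<le> W" "w (?t + ?c) \<le> W"
    using f fits_k ok_fits[OF m(1)] by (auto intro: fits_w)
  have fit: "tfit w W K m (RLess (ROfNat k_exp) (RPlus (rvar 8) (rvar 11)))"
    using w ok_k[OF m(1)] K_bounds by simp
  show ?thesis
    unfolding extend_star_def
  proof (rule run_If[OF fit], goal_cases)
    case 2
    then have over: "k < ?t + ?c"
      using ok_k[OF m(1)] by simp
    have "(\<forall>v. \<not> cand a m v) \<or> (\<exists>e. best_edge a m e \<and> (?t + cost G (a, e) \<le> k \<longrightarrow> arcs 7 m = insert (a, e) (arcs 7 m)))"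
      using cases over by force
    then show ?case
      using m by (intro run_Skip) (simp add: same_def)
  next
    case 3
    then have le: "?t + ?c \<le> k"
      using ok_k[OF m(1)] by simp
    define e where "e = nats m 18 0"
    \<comment> \<open>The start values are excluded: the dummy cost \<open>k\<close> next to a star
      of cost at least 1 exceeds the budget.\<close>
    have e: "best_edge a m e" "?c = cost G (a, e)"
      using cases le t1 by (auto simp: e_def)
    then have en: "e < n" "(a, e) \<notin> edges G" "(a, e) \<notin> arcs 7 m"
      by (auto simp: best_edge_def cand_def)
    let ?m1 = "nset m 7 (a * n + e) 1"
    let ?m2 = "rset ?m1 8 0 (?t + ?c)"
    have ok1: "ok ?m1"
      using m(1) by (intro ok_nset_bit) auto
    have ok2: "ok ?m2"
      by (rule ok_rset[OF ok1 _ f]) simp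
    have arcs2: "arcs 7 ?m2 = insert (a, e) (arcs 7 m)"
      using a en by (simp add: arcs_def edge_set_insert)
    have "weight (insert (a, e) (arcs 7 m)) = cost G (a, e) + weight (arcs 7 m)"
      by (rule weight_insert[OF arcs_subset a(2) en(1,3)])
    moreover have "nodes 6 ?m2 = nodes 6 m"
      by (simp add: nodes_def)
    ultimately have "star_inv a ?m2"
      using m(2) en arcs2 e(2) le unfolding star_inv_def by auto
    moreover have "same {7} {8} m ?m2"
      by (simp add: same_def)
    ultimately have Q: "?Q ?m2"
      using ok2 arcs2 e(1) by blast
    then have 2: "run (rassign 8 (RPlus (rvar 8) (rvar 11))) 1 ?Q ?m1"
      using w by - (rule run_RAssign, auto)
    have idx: "nval m (NPlus (NTimes (nvar 14) n_exp) (nvar 18)) = a * n + e"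
      "nfit K m (NPlus (NTimes (nvar 14) n_exp) (nvar 18))"
    proof -
      show "nval m (NPlus (NTimes (nvar 14) n_exp) (nvar 18)) = a * n + e"
        using a ok_n[OF m(1)] by (simp add: e_def)
      have "a * n + e < K" "e < K" "n < K" "a < K"
        using index_less[OF a(2) en(1)] K_bounds a en by linarith+
      then show "nfit K m (NPlus (NTimes (nvar 14) n_exp) (nvar 18))"
        using a ok_n[OF m(1)] by (simp add: e_def[symmetric])
    qed
    show ?case
    proof (rule run_Seq, rule run_NAssign)
      show "run (rassign 8 (RPlus (rvar 8) (rvar 11))) 1 ?Q
          (nset m 7 (nval m (NPlus (NTimes (nvar 14) n_exp) (nvar 18))) (nval m (NConst 1)))"
        unfolding idx(1) using 2 by simp
    qed (use idx K_bounds in auto)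
  qed simp
qed

section \<open>Growing one star\<close>

definition t_round :: nat where
  "t_round = t_try_star + (t_scan_edges + (1 + 1 + (1 + 1)))"

definition round_vars :: "nat set" where
  "round_vars = {7, 8, 9, 10, 11, 13, 16, 17, 18}"

definition round_nums :: "nat set" where
  "round_nums = {2, 6, 7, 8, 9, 10, 11}"

lemma run_round:
  assumes m: "ok m" "greedy_inv m" "best_inv m" "star_inv a m"
  shows "run (Seq try_star (Seq scan_edges extend_star)) t_round (\<lambda>m'. ok m' \<and>
    same (round_vars - {17}) round_nums m m' \<and> best_inv m' \<and> density m \<le> density m' \<and>
    (F (union_sol m) - F (sol 4 m)) / nums m 8 0 \<le> density m' \<and> star_inv a m' \<and>
    ((\<forall>v. \<not> cand a m v) \<or>
     (\<exists>e. best_edge a m e \<and> (nums m 8 0 + cost G (a, e) \<le> k \<longrightarrow> arcs 7 m' = insert (a, e) (arcs 7 m))))) m"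
    (is "run _ _ ?Q m")
  unfolding t_round_def
proof (rule run_Seq, rule run_mono, rule run_try_star[OF m])
  fix m1 assume "ok m1 \<and> same {8, 9, 10, 11, 13} {6, 7, 9} m m1 \<and>
    best_inv m1 \<and> density m \<le> density m1 \<and>
    (F (sol 4 m \<union> sol 6 m) - F (sol 4 m)) / nums m 8 0 \<le> density m1 \<and>
    nodes 10 m1 = nodes 4 m \<union> nodes 6 m \<and> arcs 11 m1 = arcs 5 m \<union> arcs 7 m \<and>
    nums m1 9 0 = F (sol 4 m \<union> sol 6 m)"
  then have m1: "ok m1" "same {8, 9, 10, 11, 13} {6, 7, 9} m m1" "best_inv m1"
    "density m \<le> density m1" "(F (union_sol m) - F (sol 4 m)) / nums m 8 0 \<le> density m1"
    "nodes 10 m1 = nodes 4 m \<union> nodes 6 m" "arcs 11 m1 = arcs 5 m \<union> arcs 7 m" "nums m1 9 0 = F (union_sol m)"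
    unfolding union_sol_def by blast+
  have s1: "nats m1 x = nats m x" if "x \<notin> {8, 9, 10, 11, 13}" for x
    using m1(2) that by (simp add: same_def)
  have r1: "nums m1 x = nums m x" if "x \<notin> {6, 7, 9}" for x
    using m1(2) that by (simp add: same_def)
  have inv1: "greedy_inv m1" "star_inv a m1"
    using m s1 r1 by (simp_all add: greedy_inv_cong[of m1 m] star_inv_cong[of m1 m])
  have union1: "union_inv m1"
    using m1 s1 union_sol_cong[of m1 m] by (simp add: union_inv_def nodes_def arcs_def)
  show "run (Seq scan_edges extend_star) (t_scan_edges + (1 + 1 + (1 + 1))) ?Q m1"
  proof (rule run_Seq, rule run_mono, rule run_scan_edges[OF m1(1) inv1 union1])
    fix m2 assume m2: "ok m2 \<and> same {16, 18} {2, 10, 11} m1 m2 \<and> edge_inv a n m2"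
    have s2: "nats m2 x = nats m1 x" if "x \<notin> {16, 18}" for x
      using m2 that by (simp add: same_def)
    have r2: "nums m2 x = nums m1 x" if "x \<notin> {2, 10, 11}" for x
      using m2 that by (simp add: same_def)
    have star2: "star_inv a m2"
      using inv1(2) s2 r2 by (simp add: star_inv_cong[of m2 m1])
    have eq: "cand a m2 = cand a m" "gain a m2 = gain a m" "nums m2 8 = nums m 8" "arcs 7 m2 = arcs 7 m"
      using s1 s2 r1 r2 by (auto intro!: cand_cong gain_cong arcs_cong)
    show "run extend_star (1 + 1 + (1 + 1)) ?Q m2"
    proof (rule run_mono, rule run_extend_star)
      fix m3 assume m3: "ok m3 \<and> same {7} {8} m2 m3 \<and> star_inv a m3 \<and>
        ((\<forall>v. \<not> cand a m2 v) \<or>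
         (\<exists>e. best_edge a m2 e \<and> (nums m2 8 0 + cost G (a, e) \<le> k \<longrightarrow> arcs 7 m3 = insert (a, e) (arcs 7 m2))))"
      have s3: "nats m3 x = nats m2 x" if "x \<notin> {7}" for x
        using m3 that by (simp add: same_def)
      have r3: "nums m3 x = nums m2 x" if "x \<notin> {8}" for x
        using m3 that by (simp add: same_def)
      have "best_inv m3"
        using m1(3) s2 s3 r2 r3 by (simp add: best_inv_cong[of m3 m1])
      moreover have "density m3 = density m1"
        using r2 r3 by (simp add: density_cong[of m3 m1])
      moreover have "same (round_vars - {17}) round_nums m m3"
        using s1 s2 s3 r1 r2 r3 by (simp add: same_def round_vars_def round_nums_def)
      ultimately show "?Q m3"
        using m1 m3 unfolding best_edge_def eq by auto
    qed (use m2 star2 in auto)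
  qed
qed

definition t_grow_star :: nat where
  "t_grow_star = (n + 1) * (t_round + 2) + 2"

definition pairs_tried :: "nat \<Rightarrow> memory \<Rightarrow> bool" where
  "pairs_tried a m \<longleftrightarrow> (\<forall>v<n. (a, v) \<notin> edges G \<longrightarrow> 0 < cost G (a, v) \<longrightarrow> 1 + cost G (a, v) \<le> k \<longrightarrow>
     (F (sol 4 m \<union> items {a} {(a, v)}) - F (sol 4 m)) / (1 + cost G (a, v)) \<le> density m)"

text \<open>For each fitting \<open>Q\<close>, either its claim is settled after \<open>j\<close>
  rounds, or the star has at least \<open>j\<close> edges, is no heavier than \<open>Q\<close> and
  obeys the decay bound. No star has \<open>n + 1\<close> edges, so in the end all claims are
  settled. This requires a start of weight zero and rated single edges; for other starts only the
  density of the start star matters.\<close>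

lemma run_grow_star:
  assumes m: "ok m" "greedy_inv m" "best_inv m" "star_inv a m"
  shows "run grow_star t_grow_star (\<lambda>m'. ok m' \<and> same round_vars round_nums m m' \<and>
    best_inv m' \<and> density m \<le> density m' \<and>
    (F (union_sol m) - F (sol 4 m)) / nums m 8 0 \<le> density m' \<and>
    (nums m 8 0 = 1 \<longrightarrow> pairs_tried a m \<longrightarrow> (\<forall>Q. fitting a Q \<longrightarrow> claim (sol 4 m) a Q (density m')))) m"
    (is "run _ _ ?Q m")
proof -
  define S where "S = sol 4 m"
  define V where "V Q = F (S \<union> items {a} Q) - F S" for Q
  define pre where "pre \<longleftrightarrow> nums m 8 0 = 1 \<and> pairs_tried a m"
  have a: "a < n"
    using m by (simp add: star_inv_def)
  let ?P = "\<lambda>j m' Q. claim S a Q (density m') \<or>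
    (j \<le> card (arcs 7 m') \<and> weight (arcs 7 m') \<le> weight Q \<and>
     V Q - (F (union_sol m') - F S) \<le> V Q * exp (- weight (arcs 7 m') / weight Q))"
  let ?I = "\<lambda>j m'. ok m' \<and> same round_vars round_nums m m' \<and> best_inv m' \<and> star_inv a m' \<and>
    density m \<le> density m' \<and> (j = 0 \<longrightarrow> arcs 7 m' = arcs 7 m \<and> nums m' 8 0 = nums m 8 0) \<and>
    (0 < j \<longrightarrow> (F (union_sol m) - F S) / nums m 8 0 \<le> density m') \<and>
    (pre \<longrightarrow> (\<forall>Q. fitting a Q \<longrightarrow> ?P j m' Q))"
  have "run (repeat 17 (NPlus n_exp (NConst 1)) (Seq try_star (Seq scan_edges extend_star)))
      ((n + 1) * (t_round + 2) + 2) ?Q m"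
  proof (rule run_repeat[where I = ?I])
    let ?m1 = "nset m 17 0 0"
    \<comment> \<open>At weight zero the exponential factor is 1, also if
      \<open>weight Q = 0\<close>.\<close>
    have "?P 0 ?m1 Q" if pre and Q: "fitting a Q" for Q
    proof -
      have "weight (arcs 7 m) = 0"
        using m(4) \<open>pre\<close> by (simp add: pre_def star_inv_def)
      moreover have "0 \<le> weight Q"
        using Q a by (intro weight_nonneg) (auto simp: fitting_def)
      moreover have "arcs 7 ?m1 = arcs 7 m"
        by (simp add: arcs_def)
      moreover have "F S \<le> F (union_sol ?m1)"
        using union_sol_cong[of ?m1 m] by (auto simp: union_sol_def S_def intro!: F.mono)
      ultimately show ?thesis
        by simp
    qed
    then show "?I 0 ?m1"
      using m by (auto simp: same_def round_vars_def best_inv_cong[of ?m1 m] star_inv_cong[of ?m1 m]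
          density_cong[of ?m1 m] arcs_def intro: ok_nset)
  next
    fix j m1 assume I: "?I j m1" and j: "j < n + 1" and m1: "nats m1 17 0 = j"
    have s: "nats m1 x = nats m x" if "x \<notin> round_vars" for x
      using I that by (simp add: same_def)
    have r: "nums m1 x = nums m x" if "x \<notin> round_nums" for x
      using I that by (simp add: same_def)
    have inv1: "ok m1" "best_inv m1" "star_inv a m1"
      using I by auto
    have greedy1: "greedy_inv m1"
      using m(2) s r by (simp add: greedy_inv_cong[of m1 m] round_vars_def round_nums_def)
    have sol1: "sol 4 m1 = S"
      using s unfolding S_def by (intro sol_cong) (auto simp: round_vars_def)
    have union1: "union_sol m1 = S \<union> items {a} (arcs 7 m1)"
      using star_sol[OF inv1(3)] sol1 by (simp add: union_sol_def)
    show "run (Seq try_star (Seq scan_edges extend_star)) t_round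
        (\<lambda>m'. ok m' \<and> nats m' 17 0 = j \<and> ?I (Suc j) (nset m' 17 0 (Suc j))) m1"
    proof (rule run_mono, rule run_round[OF inv1(1) greedy1 inv1(2,3)])
      fix m2 assume "ok m2 \<and> same (round_vars - {17}) round_nums m1 m2 \<and> best_inv m2 \<and> density m1 \<le> density m2 \<and>
        (F (union_sol m1) - F (sol 4 m1)) / nums m1 8 0 \<le> density m2 \<and> star_inv a m2 \<and>
        ((\<forall>v. \<not> cand a m1 v) \<or>
         (\<exists>e. best_edge a m1 e \<and> (nums m1 8 0 + cost G (a, e) \<le> k \<longrightarrow> arcs 7 m2 = insert (a, e) (arcs 7 m1))))"
      then have m2: "ok m2" "same (round_vars - {17}) round_nums m1 m2" "best_inv m2" "density m1 \<le> density m2"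
        "(F (union_sol m1) - F S) / nums m1 8 0 \<le> density m2" "star_inv a m2"
        "(\<forall>v. \<not> cand a m1 v) \<or>
         (\<exists>e. best_edge a m1 e \<and> (nums m1 8 0 + cost G (a, e) \<le> k \<longrightarrow> arcs 7 m2 = insert (a, e) (arcs 7 m1)))"
        unfolding sol1 by blast+
      let ?m3 = "nset m2 17 0 (Suc j)"
      have dens3: "density ?m3 = density m2" and arcs3: "arcs 7 ?m3 = arcs 7 m2"
        by (simp_all add: density_def arcs_def)
      have s2: "nats m2 x = nats m1 x" if "x \<notin> round_vars - {17}" for x
        using m2(2) that by (simp add: same_def)
      have star3: "star_inv a ?m3"
        using m2(6) by (simp add: star_inv_cong[of ?m3 m2])
      have sol3: "sol 4 ?m3 = S"
        using s2 unfolding sol1[symmetric] by (intro sol_cong) (auto simp: round_vars_def)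
      have union3: "union_sol ?m3 = S \<union> items {a} (arcs 7 m2)"
        using star_sol[OF star3] sol3 arcs3 by (simp add: union_sol_def)
      have same3: "same round_vars round_nums m ?m3"
        using I m2(2) by (auto simp: same_def round_vars_def)
      have dens: "density m \<le> density m2"
        using I m2(4) by linarith
      have P: "?P (Suc j) ?m3 Q" if pre and Q: "fitting a Q" for Q
      proof (subst disj_commute, rule disjCI)
        assume n3: "\<not> claim S a Q (density ?m3)"
        then have n2: "\<not> claim S a Q (density m2)" and n1: "\<not> claim S a Q (density m1)"
          using dens3 claim_mono m2(4) by auto
        let ?T = "arcs 7 m1"
        have I1: "j \<le> card ?T" "weight ?T \<le> weight Q"
          "V Q - (F (union_sol m1) - F S) \<le> V Q * exp (- weight ?T / weight Q)"
          using I \<open>pre\<close> Q n1 by auto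
        have T: "free_arcs a \<subseteq> ?T" "?T \<subseteq> {a} \<times> {..<n}" and t: "nums m1 8 0 = 1 + weight ?T"
          using inv1(3) by (auto simp: star_inv_def)
        note step = star_step[OF a T Q I1(2), of S "density m2", folded union1, folded V_def, OF I1(3)]
        have d: "(F (union_sol m1) - F S) / (1 + weight ?T) \<le> density m2"
          using m2(5) t by simp
        have cand: "cand a m1 v \<longleftrightarrow> v < n \<and> (a, v) \<notin> edges G \<and> Inr (a, v) \<notin> union_sol m1 \<and>
            0 < cost G (a, v) \<and> 1 + cost G (a, v) \<le> k" for v
          unfolding cand_def union_sol_def sol_def by auto
        obtain e where e: "best_edge a m1 e"
          and ext: "nums m1 8 0 + cost G (a, e) \<le> k \<longrightarrow> arcs 7 m2 = insert (a, e) ?T"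
          using m2(7) step(1)[OF d] n2 cand by blast
        have ce: "e < n" "(a, e) \<notin> ?T" "(a, e) \<notin> edges G" "0 < cost G (a, e)" "1 + cost G (a, e) \<le> k"
          using e by (auto simp: best_edge_def cand_def)
        have pair: "(F (S \<union> items {a} {(a, e)}) - F S) / (1 + cost G (a, e)) \<le> density m2"
        proof -
          have "(F (S \<union> items {a} {(a, e)}) - F S) / (1 + cost G (a, e)) \<le> density m"
            using \<open>pre\<close> ce unfolding pre_def pairs_tried_def S_def by blast
          then show ?thesis
            using dens by linarith
        qed
        have "weight ?T + cost G (a, e) \<le> weight Q \<and>
          V Q - (F (insert (Inr (a, e)) (union_sol m1)) - F S) \<le> V Q * exp (- (weight ?T + cost G (a, e)) / weight Q)"
          using e cand unfolding best_edge_def gain_def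
          by (intro step(2)[OF d _ _ pair[folded V_def] n2]) auto
        note step2 = this
        \<comment> \<open>As long as the claim is open, the extended star is no heavier than
          \<open>Q\<close>; since \<open>Q\<close> fits the budget, so does the new edge, and the
          extension takes place.\<close>
        moreover have arcs2: "arcs 7 m2 = insert (a, e) ?T"
          using ext step2 t Q by (simp add: fitting_def)
        moreover have "weight (arcs 7 m2) = weight ?T + cost G (a, e)"
          unfolding arcs2 using weight_insert[OF arcs_subset a ce(1,2)] by simp
        moreover have "card (arcs 7 m2) = Suc (card ?T)"
          unfolding arcs2 using ce(2) finite_arcs by simp
        moreover have "union_sol ?m3 = insert (Inr (a, e)) (union_sol m1)"
          unfolding union1 union3 arcs2 by (auto simp: items_def)
        ultimately show "Suc j \<le> card (arcs 7 ?m3) \<and> weight (arcs 7 ?m3) \<le> weight Q \<and>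
          V Q - (F (union_sol ?m3) - F S) \<le> V Q * exp (- weight (arcs 7 ?m3) / weight Q)"
          unfolding arcs3 using I1(1) by simp
      qed
      \<comment> \<open>Round 0 rates the start star itself; later rounds inherit the bound because
        densities never decrease.\<close>
      have first: "(F (union_sol m) - F S) / nums m 8 0 \<le> density m2"
      proof (cases "j = 0")
        case True
        then have "arcs 7 m1 = arcs 7 m" "nums m1 8 0 = nums m 8 0"
          using I by auto
        moreover have "union_sol m = S \<union> items {a} (arcs 7 m)"
          using star_sol[OF m(4)] by (simp add: union_sol_def S_def)
        ultimately show ?thesis
          using m2(5) union1 by simp
      next
        case False
        then show ?thesis
          using I m2(4) by auto
      qed
      have "ok ?m3"
        using m2(1) j K_bounds by (intro ok_nset) auto
      moreover have "best_inv ?m3"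
        using m2(3) by (simp add: best_inv_cong[of ?m3 m2])
      moreover have "nats m2 17 0 = j"
        using s2[of 17] m1 by simp
      ultimately show "ok m2 \<and> nats m2 17 0 = j \<and> ?I (Suc j) ?m3"
        using m2(1) same3 star3 dens first P unfolding dens3 by blast
    qed
  next
    fix m' assume I: "?I (n + 1) m'"
    have "card (arcs 7 m') \<le> n"
    proof -
      have "card (arcs 7 m') \<le> card ({a} \<times> {..<n})"
        using I by (intro card_mono) (auto simp: star_inv_def)
      then show ?thesis
        by simp
    qed
    then show "?Q m'"
      using I by (auto simp: S_def pre_def)
  qed (use n1_exp_bound K_bounds in auto)
  then show ?thesis
    unfolding grow_star_def t_grow_star_def .
qed

section \<open>Search over all centers and forced edges\<close>

definition seek_vars :: "nat set" where
  "seek_vars = {6, 7, 8, 9, 10, 11, 13, 14, 15, 16, 17, 18}"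

definition t_seek_star :: nat where
  "t_seek_star = 1 + (1 + (n * ((n + 1) * (t_start_star + t_grow_star + 2) + 2 + 2) + 2))"

definition pair_bound :: "(nat + nat \<times> nat) set \<Rightarrow> nat \<Rightarrow> nat \<Rightarrow> real \<Rightarrow> bool" where
  "pair_bound I a v d \<longleftrightarrow> ((a, v) \<notin> edges G \<longrightarrow> 0 < cost G (a, v) \<longrightarrow> 1 + cost G (a, v) \<le> k \<longrightarrow>
     (F (I \<union> items {a} {(a, v)}) - F I) / (1 + cost G (a, v)) \<le> d)"

lemma pair_bound_mono: "pair_bound I a v d \<Longrightarrow> d \<le> d' \<Longrightarrow> pair_bound I a v d'"
  by (auto simp: pair_bound_def)

text \<open>For \<open>b < n\<close>, an affordable edge \<open>(a, b)\<close> is in the start star,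
  which costs no more than the center with this edge alone; by monotonicity its rating bounds the
  density of that single-edge star. For \<open>b = n\<close> all these bounds are available, and the
  growth settles the center.\<close>

lemma run_try_stars:
  assumes m: "ok m" "greedy_inv m" "best_inv m" "1 \<le> k" "nats m 14 0 = a" "a < n" "nats m 15 0 = b" "b \<le> n"
    and pairs: "\<And>v. v < b \<Longrightarrow> pair_bound (sol 4 m) a v (density m)"
  shows "run (Seq start_star grow_star) (t_start_star + t_grow_star) (\<lambda>m'. ok m' \<and>
    same (seek_vars - {14, 15}) round_nums m m' \<and> best_inv m' \<and> density m \<le> density m' \<and>
    (b < n \<longrightarrow> pair_bound (sol 4 m) a b (density m')) \<and>
    (b = n \<longrightarrow> (\<forall>Q. fitting a Q \<longrightarrow> claim (sol 4 m) a Q (density m')))) m"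
    (is "run _ _ ?Q m")
proof (rule run_Seq, rule run_mono, rule run_start_star[OF m(1,5-8,4)])
  fix m1 assume "ok m1 \<and> same {6, 7, 13, 16} {8} m m1 \<and> star_inv a m1 \<and> arcs 7 m1 = start_arcs a b"
  then have m1: "ok m1" "same {6, 7, 13, 16} {8} m m1" "star_inv a m1" "arcs 7 m1 = start_arcs a b"
    by auto
  have s1: "nats m1 x = nats m x" if "x \<notin> {6, 7, 13, 16}" for x
    using m1(2) that by (simp add: same_def)
  have r1: "nums m1 x = nums m x" if "x \<noteq> 8" for x
    using m1(2) that by (simp add: same_def)
  have inv1: "greedy_inv m1" "best_inv m1" "density m1 = density m" "sol 4 m1 = sol 4 m"
    using m s1 r1 by (simp_all add: greedy_inv_cong[of m1 m] best_inv_cong[of m1 m] density_cong[of m1 m] sol_cong[of m1 4 m])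
  have t: "nums m1 8 0 = 1 + (if b < n \<and> (a, b) \<notin> edges G \<and> 1 + cost G (a, b) \<le> k then cost G (a, b) else 0)"
    using m1(3,4) weight_start_arcs[OF m(6)] by (simp add: star_inv_def)
  have union1: "union_sol m1 = sol 4 m \<union> items {a} (start_arcs a b)"
    using star_sol[OF m1(3)] m1(4) inv1(4) by (simp add: union_sol_def)
  show "run grow_star t_grow_star ?Q m1"
  proof (rule run_mono, rule run_grow_star[OF m1(1) inv1(1,2) m1(3)], unfold inv1)
    fix m2 assume "ok m2 \<and> same round_vars round_nums m1 m2 \<and> best_inv m2 \<and> density m \<le> density m2 \<and>
      (F (union_sol m1) - F (sol 4 m)) / nums m1 8 0 \<le> density m2 \<and>
      (nums m1 8 0 = 1 \<longrightarrow> pairs_tried a m1 \<longrightarrow> (\<forall>Q. fitting a Q \<longrightarrow> claim (sol 4 m) a Q (density m2)))"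
    then have m2: "ok m2" "same round_vars round_nums m1 m2" "best_inv m2" "density m \<le> density m2"
      "(F (union_sol m1) - F (sol 4 m)) / nums m1 8 0 \<le> density m2"
      "nums m1 8 0 = 1 \<Longrightarrow> pairs_tried a m1 \<Longrightarrow> \<forall>Q. fitting a Q \<longrightarrow> claim (sol 4 m) a Q (density m2)"
      by auto
    have "pair_bound (sol 4 m) a b (density m2)" if "b < n"
      unfolding pair_bound_def
    proof (intro impI)
      assume b: "(a, b) \<notin> edges G" "0 < cost G (a, b)" "1 + cost G (a, b) \<le> k"
      then have "(a, b) \<in> start_arcs a b"
        using that by (simp add: start_arcs_def)
      then have "F (sol 4 m \<union> items {a} {(a, b)}) \<le> F (union_sol m1)"
        unfolding union1 by (intro F.mono Un_mono items_mono) auto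
      then have "(F (sol 4 m \<union> items {a} {(a, b)}) - F (sol 4 m)) / (1 + cost G (a, b))
          \<le> (F (union_sol m1) - F (sol 4 m)) / (1 + cost G (a, b))"
        using b by (intro divide_right_mono) auto
      then show "(F (sol 4 m \<union> items {a} {(a, b)}) - F (sol 4 m)) / (1 + cost G (a, b)) \<le> density m2"
        using m2(5) t b that by simp
    qed
    moreover have "\<forall>Q. fitting a Q \<longrightarrow> claim (sol 4 m) a Q (density m2)" if "b = n"
    proof (rule m2(6))
      show "nums m1 8 0 = 1"
        using t that by simp
      show "pairs_tried a m1"
        using pairs unfolding pairs_tried_def pair_bound_def inv1 that by blast
    qed
    moreover have "same (seek_vars - {14, 15}) round_nums m m2"
      using s1 r1 m2(2) by (simp add: same_def seek_vars_def round_vars_def round_nums_def)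
    ultimately show "?Q m2"
      using m2(1,3,4) by blast
  qed
qed

text \<open>Both loops rely on the recorded density never decreasing: the bounds for earlier edges
  and centers stay valid while denser stars replace the recorded one.\<close>

lemma run_seek_star:
  assumes m: "ok m" "greedy_inv m" "1 \<le> k"
  shows "run seek_star t_seek_star (\<lambda>m'. ok m' \<and> same seek_vars round_nums m m' \<and> best_inv m' \<and>
    (\<forall>a<n. \<forall>Q. fitting a Q \<longrightarrow> claim (sol 4 m) a Q (density m'))) m"
    (is "run _ _ ?Q m")
proof -
  define S where "S = sol 4 m"
  let ?I = "\<lambda>j m'. ok m' \<and> same seek_vars round_nums m m' \<and> best_inv m' \<and>
    (\<forall>a<j. \<forall>Q. fitting a Q \<longrightarrow> claim S a Q (density m'))"
  let ?m1 = "rset m 6 0 (- 1)"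
  let ?m2 = "rset ?m1 7 0 1"
  have ok1: "ok ?m1"
    by (rule ok_rset[OF m(1) _ fits_const(3)]) simp
  have ok2: "ok ?m2"
    by (rule ok_rset[OF ok1 _ fits_const(2)]) simp
  let ?inner = "repeat 15 (NPlus n_exp (NConst 1)) (Seq start_star grow_star)"
  have inner: "run ?inner ((n + 1) * (t_start_star + t_grow_star + 2) + 2)
      (\<lambda>m'. ok m' \<and> nats m' 14 0 = a \<and> ?I (Suc a) (nset m' 14 0 (Suc a))) m1"
    if I: "?I a m1" and a: "a < n" and m1: "nats m1 14 0 = a" for a m1
  proof -
    let ?J = "\<lambda>b m'. ok m' \<and> same seek_vars round_nums m m' \<and> best_inv m' \<and> nats m' 14 0 = a \<and>
      density m1 \<le> density m' \<and> (\<forall>v<b. v < n \<longrightarrow> pair_bound S a v (density m')) \<and>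
      (b = n + 1 \<longrightarrow> (\<forall>Q. fitting a Q \<longrightarrow> claim S a Q (density m')))"
    show ?thesis
    proof (rule run_repeat[where I = ?J])
      let ?m3 = "nset m1 15 0 0"
      have "ok ?m3"
        by (rule ok_nset) (use I in auto)
      then show "?J 0 ?m3"
        using I m1 by (simp add: same_def seek_vars_def best_inv_cong[of ?m3 m1] density_cong[of ?m3 m1])
    next
      fix b m3 assume J: "?J b m3" and b: "b < n + 1" and m3: "nats m3 15 0 = b"
      have s3: "nats m3 x = nats m x" if "x \<notin> seek_vars" for x
        using J that by (simp add: same_def)
      have r3: "nums m3 x = nums m x" if "x \<notin> round_nums" for x
        using J that by (simp add: same_def)
      have inv3: "greedy_inv m3" "sol 4 m3 = S"
        using m(2) s3 r3 unfolding S_def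
        by (simp_all add: greedy_inv_cong[of m3 m] sol_cong[of m3 4 m] seek_vars_def round_nums_def)
      have pairs: "pair_bound (sol 4 m3) a v (density m3)" if "v < b" for v
        using J that b inv3 by simp
      show "run (Seq start_star grow_star) (t_start_star + t_grow_star)
          (\<lambda>m'. ok m' \<and> nats m' 15 0 = b \<and> ?J (Suc b) (nset m' 15 0 (Suc b))) m3"
      proof (rule run_mono, rule run_try_stars[where a = a and b = b], unfold inv3)
        fix m4 assume "ok m4 \<and> same (seek_vars - {14, 15}) round_nums m3 m4 \<and> best_inv m4 \<and> density m3 \<le> density m4 \<and>
          (b < n \<longrightarrow> pair_bound S a b (density m4)) \<and> (b = n \<longrightarrow> (\<forall>Q. fitting a Q \<longrightarrow> claim S a Q (density m4)))"
        then have m4: "ok m4" "same (seek_vars - {14, 15}) round_nums m3 m4" "best_inv m4" "density m3 \<le> density m4"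
          "b < n \<longrightarrow> pair_bound S a b (density m4)" "b = n \<longrightarrow> (\<forall>Q. fitting a Q \<longrightarrow> claim S a Q (density m4))"
          by auto
        let ?m5 = "nset m4 15 0 (Suc b)"
        have dens5: "density ?m5 = density m4"
          by (simp add: density_def)
        have n4: "nats m4 14 0 = a" "nats m4 15 0 = b"
          using m4(2) J m3 by (simp_all add: same_def seek_vars_def)
        have "ok ?m5"
          using m4(1) b K_bounds by (intro ok_nset) auto
        moreover have "same seek_vars round_nums m ?m5"
          using J m4(2) by (auto simp: same_def seek_vars_def)
        moreover have "best_inv ?m5"
          using m4(3) by (simp add: best_inv_cong[of ?m5 m4])
        moreover have "pair_bound S a v (density m4)" if "v < Suc b" "v < n" for v
        proof (cases "v = b")
          case False
          then have "pair_bound S a v (density m3)"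
            using J that by simp
          then show ?thesis
            using m4(4) by (rule pair_bound_mono)
        qed (use m4(5) that in simp)
        ultimately show "ok m4 \<and> nats m4 15 0 = b \<and> ?J (Suc b) ?m5"
          unfolding dens5 using m4(1,4,6) n4 J by auto
      qed (use J m3 m b a inv3 pairs in auto)
    next
      fix m3 assume J: "?J (n + 1) m3"
      let ?m4 = "nset m3 14 0 (Suc a)"
      have dens4: "density ?m4 = density m3"
        by (simp add: density_def)
      have "ok ?m4"
        using J a K_bounds by (intro ok_nset) auto
      moreover have "same seek_vars round_nums m ?m4"
        using J by (auto simp: same_def seek_vars_def)
      moreover have "best_inv ?m4"
        using J by (simp add: best_inv_cong[of ?m4 m3])
      moreover have "claim S a' Q (density m3)" if "a' < Suc a" "fitting a' Q" for a' Q
      proof (cases "a' = a")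
        case False
        then have "claim S a' Q (density m1)"
          using I that by simp
        then show ?thesis
          using J claim_mono by blast
      qed (use J that in simp)
      ultimately show "ok m3 \<and> nats m3 14 0 = a \<and> ?I (Suc a) ?m4"
        unfolding dens4 using J by blast
    qed (use n1_exp_bound K_bounds in auto)
  qed
  have "run (repeat 14 n_exp ?inner) (n * ((n + 1) * (t_start_star + t_grow_star + 2) + 2 + 2) + 2) ?Q ?m2"
  proof (rule run_repeat[where I = ?I])
    let ?m3 = "nset ?m2 14 0 0"
    have "ok ?m3"
      by (rule ok_nset[OF ok2]) auto
    then show "?I 0 ?m3"
      using m by (simp add: same_def seek_vars_def round_nums_def best_inv_def)
  qed (use inner n_exp_bound K_bounds in \<open>auto simp: S_def\<close>)
  then have "run (Seq (rassign 7 (RConst 1)) (repeat 14 n_exp ?inner))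
      (1 + (n * ((n + 1) * (t_start_star + t_grow_star + 2) + 2 + 2) + 2)) ?Q ?m1"
    using fits_w[OF fits_const(2)] by - (rule run_Seq, rule run_RAssign, auto)
  then show ?thesis
    unfolding seek_star_def t_seek_star_def
    using fits_w[OF fits_const(3)] by - (rule run_Seq, rule run_RAssign, auto)
qed

text \<open>A solution decomposes into the stars of its seeds, so the densest star is dense enough.\<close>

lemma gain_le_density:
  assumes AS: "valid A S" "real (card A) + weight S \<le> k" "1 \<le> k"
    and claims: "\<And>a Q. a < n \<Longrightarrow> fitting a Q \<Longrightarrow> claim I a Q d" and "0 \<le> d"
  shows "\<beta> * (F (I \<union> items A S) - F I) \<le> d * k"
proof -
  define T where "T a = {e \<in> S. fst e = a}" for a
  have finA: "finite A" and Sn: "S \<subseteq> {..<n} \<times> {..<n}"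
    using AS(1) finite_subset[of A "{..<n}"] by (auto simp: valid_def)
  have finS: "finite S"
    by (rule finite_arc_set[OF Sn])
  \<comment> \<open>Every edge of \<open>S\<close> has its tail in \<open>A\<close>, so the stars of
    the seeds exhaust the solution.\<close>
  have "items A S = (\<Union>a\<in>A. items {a} (T a))"
    using AS(1) by (auto simp: items_def T_def valid_def)
  then have "F (I \<union> items A S) - F I \<le> (\<Sum>a\<in>A. F (I \<union> items {a} (T a)) - F I)"
    using F.gain_UN[OF finA] by simp
  then have "\<beta> * (F (I \<union> items A S) - F I) \<le> \<beta> * (\<Sum>a\<in>A. F (I \<union> items {a} (T a)) - F I)"
    using \<beta>_bounds by (intro mult_left_mono) auto
  also have "\<dots> = (\<Sum>a\<in>A. \<beta> * (F (I \<union> items {a} (T a)) - F I))"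
    by (rule sum_distrib_left)
  also have "\<dots> \<le> (\<Sum>a\<in>A. d * (1 + weight (T a)))"
  proof (rule sum_mono)
    fix a assume a: "a \<in> A"
    have T: "T a \<subseteq> {..<n} \<times> {..<n}"
      using Sn by (auto simp: T_def)
    have "card A > 0"
      using a finA by (auto simp: card_gt_0_iff)
    \<comment> \<open>One unit of the budget pays for a seed, so the edges of each star fit into the
      rest and the star is one that the search covers.\<close>
    then have "1 + weight (T a) \<le> k"
      using AS(2) weight_mono[OF Sn, of "T a"] by (auto simp: T_def)
    then have "fitting a (T a)"
      using AS(1) by (auto simp: fitting_def T_def valid_def)
    then have "claim I a (T a) d"
      using AS(1) a by (intro claims) (auto simp: valid_def)
    then show "\<beta> * (F (I \<union> items {a} (T a)) - F I) \<le> d * (1 + weight (T a))"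
      using weight_nonneg[OF T] by (simp add: claim_def divide_le_eq)
  qed
  also have "\<dots> = d * (real (card A) + (\<Sum>a\<in>A. weight (T a)))"
    by (simp add: sum_distrib_left[symmetric] sum.distrib)
  also have "(\<Sum>a\<in>A. weight (T a)) = weight S"
    unfolding weight_def T_def using AS(1) finA finS
    by (intro sum.group) (auto simp: valid_def)
  also have "d * (real (card A) + weight S) \<le> d * k"
    using AS(2) \<open>0 \<le> d\<close> by (rule mult_left_mono)
  finally show ?thesis .
qed

section \<open>The outer greedy algorithm\<close>

definition t_greedy_step :: nat where
  "t_greedy_step = t_evaluate + (1 + (t_seek_star + (t_evaluate + (t_unite + (t_unite + 1)))))"

text \<open>Number array 5 charges every star in full and thus only bounds the true cost. The clause
  with factor 2 holds even if the budget is exceeded: the last star and the solution before it have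
  both been offered as output.\<close>

definition step_inv :: "memory \<Rightarrow> bool" where
  "step_inv m \<longleftrightarrow> ok m \<and> output_inv m \<and> valid_at 4 m \<and> cost_at 4 m \<le> nums m 5 0 \<and>
    F (sol 4 m) \<le> 2 * nums m 3 0 \<and>
    (\<forall>A S. valid A S \<longrightarrow> real (card A) + weight S \<le> k \<longrightarrow>
      F (items A S) - F (sol 4 m) \<le> F (items A S) * exp (- \<beta> * nums m 5 0 / k))"

lemma run_greedy_step:
  assumes m: "step_inv m" and R: "nums m 5 0 < k"
  shows "run greedy_step t_greedy_step (\<lambda>m'. step_inv m' \<and> nums m 5 0 + 1 \<le> nums m' 5 0) m"
    (is "run _ _ ?Q m")
proof -
  have inv: "ok m" "output_inv m" "valid_at 4 m" "cost_at 4 m \<le> nums m 5 0"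
    "F (sol 4 m) \<le> 2 * nums m 3 0"
    and decay: "\<And>A S. valid A S \<Longrightarrow> real (card A) + weight S \<le> k \<Longrightarrow>
      F (items A S) - F (sol 4 m) \<le> F (items A S) * exp (- \<beta> * nums m 5 0 / k)"
    using m unfolding step_inv_def by blast+
  have R0: "0 \<le> nums m 5 0"
    using inv(4) weight_nonneg[OF arcs_subset[of 5 m]] by (simp add: cost_at_def)
  then have k: "1 \<le> k"
    using R by linarith
  show ?thesis
    unfolding greedy_step_def t_greedy_step_def
  proof (rule run_Seq, rule run_mono, rule run_evaluate)
    fix m1 assume "ok m1 \<and> same {2, 3, 13} {2, 3} m m1 \<and> output_inv m1 \<and>
      nums m 3 0 \<le> nums m1 3 0 \<and> F (sol 4 m) \<le> nums m1 3 0"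
    then have m1: "ok m1" "same {2, 3, 13} {2, 3} m m1" "output_inv m1" "F (sol 4 m) \<le> nums m1 3 0"
      by auto
    have s1: "nats m1 x = nats m x" if "x \<notin> {2, 3, 13}" for x
      using m1(2) that by (simp add: same_def)
    have sol1: "sol 4 m1 = sol 4 m" "valid_at 4 m1"
      using s1 inv(3) by (simp_all add: sol_cong[of m1 4 m] valid_at_cong[of m1 4 m])
    define m2 where "m2 = rset m1 4 0 (F (sol 4 m))"
    have query: "spread G (nodes 4 m1) (arcs 5 m1) = F (sol 4 m)"
      using spread_at[OF sol1(2)] sol1(1) by simp
    have "fits (F (sol 4 m))"
      using inv(3) by (rule fits_F)
    then have m2: "ok m2" "nats m2 = nats m1" "\<And>x. x \<noteq> 4 \<Longrightarrow> nums m2 x = nums m1 x" "nums m2 4 0 = F (sol 4 m)"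
      using m1(1) by (simp_all add: m2_def ok_rset)
    have sol2: "sol 4 m2 = sol 4 m" "valid_at 4 m2" "output_inv m2"
      using sol1 m1 m2 by (simp_all add: sol_cong[of m2 4 m1] valid_at_cong[of m2 4 m1] output_inv_cong[of m2 m1])
    have greedy2: "greedy_inv m2"
      using sol2 m2 by (simp add: greedy_inv_def)
    let ?rest = "Seq (unite 4 4 8) (Seq (unite 5 5 9) (rassign 5 (RPlus (rvar 5) (rvar 7))))"
    have "run (Seq seek_star (Seq (evaluate 8 9) ?rest))
      (t_seek_star + (t_evaluate + (t_unite + (t_unite + 1)))) ?Q m2"
    proof (rule run_Seq, rule run_mono, rule run_seek_star[OF m2(1) greedy2 k], unfold sol2)
      fix m3 assume "ok m3 \<and> same seek_vars round_nums m2 m3 \<and> best_inv m3 \<and>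
        (\<forall>a<n. \<forall>Q. fitting a Q \<longrightarrow> claim (sol 4 m) a Q (density m3))"
      then have m3: "ok m3" "same seek_vars round_nums m2 m3" "best_inv m3"
        "\<And>a Q. a < n \<Longrightarrow> fitting a Q \<Longrightarrow> claim (sol 4 m) a Q (density m3)"
        by auto
      have s3: "nats m3 x = nats m2 x" if "x \<notin> seek_vars" for x
        using m3(2) that by (simp add: same_def)
      have r3: "nums m3 x = nums m2 x" if "x \<notin> round_nums" for x
        using m3(2) that by (simp add: same_def)
      have sol3: "sol 4 m3 = sol 4 m" "valid_at 4 m3" "output_inv m3" "cost_at 4 m3 = cost_at 4 m"
        "nums m3 5 0 = nums m 5 0" "nums m3 3 = nums m1 3"
        using sol2 s3 r3 s1 m2 m1(2)
        by (simp_all add: sol_cong[of m3 4 m2] valid_at_cong[of m3 4 m2] output_inv_cong[of m3 m2]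
            cost_at_cong[of m3 4 m] seek_vars_def round_nums_def same_def)
      define c where "c = nums m3 7 0"
      define g where "g = nums m3 6 0"
      have c: "1 \<le> c" "c \<le> k"
        using m3(3) by (simp_all add: best_inv_def c_def)
      have dens: "density m3 = g / c"
        by (simp add: density_def g_def c_def)
      \<comment> \<open>The bare seed 0 exists because \<open>k < n\<close>. Its claim makes the
        recorded density nonnegative, which excludes the mark for a missing star.\<close>
      have "fitting 0 {}"
        using k by (simp add: fitting_def weight_def)
      then have "claim (sol 4 m) 0 {} (g / c)"
        using m3(4)[of 0 "{}"] k_less by (simp add: dens)
      moreover have "F (sol 4 m) \<le> F (sol 4 m \<union> items {0} {})"
        by (rule F.mono) auto
      then have "0 \<le> \<beta> * ((F (sol 4 m \<union> items {0} {}) - F (sol 4 m)) / (1 + weight {}))"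
        using \<beta>_bounds by (simp add: weight_def)
      ultimately have "0 \<le> g / c"
        unfolding claim_def by (rule order_trans[rotated])
      then have g0: "0 \<le> g"
        using c by (simp add: zero_le_divide_iff)
      then have best3: "valid_at 8 m3" "c = cost_at 8 m3" "g = F (sol 4 m \<union> sol 8 m3) - F (sol 4 m)"
        using m3(3) sol3(1) unfolding best_inv_def c_def[symmetric] g_def[symmetric] by auto
      show "run (Seq (evaluate 8 9) ?rest) (t_evaluate + (t_unite + (t_unite + 1))) ?Q m3"
      proof (rule run_Seq, rule run_mono, rule run_evaluate[OF m3(1) sol3(3) best3(1)])
        fix m4 assume "ok m4 \<and> same {2, 3, 13} {2, 3} m3 m4 \<and> output_inv m4 \<and>
          nums m3 3 0 \<le> nums m4 3 0 \<and> F (sol 8 m3) \<le> nums m4 3 0"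
        then have m4: "ok m4" "same {2, 3, 13} {2, 3} m3 m4" "output_inv m4"
          "nums m3 3 0 \<le> nums m4 3 0" "F (sol 8 m3) \<le> nums m4 3 0"
          by auto
        show "run ?rest (t_unite + (t_unite + 1)) ?Q m4"
        proof (rule run_Seq, rule run_mono, rule run_unite[OF m4(1)])
          fix m5 assume m5: "ok m5 \<and> same {4, 13} {} m4 m5 \<and> nodes 4 m5 = nodes 4 m4 \<union> nodes 8 m4 \<and>
            arcs 4 m5 = arcs 4 m4 \<union> arcs 8 m4"
          show "run (Seq (unite 5 5 9) (rassign 5 (RPlus (rvar 5) (rvar 7)))) (t_unite + 1) ?Q m5"
          proof (rule run_Seq, rule run_mono, rule run_unite)
            fix m6 assume m6: "ok m6 \<and> same {5, 13} {} m5 m6 \<and> nodes 5 m6 = nodes 5 m5 \<union> nodes 9 m5 \<and>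
              arcs 5 m6 = arcs 5 m5 \<union> arcs 9 m5"
            have sets6: "nodes 4 m6 = nodes 4 m3 \<union> nodes 8 m3" "arcs 5 m6 = arcs 5 m3 \<union> arcs 9 m3"
              "nats m6 2 = nats m4 2" "nats m6 3 = nats m4 3"
              using m4(2) m5 m6 by (simp_all add: same_def nodes_def arcs_def)
            have r6: "nums m6 = nums m4"
              using m5 m6 by (simp add: same_def fun_eq_iff)
            have r6': "nums m6 5 0 = nums m 5 0" "nums m6 7 0 = c"
              using r6 m4(2) sol3(5) by (simp_all add: same_def c_def)
            let ?m7 = "rset m6 5 0 (nums m 5 0 + c)"
            have f: "fits (nums m 5 0 + c)"
            proof -
              have "nums m 5 0 \<in> Z" "c \<in> Z"
                using ok_fits[OF inv(1), of 5] ok_fits[OF m3(1), of 7] by (simp_all add: fits_def c_def)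
              then show ?thesis
                using R R0 c k_less by (simp add: fits_def add_Z)
            qed
            have ok7: "ok ?m7"
              using m6 f by (intro ok_rset) auto
            have sol7: "sol 4 ?m7 = sol 4 m \<union> sol 8 m3"
              using sets6 unfolding sol3(1)[symmetric] by (simp add: sol_def nodes_def arcs_def items_Un)
            have valid7: "valid_at 4 ?m7"
              using sets6 valid_Un[of "nodes 4 m3" "arcs 5 m3" "nodes 8 m3" "arcs 9 m3"] sol3(2) best3(1)
              by (simp add: valid_at_def nodes_def arcs_def)
            have out7: "output_inv ?m7"
              using m4(3) sets6 r6 by (simp add: output_inv_cong[of ?m7 m4])
            have cost7: "cost_at 4 ?m7 \<le> nums m 5 0 + c"
            proof -
              have "card (nodes 4 m3 \<union> nodes 8 m3) \<le> card (nodes 4 m3) + card (nodes 8 m3)"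
                by (rule card_Un_le)
              moreover have "weight (arcs 5 m3 \<union> arcs 9 m3) + weight (arcs 5 m3 \<inter> arcs 9 m3)
                  = weight (arcs 5 m3) + weight (arcs 9 m3)"
                unfolding weight_def by (rule sum.union_inter[OF finite_arcs finite_arcs])
              moreover have "0 \<le> weight (arcs 5 m3 \<inter> arcs 9 m3)"
                using arcs_subset[of 5 m3] by (intro weight_nonneg) auto
              ultimately have "cost_at 4 ?m7 \<le> cost_at 4 m3 + cost_at 8 m3"
                using sets6 by (simp add: cost_at_def nodes_def arcs_def)
              then show ?thesis
                using inv(4) sol3(4) best3(2) by linarith
            qed
            \<comment> \<open>Both parts are feasible and have been evaluated: the old solution has
              accounted cost below \<open>k\<close>, and the star costs at most \<open>k\<close>.
              Subadditivity is the source of the factor 2.\<close>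
            have "F (sol 4 m \<union> sol 8 m3) \<le> F (sol 4 m) + F (sol 8 m3)"
              by (rule F.subadditive)
            also have "\<dots> \<le> 2 * nums ?m7 3 0"
              using m1(4) m4(4,5) sol3(6) r6 by simp
            finally have half7: "F (sol 4 ?m7) \<le> 2 * nums ?m7 3 0"
              unfolding sol7 .
            have "F (items A S) - F (sol 4 ?m7) \<le> F (items A S) * exp (- \<beta> * (nums m 5 0 + c) / k)"
              if AS: "valid A S" "real (card A) + weight S \<le> k" for A S
            proof -
              let ?D = "F (items A S) - F (sol 4 m)"
              have new: "F (sol 4 ?m7) = F (sol 4 m) + g"
                unfolding sol7 best3(3) by simp
              show ?thesis
              proof (cases "?D \<le> 0")
                case True
                have "0 \<le> F (items A S) * exp (- \<beta> * (nums m 5 0 + c) / k)"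
                  by (intro mult_nonneg_nonneg F.nonneg) simp
                then show ?thesis
                  using True new g0 by linarith
              next
                case False
                have "\<beta> * ?D \<le> \<beta> * (F (sol 4 m \<union> items A S) - F (sol 4 m))"
                  using \<beta>_bounds F.mono[of "items A S" "sol 4 m \<union> items A S"] by simp
                also have "\<dots> \<le> g / c * k"
                  using AS k m3(4) \<open>0 \<le> g / c\<close> unfolding dens by (rule gain_le_density)
                finally have "\<beta> * c / k * ?D \<le> g"
                  using c k by (simp add: field_simps)
                \<comment> \<open>The star closes at least the fraction
                  \<open>\<beta> * c / k\<close> of the gap, so the gap decays exponentially in the
                  accounted cost.\<close>
                then have "?D - g \<le> ?D * (1 - \<beta> * c / k)"
                  by (simp add: algebra_simps)
                also have "\<dots> \<le> ?D * exp (- \<beta> * c / k)"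
                  using exp_ge_add_one_self[of "- \<beta> * c / k"] False by (intro mult_left_mono) auto
                also have "\<dots> \<le> F (items A S) * exp (- \<beta> * nums m 5 0 / k) * exp (- \<beta> * c / k)"
                  using decay[OF AS] by (rule mult_right_mono) simp
                also have "\<dots> = F (items A S) * exp (- \<beta> * (nums m 5 0 + c) / k)"
                  by (simp add: exp_add[symmetric] add_divide_distrib diff_divide_distrib algebra_simps)
                finally show ?thesis
                  using new by simp
              qed
            qed
            then have "step_inv ?m7"
              unfolding step_inv_def using ok7 out7 valid7 cost7 half7 by simp
            then have Q: "?Q ?m7"
              using c by simp
            have w: "w (nums m 5 0) \<le> W" "w c \<le> W" "w (nums m 5 0 + c) \<le> W"
              using fits_w f ok_fits[OF inv(1), of 5] ok_fits[OF m3(1), of 7] by (auto simp: c_def)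
            show "run (rassign 5 (RPlus (rvar 5) (rvar 7))) 1 ?Q m6"
            proof (rule run_RAssign)
              show "?Q (rset m6 5 (nval m6 (NConst 0)) (rval m6 (RPlus (rvar 5) (rvar 7))))"
                using Q r6' by simp
            qed (use w r6' in auto)
          qed (use m5 in auto)
        qed auto
      qed (use c best3(2) in auto)
    qed
    then have "run (Seq (Query 4 5 4) (Seq seek_star (Seq (evaluate 8 9) ?rest)))
      (1 + (t_seek_star + (t_evaluate + (t_unite + (t_unite + 1))))) ?Q m1"
      by - (rule run_Seq, rule run_Query, simp only: query m2_def)
    then show "run (Seq (Query 4 5 4) (Seq seek_star (Seq (evaluate 8 9) ?rest)))
      (1 + (t_seek_star + (t_evaluate + (t_unite + (t_unite + 1))))) ?Q m1" .
  qed (use inv R in auto)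
qed

end

text \<open>The quadratic Taylor bound is used twice: \<open>exp 1 \<ge> 5 / 2\<close> gives
  \<open>\<beta> \<ge> 1 / 5\<close>, and \<open>exp (1 / 5) \<ge> 61 / 50\<close> leaves 11/122,
  slightly more than 0.09.\<close>

lemma approximation_factor:
  fixes \<beta> :: real
  assumes "\<beta> = (1 - exp (- 1)) / 3"
  shows "0.09 \<le> (1 - exp (- \<beta>)) / 2"
proof -
  have "5 / 2 \<le> exp (1 :: real)"
    using exp_lower_Taylor_quadratic[of "1 :: real"] by (simp add: field_simps)
  then have "exp (- 1 :: real) \<le> 2 / 5"
    using le_imp_inverse_le[of "5 / 2" "exp (1 :: real)"] by (simp add: exp_minus)
  then have \<beta>: "1 / 5 \<le> \<beta>"
    using assms by simp
  have "61 / 50 \<le> exp (1 / 5 :: real)"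
    using exp_lower_Taylor_quadratic[of "1 / 5 :: real"] by (simp add: power2_eq_square)
  also have "\<dots> \<le> exp \<beta>"
    using \<beta> by simp
  finally have "exp (- \<beta>) \<le> 50 / 61"
    using le_imp_inverse_le[of "61 / 50" "exp \<beta>"] by (simp add: exp_minus)
  then show ?thesis
    by simp
qed

text \<open>Used to split the budget off \<open>K\<close>: it may be exponential in the input
  length, so the crude bound \<open>nat_size_le\<close> is applied only to the summand that depends
  on \<open>n\<close>.\<close>

lemma nat_size_add: "nat_size (a + b) \<le> nat_size a + nat_size b"
proof -
  have "a < 2 ^ floorlog 2 a" "b < 2 ^ floorlog 2 b"
    by (rule floorlog_leD; simp)+
  moreover have "(2 :: nat) ^ floorlog 2 a \<le> 2 ^ (floorlog 2 a + floorlog 2 b)"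
    "(2 :: nat) ^ floorlog 2 b \<le> 2 ^ (floorlog 2 a + floorlog 2 b)"
    by (rule power_increasing; simp)+
  ultimately have "a + b < 2 * 2 ^ (floorlog 2 a + floorlog 2 b)"
    by linarith
  then have "floorlog 2 (a + b) \<le> floorlog 2 a + floorlog 2 b + 1"
    by (intro floorlog_leI) auto
  then show ?thesis
    by (simp add: nat_size_def)
qed

lemma nat_size_le: "nat_size a \<le> a + 1"
  using floorlog_leI[of a 2 a] by (simp add: nat_size_def less_exp)

context bima
begin

section \<open>Guarantee and running time of the whole program\<close>

definition good_output :: "memory \<Rightarrow> bool" where
  "good_output m \<longleftrightarrow> feasible G k (nodes 2 m) (arcs 3 m) \<and>
    (\<forall>A S. feasible G k A S \<longrightarrow> 0.09 * spread G A S \<le> spread G (nodes 2 m) (arcs 3 m))"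

lemma feasible_valid: "feasible G k A S \<longleftrightarrow> valid A S \<and> real (card A) + weight S \<le> k"
  by (auto simp: feasible_def valid_def verts solution_cost_def weight_def)

lemma ok_input: "ok (input_memory G k)"
proof -
  have n: "card (verts G) = n"
    by (simp add: n_def)
  have fits0: "fits 0"
    by (simp add: fits_def zero_Z)
  have idx: "(u * n + v) div n = u" "(u * n + v) mod n = v" if "v < n" for u v
    using that by simp_all
  have K: "n \<le> K" "k \<le> K" "1 \<le> K"
    using K_bounds by auto
  show ?thesis
    unfolding ok_def input_memory_def Let_def n
    using K fits0 by (auto simp: idx index_less)
qed

lemma input_memory_empty: "2 \<le> x \<Longrightarrow> nats (input_memory G k) x i = 0" "2 \<le> x \<Longrightarrow> nums (input_memory G k) x i = 0"
  by (auto simp: input_memory_def Let_def)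

lemma input_nodes_arcs: "2 \<le> x \<Longrightarrow> nodes x (input_memory G k) = {}" "2 \<le> x \<Longrightarrow> arcs x (input_memory G k) = {}"
  by (auto simp: nodes_def arcs_def node_set_def edge_set_def input_memory_empty)

lemma run_all_nodes:
  assumes "n \<le> k"
  shows "run star_greedy (1 + 1 + (n * (1 + 2) + 2)) good_output (input_memory G k)"
proof -
  let ?m = "input_memory G k"
  let ?I = "\<lambda>j m. ok m \<and> nodes 2 m = {..<j} \<and> arcs 3 m = {}"
  have loop: "run (repeat 14 n_exp (NAssign 2 (nvar 14) (NConst 1))) (n * (1 + 2) + 2) good_output ?m"
  proof (rule run_repeat[where I = ?I])
    have "ok (nset ?m 14 0 0)"
      by (rule ok_nset[OF ok_input]) auto
    then show "?I 0 (nset ?m 14 0 0)"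
      using input_nodes_arcs[of 2] input_nodes_arcs[of 3] by (simp add: nodes_def arcs_def)
  next
    fix j m assume I: "?I j m" and j: "j < n" and m: "nats m 14 0 = j"
    let ?m1 = "nset m 2 j 1"
    let ?m2 = "nset ?m1 14 0 (Suc j)"
    have ok1: "ok ?m1"
      using I by (intro ok_nset_bit) auto
    have "ok ?m2"
      by (rule ok_nset[OF ok1]) (use j K_bounds in auto)
    moreover have "nodes 2 ?m2 = {..<Suc j}"
      using I j by (simp add: nodes_def node_set_insert lessThan_Suc)
    moreover have "arcs 3 ?m2 = {}"
      using I by (simp add: arcs_def)
    ultimately show "run (NAssign 2 (nvar 14) (NConst 1)) 1
        (\<lambda>m'. ok m' \<and> nats m' 14 0 = j \<and> ?I (Suc j) (nset m' 14 0 (Suc j))) m"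
      using m ok1 j K_bounds by - (rule run_NAssign, auto)
  next
    fix m assume I: "?I n m"
    have "feasible G k {..<n} {}"
      using assms by (simp add: feasible_valid valid_def weight_def)
    moreover have "0.09 * spread G A S \<le> spread G {..<n} {}" if "feasible G k A S" for A S
    proof -
      have "valid A S"
        using that feasible_valid by blast
      then have "0 \<le> spread G A S" "spread G A S \<le> n"
        using F_le F.nonneg by (simp_all add: spread_valid)
      then show ?thesis
        using spread_all_nodes[OF wf] by (simp add: verts)
    qed
    ultimately show "good_output m"
      using I by (simp add: good_output_def)
  qed (use ok_n K_bounds in auto)
  show ?thesis
    unfolding star_greedy_def
  proof (rule run_If, goal_cases)
    case 1
    then show ?case
      using ok_n[OF ok_input] ok_k[OF ok_input] K_bounds by simp
  next
    case 3
    then show ?case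
      using ok_n[OF ok_input] ok_k[OF ok_input] assms by simp
  qed (use loop in simp_all)
qed

end

context bima_small
begin

lemma run_greedy_loop:
  "run star_greedy (1 + (k * (t_greedy_step + 1) + 1) + 1) good_output (input_memory G k)"
proof -
  let ?m = "input_memory G k"
  let ?I = "\<lambda>j m. step_inv m \<and> real j \<le> nums m 5 0"
  have empty: "sol x ?m = {}" "valid_at x ?m" "cost_at x ?m = 0" if "2 \<le> x" for x
    using that by (simp_all add: sol_def valid_at_def cost_at_def input_nodes_arcs valid_def weight_def)
  have loop: "run (While (RLess (rvar 5) (ROfNat k_exp)) greedy_step) (k * (t_greedy_step + 1) + 1) good_output ?m"
  proof (rule run_While[where I = ?I])
    show "?I 0 ?m"
      using ok_input empty[of 2] empty[of 4]
      by (simp add: step_inv_def output_inv_def input_memory_empty F.empty)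
  next
    fix j m assume I: "?I j m"
    then have ok: "ok m"
      by (simp add: step_inv_def)
    show "tfit w W K m (RLess (rvar 5) (ROfNat k_exp))"
      using fits_w[OF ok_fits[OF ok, of 5]] fits_w[OF fits_k] ok_k[OF ok] K_bounds by simp
    show "j < k \<and> run greedy_step t_greedy_step (?I (Suc j)) m" if "holds m (RLess (rvar 5) (ROfNat k_exp))"
    proof -
      have R: "nums m 5 0 < k"
        using that ok_k[OF ok] by simp
      have "run greedy_step t_greedy_step (?I (Suc j)) m"
        using I by (intro run_mono[OF run_greedy_step[OF _ R]]) auto
      then show ?thesis
        using I R by linarith
    qed
    show "good_output m" if "\<not> holds m (RLess (rvar 5) (ROfNat k_exp))"
    proof -
      have R: "k \<le> nums m 5 0"
        using that ok_k[OF ok] by simp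
      have out: "valid_at 2 m" "cost_at 2 m \<le> k" "nums m 3 0 = F (sol 2 m)"
        and half: "F (sol 4 m) \<le> 2 * nums m 3 0"
        and decay: "\<And>A S. valid A S \<Longrightarrow> real (card A) + weight S \<le> k \<Longrightarrow>
          F (items A S) - F (sol 4 m) \<le> F (items A S) * exp (- \<beta> * nums m 5 0 / k)"
        using I unfolding step_inv_def output_inv_def by blast+
      have "0.09 * spread G A S \<le> F (sol 2 m)" if f: "feasible G k A S" for A S
      \<comment> \<open>The exponent divides by \<open>k\<close>. With budget 0 only the empty
        solution is feasible, and its spread is 0.\<close>
      proof (cases "k = 0")
        case True
        have AS: "valid A S" "real (card A) + weight S \<le> 0"
          using f[unfolded feasible_valid] True by auto
        then have "A \<subseteq> {..<n}" "S \<subseteq> A \<times> {..<n}" "0 \<le> weight S"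
          by (auto simp: valid_def intro!: weight_nonneg)
        then have "finite A" "real (card A) \<le> 0"
          using finite_subset[of A "{..<n}"] AS(2) by (simp, linarith)
        then have "A = {}"
          by simp
        then have "A = {}" "S = {}"
          using AS(1) by (simp_all add: valid_def)
        then have "spread G A S = 0"
          using spread_valid[of A S] by (simp add: valid_def F.empty)
        then show ?thesis
          using F.nonneg by simp
      next
        case False
        let ?O = "F (items A S)"
        have AS: "valid A S" "real (card A) + weight S \<le> k"
          using f feasible_valid by auto
        \<comment> \<open>The loop ends with accounted cost at least \<open>k\<close>, so the
          remaining gap is at most the fraction \<open>exp (- \<beta>)\<close>.\<close>
        have "\<beta> * 1 \<le> \<beta> * (nums m 5 0 / k)"
          using R False \<beta>_bounds by (intro mult_left_mono) auto
        then have "exp (- \<beta> * nums m 5 0 / k) \<le> exp (- \<beta>)"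
          by simp
        then have "?O * exp (- \<beta> * nums m 5 0 / k) \<le> ?O * exp (- \<beta>)"
          using F.nonneg by (rule mult_left_mono)
        then have "?O * (1 - exp (- \<beta>)) \<le> 2 * F (sol 2 m)"
          using decay[OF AS] half out(3) by (simp add: right_diff_distrib)
        moreover have "?O * 0.09 \<le> ?O * ((1 - exp (- \<beta>)) / 2)"
          using approximation_factor[OF \<beta>_def] F.nonneg by (rule mult_left_mono)
        ultimately show ?thesis
          using spread_valid[OF AS(1)] by simp
      qed
      then show ?thesis
        using out spread_at[OF out(1)]
        by (simp add: good_output_def feasible_valid valid_at_def cost_at_def)
    qed
  qed simp
  show ?thesis
    unfolding star_greedy_def
  proof (rule run_If, goal_cases)
    case 1
    then show ?case
      using ok_n[OF ok_input] ok_k[OF ok_input] K_bounds by simp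
  next
    case 4
    then show ?case
      using ok_n[OF ok_input] ok_k[OF ok_input] k_less by simp
  qed (use loop in simp_all)
qed

text \<open>With \<open>N = n + 1\<close>: a round of growth takes quadratic time, each start has
  \<open>N\<close> rounds, an outer step has at most \<open>N ^ 2\<close> starts, and there are
  fewer than \<open>N\<close> outer steps.\<close>

lemma greedy_loop_time: "1 + (k * (t_greedy_step + 1) + 1) + 1 \<le> 400 * (n + 1) ^ 6"
proof -
  define N where "N = n + 1"
  have N: "1 \<le> N ^ i" "N ^ i * N ^ j = N ^ (i + j)" for i j
    by (simp_all add: N_def power_add)
  have up: "N ^ i \<le> N ^ j" if "i \<le> j" for i j
    using that by (intro power_increasing) (simp_all add: N_def)
  have n: "n \<le> N ^ 1" "n * n \<le> N ^ 2"
    by (auto simp: N_def power2_eq_square)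
  have unite: "t_unite \<le> 5 * N ^ 2"
    using n(2) N(1)[of 2] by (simp add: t_unite_def)
  have eval: "t_evaluate \<le> 14 * N ^ 2"
    using unite N(1)[of 2] by (simp add: t_evaluate_def)
  have start: "t_start_star \<le> 30 * N ^ 2"
    using unite N(1)[of 2] n(1) up[of 1 2] by (simp add: t_start_star_def t_start_edge_def)
  have "t_try_edge \<le> 30"
    by (simp add: t_try_edge_def)
  then have "n * (t_try_edge + 2) \<le> N ^ 1 * 32"
    using n(1) by (intro mult_le_mono) auto
  then have scan: "t_scan_edges \<le> 36 * N ^ 2"
    using N(1)[of 2] up[of 1 2] by (simp add: t_scan_edges_def)
  have "t_try_star \<le> 26 * N ^ 2"
    using unite N(1)[of 2] by (simp add: t_try_star_def)
  then have round: "t_round \<le> 66 * N ^ 2"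
    using scan N(1)[of 2] by (simp add: t_round_def)
  have "N ^ 1 * (t_round + 2) \<le> N ^ 1 * (68 * N ^ 2)"
    using round N(1)[of 2] by (intro mult_le_mono) auto
  then have "N * (t_round + 2) \<le> 68 * N ^ 3"
    by (simp add: power2_eq_square power3_eq_cube)
  then have grow: "t_grow_star \<le> 70 * N ^ 3"
    using N(1)[of 3] unfolding t_grow_star_def N_def[symmetric] by linarith
  have "t_start_star + t_grow_star + 2 \<le> 102 * N ^ 3"
    using start grow N(1)[of 3] up[of 2 3] by linarith
  then have "N * (t_start_star + t_grow_star + 2) \<le> N * (102 * N ^ 3)"
    by (rule mult_le_mono2)
  also have "N * (102 * N ^ 3) = 102 * N ^ 4"
    by (simp add: power_numeral_reduce)
  finally have "N * (t_start_star + t_grow_star + 2) + 2 + 2 \<le> 106 * N ^ 4"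
    using N(1)[of 4] by linarith
  then have "n * (N * (t_start_star + t_grow_star + 2) + 2 + 2) \<le> N ^ 1 * (106 * N ^ 4)"
    using n(1) by (intro mult_le_mono)
  also have "N ^ 1 * (106 * N ^ 4) = 106 * N ^ 5"
    by (simp add: power_numeral_reduce)
  finally have seek: "t_seek_star \<le> 110 * N ^ 5"
    using N(1)[of 5] unfolding t_seek_star_def N_def by linarith
  have step: "t_greedy_step \<le> 150 * N ^ 5"
    using seek eval unite N(1)[of 5] up[of 2 5] by (simp add: t_greedy_step_def)
  have "k * (t_greedy_step + 1) \<le> N ^ 1 * (151 * N ^ 5)"
  proof (intro mult_le_mono)
    show "t_greedy_step + 1 \<le> 151 * N ^ 5"
      using step N(1)[of 5] by linarith
  qed (use k_less in \<open>simp add: N_def\<close>)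
  also have "N ^ 1 * (151 * N ^ 5) = 151 * N ^ 6"
    by (simp add: power_numeral_reduce)
  finally show ?thesis
    using N(1)[of 6] unfolding N_def by linarith
qed

end

context bima
begin

lemma run_star_greedy: "run star_greedy (400 * (n + 1) ^ 6) good_output (input_memory G k)"
proof (cases "k < n")
  case True
  interpret bima_small G k w Z W
    by unfold_locales (rule True)
  show ?thesis
    by (rule run_weaken[OF run_greedy_loop greedy_loop_time])
next
  case False
  have "(n + 1) ^ 1 \<le> (n + 1) ^ 6"
    by (rule power_increasing) auto
  then have "1 + 1 + (n * (1 + 2) + 2) \<le> 400 * (n + 1) ^ 6"
    by simp
  then show ?thesis
    using False by (intro run_weaken[OF run_all_nodes]) auto
qed

text \<open>\<open>W\<close> is linear in the input size \<open>I\<close> and \<open>U\<close> at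
  most quadratic, so the exponents 6 and 2 add up; \<open>c\<close> depends on the cost
  measure.\<close>

lemma star_greedy_time:
  assumes "n \<le> I" "nat_size k \<le> I" "W \<le> c * (I + 1)"
  shows "400 * (n + 1) ^ 6 * U \<le> 16000 * (c + 20) * (I + 1) ^ 8"
proof -
  define M where "M = I + 1"
  have M: "M \<le> M ^ 2" "1 \<le> M ^ 2"
    by (simp_all add: M_def power2_eq_square)
  have "nat_size K \<le> (n + 2)\<^sup>2 + 1 + nat_size k"
    unfolding K_def using nat_size_add[of "(n + 2)\<^sup>2" k] nat_size_le[of "(n + 2)\<^sup>2"] by linarith
  moreover have "(n + 2)\<^sup>2 \<le> (2 * M)\<^sup>2"
    using assms(1) by (intro power_mono) (auto simp: M_def)
  moreover have "(2 * M)\<^sup>2 = 4 * M\<^sup>2"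
    by (simp add: power_mult_distrib)
  moreover have "nat_size k \<le> M"
    using assms(2) by (simp add: M_def)
  ultimately have K: "nat_size K \<le> 6 * M ^ 2"
    using M by linarith
  have N: "(n + 1) ^ i \<le> M ^ i" for i
    using assms(1) by (intro power_mono) (auto simp: M_def)
  have "W \<le> c * M ^ 2"
    using assms(3) mult_le_mono2[OF M(1), of c] by (simp add: M_def)
  then have "nat_size K + W + (n + 1)\<^sup>2 \<le> (c + 20) * M ^ 2"
    using K N[of 2] unfolding add_mult_distrib by linarith
  then have "400 * (n + 1) ^ 6 * U \<le> 400 * M ^ 6 * (40 * ((c + 20) * M ^ 2))"
    unfolding U_def using N[of 6] by (intro mult_le_mono) auto
  also have "\<dots> = 16000 * (c + 20) * M ^ 8"
    by (simp add: algebra_simps flip: power_add)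
  finally show ?thesis
    by (simp add: M_def)
qed

lemma star_greedy_runs:
  assumes "n \<le> I" "nat_size k \<le> I" "W \<le> c * (I + 1)"
  obtains m t where "runs w star_greedy G k m t" "t \<le> 16000 * (c + 20) * (I + 1) ^ 8"
    "feasible G k (output_nodes G m) (output_edges G m)"
    "\<And>A S. optimal G k A S \<Longrightarrow> 0.09 * spread G A S \<le> spread G (output_nodes G m) (output_edges G m)"
proof -
  obtain m t where run: "exec n (spread G) w star_greedy (input_memory G k) m t" "t \<le> 400 * (n + 1) ^ 6 * U"
    and out: "good_output m"
    using run_star_greedy by (rule runE)
  have eq: "output_nodes G m = nodes 2 m" "output_edges G m = arcs 3 m"
    by (simp_all add: output_nodes_def output_edges_def nodes_def arcs_def n_def)
  show thesis
  proof
    show "runs w star_greedy G k m t"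
      using run(1) by (simp add: runs_def n_def)
    show "t \<le> 16000 * (c + 20) * (I + 1) ^ 8"
      using run(2) star_greedy_time[OF assms] by linarith
  qed (use out in \<open>auto simp: eq good_output_def optimal_def\<close>)
qed

end

section \<open>Rational networks\<close>

lemma floorlog_mult: "floorlog 2 (a * b) \<le> floorlog 2 a + floorlog 2 b"
proof (cases "a = 0 \<or> b = 0")
  case False
  have "a < 2 ^ floorlog 2 a" "b < 2 ^ floorlog 2 b"
    by (rule floorlog_leD; simp)+
  then have "a * b < 2 ^ (floorlog 2 a + floorlog 2 b)"
    unfolding power_add using False by (intro mult_strict_mono) auto
  then show ?thesis
    by (intro floorlog_leI) auto
qed (auto simp: floorlog_def)

lemma floorlog_prod: "finite A \<Longrightarrow> floorlog 2 (\<Prod>x\<in>A. f x) \<le> 1 + (\<Sum>x\<in>A. floorlog 2 (f x))"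
proof (induction A rule: finite_induct)
  case (insert x A)
  then show ?case
    using floorlog_mult[of "f x" "prod f A"] by simp
qed (simp add: floorlog_def)

lemma floorlog_le: "floorlog 2 a \<le> a"
  by (intro floorlog_leI) (simp_all add: less_exp)

lemma rat_size_Fract:
  assumes "0 < b"
  shows "rat_size (Fract a b) \<le> nat_size (nat \<bar>a\<bar>) + nat_size (nat b)"
proof -
  have q: "quotient_of (Fract a b) = (a div gcd a b, b div gcd a b)"
    using assms by (simp add: quotient_of_Fract normalize_def Let_def)
  have le: "\<bar>c div gcd a b\<bar> \<le> \<bar>c\<bar>" if "gcd a b dvd c" for c
  proof -
    have "1 \<le> gcd a b"
      using assms by (simp add: int_one_le_iff_zero_less)
    then have "1 * \<bar>c div gcd a b\<bar> \<le> gcd a b * \<bar>c div gcd a b\<bar>"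
      by (rule mult_right_mono) simp
    also have "\<dots> = \<bar>gcd a b * (c div gcd a b)\<bar>"
      by (simp only: abs_mult abs_gcd_int)
    finally show ?thesis
      using that by simp
  qed
  have "\<bar>a div gcd a b\<bar> \<le> \<bar>a\<bar>" "b div gcd a b \<le> b"
    using le[of a] le[of b] assms by simp_all
  then have "nat_size (nat \<bar>a div gcd a b\<bar>) \<le> nat_size (nat \<bar>a\<bar>)" "nat_size (nat (b div gcd a b)) \<le> nat_size (nat b)"
    by (simp_all add: nat_size_mono nat_mono)
  then show ?thesis
    by (simp add: rat_size_def q)
qed

lemma bit_size_of_rat: "bit_size (of_rat q) = rat_size q"
  by (simp add: bit_size_def)

lemma bit_size_divide:
  assumes "0 < b"
  shows "bit_size (of_int a / of_int b) \<le> nat_size (nat \<bar>a\<bar>) + nat_size (nat b)"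
proof -
  have "of_int a / of_int b = (of_rat (Fract a b) :: real)"
    using assms by (simp add: of_rat_rat)
  then show ?thesis
    using rat_size_Fract[OF assms, of a] by (simp add: bit_size_of_rat)
qed

definition denominator :: "real \<Rightarrow> nat" where
  "denominator x = nat (snd (quotient_of (THE q. of_rat q = x)))"

lemma
  assumes "x \<in> \<rat>"
  shows denominator_pos: "0 < denominator x"
    and denominator_Ints: "x * denominator x \<in> \<int>"
    and floorlog_denominator: "floorlog 2 (denominator x) \<le> bit_size x"
proof -
  obtain q where q: "x = of_rat q"
    using assms by (auto simp: Rats_def)
  obtain a b where ab: "quotient_of q = (a, b)"
    by (cases "quotient_of q")
  have b: "0 < b"
    using ab by (rule quotient_of_denom_pos)
  have d: "denominator x = nat b"
    by (simp add: denominator_def q ab)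
  show "0 < denominator x"
    using b d by simp
  have "x = of_int a / of_int b"
    unfolding q quotient_of_div[OF ab] by (simp add: of_rat_divide)
  then show "x * denominator x \<in> \<int>"
    using b d by simp
  show "floorlog 2 (denominator x) \<le> bit_size x"
    by (simp add: q bit_size_of_rat rat_size_def ab nat_size_def d[unfolded q])
qed

lemma Ints_prod: "(\<And>x. x \<in> A \<Longrightarrow> f x \<in> \<int>) \<Longrightarrow> prod f A \<in> (\<int> :: real set)"
  by (induction A rule: infinite_finite_induct) auto

text \<open>
  On a rational network, all numbers computed by the algorithm are sums of multiples of \<open>1 / D\<close>,
  where \<open>D\<close> is the product of all denominators, or products of two such numbers.
\<close>

locale rational_network =
  fixes G :: "nat network"
  assumes input: "input_network G"
    and rational: "e \<in> verts G \<times> verts G \<Longrightarrow> prob G e \<in> \<rat> \<and> cost G e \<in> \<rat>"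
begin

definition D :: nat where
  "D = (\<Prod>e\<in>verts G \<times> verts G. denominator (prob G e) * denominator (cost G e))"

definition Z :: "real set" where
  "Z = {x. x * D \<in> \<int>}"

lemma wf: "wf_network G"
  using input by (simp add: input_network_def)

lemma finite_pairs: "finite (verts G \<times> verts G)"
  using wf by (simp add: wf_network_def)

lemma D_pos: "0 < D"
  unfolding D_def using rational denominator_pos by (intro prod_pos) auto

lemma multiple_Z:
  assumes "d dvd D" "x * real d \<in> \<int>"
  shows "x \<in> Z"
proof -
  obtain c where c: "D = d * c"
    using assms(1) by (rule dvdE)
  have "x * real d * real c \<in> \<int>"
    using assms(2) by (rule Ints_mult) simp
  then show ?thesis
    by (simp add: Z_def c mult.assoc)
qed

lemma cost_Z: "e \<in> verts G \<times> verts G \<Longrightarrow> cost G e \<in> Z"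
proof (rule multiple_Z)
  assume e: "e \<in> verts G \<times> verts G"
  have "denominator (cost G e) dvd denominator (prob G e) * denominator (cost G e)"
    by simp
  also have "\<dots> dvd D"
    unfolding D_def using finite_pairs e by (rule dvd_prodI)
  finally show "denominator (cost G e) dvd D" .
  show "cost G e * real (denominator (cost G e)) \<in> \<int>"
    using rational[OF e] by (simp add: denominator_Ints)
qed

text \<open>The probability of a live-edge graph has one factor \<open>p\<close> or
  \<open>1 - p\<close> per edge, and the denominator of \<open>p\<close> clears both. Hence a single
  product of denominators clears all terms of the exponentially long sum.\<close>

lemma spread_Z:
  assumes "S \<subseteq> verts G \<times> verts G"
  shows "spread G A S \<in> Z"
proof (rule multiple_Z)
  let ?F = "edges G \<union> S" and ?d = "\<lambda>e. denominator (prob G e)"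
  have F: "?F \<subseteq> verts G \<times> verts G"
    using assms wf by (auto simp: wf_network_def)
  have finF: "finite ?F"
    using F finite_pairs by (rule finite_subset)
  have "(\<Prod>e\<in>?F. ?d e) dvd (\<Prod>e\<in>verts G \<times> verts G. ?d e)"
    by (rule prod_dvd_prod_subset[OF finite_pairs F])
  also have "\<dots> dvd D"
    unfolding D_def by (rule prod_dvd_prod) simp
  finally show "(\<Prod>e\<in>?F. ?d e) dvd D" .
  have aug: "wf_network (augment G S)"
    using wf F by (simp add: wf_network_def augment_def)
  have "pmf (live_edge_pmf (augment G S)) X * real (card (reachable A X)) * real (\<Prod>e\<in>?F. ?d e) \<in> \<int>"
    if X: "X \<subseteq> ?F" for X
  proof -
    have "real (\<Prod>e\<in>?F. ?d e) = (\<Prod>e\<in>?F - X. real (?d e)) * (\<Prod>e\<in>X. real (?d e))"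
      by (simp add: prod.subset_diff[OF X finF])
    moreover have "pmf (live_edge_pmf (augment G S)) X = (\<Prod>e\<in>X. prob G e) * (\<Prod>e\<in>?F - X. 1 - prob G e)"
      using pmf_live_edge_pmf[OF aug, of X] X by (simp add: augment_def)
    ultimately have eq: "pmf (live_edge_pmf (augment G S)) X * real (card (reachable A X)) * real (\<Prod>e\<in>?F. ?d e)
        = (\<Prod>e\<in>X. prob G e * ?d e) * (\<Prod>e\<in>?F - X. (1 - prob G e) * ?d e) * real (card (reachable A X))"
      by (simp add: prod.distrib)
    have int: "prob G e * ?d e \<in> \<int>" "(1 - prob G e) * ?d e \<in> \<int>" if "e \<in> ?F" for e
      using rational[of e] denominator_Ints[of "prob G e"] that F by (auto simp: left_diff_distrib)
    have "(\<Prod>e\<in>X. prob G e * ?d e) \<in> \<int>" "(\<Prod>e\<in>?F - X. (1 - prob G e) * ?d e) \<in> \<int>"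
      by (rule Ints_prod; use int X in blast)+
    then show ?thesis
      unfolding eq by (intro Ints_mult Ints_of_nat)
  qed
  then show "spread G A S * real (\<Prod>e\<in>?F. ?d e) \<in> \<int>"
    unfolding spread_def live_edge_graphs_def sum_distrib_right
    by (intro Ints_sum) (auto simp: augment_def)
qed

text \<open>\<open>D\<close> may be huge, but bit lengths add up under multiplication, so its length
  is linear in that of the input.\<close>

lemma floorlog_D: "floorlog 2 D \<le> 1 + (\<Sum>e\<in>verts G \<times> verts G. bit_size (prob G e) + bit_size (cost G e))"
proof -
  have "floorlog 2 D \<le> 1 + (\<Sum>e\<in>verts G \<times> verts G. floorlog 2 (denominator (prob G e) * denominator (cost G e)))"
    unfolding D_def by (rule floorlog_prod[OF finite_pairs])
  also have "(\<Sum>e\<in>verts G \<times> verts G. floorlog 2 (denominator (prob G e) * denominator (cost G e)))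
      \<le> (\<Sum>e\<in>verts G \<times> verts G. bit_size (prob G e) + bit_size (cost G e))"
    using rational
    by (intro sum_mono order_trans[OF floorlog_mult] add_mono floorlog_denominator) auto
  finally show ?thesis
    by simp
qed

text \<open>Over the denominator \<open>D\<close> both numerators are at most \<open>B * D\<close>
  in absolute value. The product therefore has a numerator of at most the square of
  \<open>B * D\<close> over \<open>D * D\<close>, and cancelling does not lengthen it.\<close>

lemma bit_size_mult:
  assumes "x \<in> Z" "y \<in> Z" "\<bar>x\<bar> \<le> real B" "\<bar>y\<bar> \<le> real B"
  shows "bit_size (x * y) \<le> 2 + 2 * floorlog 2 B + 4 * floorlog 2 D"
proof -
  obtain a b where ab: "x * D = of_int a" "y * D = of_int b"
    using assms(1,2) by (auto simp: Z_def elim!: Ints_cases)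
  have D: "0 < int (D * D)"
    using D_pos by simp
  have "of_int (a * b) = (x * y) * real (D * D)"
    by (simp flip: ab)
  then have eq: "x * y = of_int (a * b) / of_int (int (D * D))"
    using D_pos by (simp add: field_simps)
  have "\<bar>real_of_int a\<bar> \<le> real (B * D)" "\<bar>real_of_int b\<bar> \<le> real (B * D)"
    using assms(3,4) by (simp_all add: ab[symmetric] abs_mult mult_right_mono)
  then have "\<bar>a\<bar> \<le> int (B * D)" "\<bar>b\<bar> \<le> int (B * D)"
    by linarith+
  then have "\<bar>a * b\<bar> \<le> int (B * D) * int (B * D)"
    unfolding abs_mult by (rule mult_mono) auto
  then have num: "nat \<bar>a * b\<bar> \<le> (B * D) * (B * D)"
    by (simp add: nat_le_iff)
  have "bit_size (x * y) \<le> nat_size (nat \<bar>a * b\<bar>) + nat_size (D * D)"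
    using bit_size_divide[OF D, of "a * b"] unfolding eq nat_int .
  also have "\<dots> \<le> nat_size ((B * D) * (B * D)) + nat_size (D * D)"
    using num by (simp add: nat_size_mono)
  also have "\<dots> \<le> 2 + 2 * floorlog 2 B + 4 * floorlog 2 D"
    using floorlog_mult[of "B * D" "B * D"] floorlog_mult[of B D] floorlog_mult[of D D]
    by (simp add: nat_size_def)
  finally show ?thesis .
qed

end

section \<open>The two cost measures\<close>

lemma card_le_input_size: "wf_network G \<Longrightarrow> card (verts G) \<le> input_size w G k"
proof -
  assume "wf_network G"
  have "card (verts G) \<le> card (verts G) * card (verts G)"
    by simp
  also have "\<dots> = (\<Sum>e\<in>verts G \<times> verts G. 1)"
    by (simp add: card_cartesian_product)
  also have "\<dots> \<le> (\<Sum>e\<in>verts G \<times> verts G. 1 + w (prob G e) + w (cost G e))"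
    by (rule sum_mono) simp
  finally show ?thesis
    by (simp add: input_size_def)
qed

text \<open>Unit charges put no restriction on numbers, so \<open>Z\<close> is the set of all reals
  and \<open>W\<close> is 1.\<close>

lemma star_greedy_real:
  assumes "input_network G"
  obtains m t where "runs (\<lambda>_. 1) star_greedy G k m t" "t \<le> 16000 * (1 + 20) * (input_size (\<lambda>_. 1) G k + 1) ^ 8"
    "feasible G k (output_nodes G m) (output_edges G m)"
    "\<And>A S. optimal G k A S \<Longrightarrow> 0.09 * spread G A S \<le> spread G (output_nodes G m) (output_edges G m)"
proof -
  interpret bima G k "\<lambda>_. 1" UNIV 1
    by unfold_locales (use assms in auto)
  show thesis
    by (rule star_greedy_runs[where I = "input_size (\<lambda>_. 1) G k" and c = 1])
      (use that card_le_input_size[OF wf, of "\<lambda>_. 1" k] in \<open>auto simp: n_def input_size_def\<close>)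
qed

lemma star_greedy_rational:
  assumes "input_network G" "\<forall>e \<in> verts G \<times> verts G. prob G e \<in> \<rat> \<and> cost G e \<in> \<rat>"
  obtains m t where "runs bit_size star_greedy G k m t" "t \<le> 16000 * (20 + 20) * (input_size bit_size G k + 1) ^ 8"
proof -
  interpret rational_network G
    by unfold_locales (use assms in auto)
  let ?I = "input_size bit_size G k" and ?B = "3 * card (verts G) + 3"
  define W where "W = 2 + 2 * floorlog 2 ?B + 4 * floorlog 2 D"
  interpret bima G k bit_size Z W
  proof unfold_locales
    show "1 \<in> Z"
      by (simp add: Z_def)
    show "x + y \<in> Z" "x - y \<in> Z" if "x \<in> Z" "y \<in> Z" for x y
      using that by (simp_all add: Z_def distrib_right left_diff_distrib)
    show "bit_size (x * y) \<le> W"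
      if "x \<in> Z" "y \<in> Z" "\<bar>x\<bar> \<le> 3 * real (card (verts G)) + 3" "\<bar>y\<bar> \<le> 3 * real (card (verts G)) + 3" for x y
      unfolding W_def using that by (intro bit_size_mult) auto
  qed (use assms cost_Z spread_Z in auto)
  have card: "card (verts G) \<le> ?I"
    by (rule card_le_input_size[OF wf])
  have "(\<Sum>e\<in>verts G \<times> verts G. bit_size (prob G e) + bit_size (cost G e)) \<le> ?I"
    unfolding input_size_def by (rule trans_le_add2) (rule sum_mono, simp)
  then have "floorlog 2 D \<le> 1 + ?I"
    using floorlog_D by linarith
  moreover have "floorlog 2 ?B \<le> 3 * ?I + 3"
    using floorlog_le[of ?B] card by linarith
  ultimately have "2 * floorlog 2 ?B \<le> 6 * ?I + 6" "4 * floorlog 2 D \<le> 4 + 4 * ?I"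
    by simp_all
  \<comment> \<open>The summands add up to at most \<open>12 + 10 * ?I\<close>, so the constant 20
    is generous.\<close>
  then have "W \<le> 20 * (?I + 1)"
    unfolding W_def by simp
  then show thesis
    by (rule star_greedy_runs[where I = ?I and c = 20, rotated 2])
      (use that card in \<open>auto simp: n_def input_size_def\<close>)
qed

lemma polynomial_time_onI:
  assumes "\<And>G k. G \<in> \<G> \<Longrightarrow> \<exists>m t. runs w alg G k m t \<and> t \<le> c * (input_size w G k + 1) ^ d"
  shows "polynomial_time_on w \<G> alg"
  unfolding polynomial_time_on_def
proof (intro exI[of _ "smult c ([:1, 1:] ^ d)"] ballI allI)
  fix G k assume "G \<in> \<G>"
  then show "\<exists>m t. runs w alg G k m t \<and> t \<le> poly (smult c ([:1, 1:] ^ d)) (input_size w G k)"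
    using assms by (simp add: add.commute)
qed

theorem corollary9:
  shows "\<exists>(\<rho>::real) alg. \<rho> > 0.0878 \<and> polynomial_time alg \<and> BIMA_approximation \<rho> alg"
proof (intro exI conjI)
  show "(0.09 :: real) > 0.0878"
    by simp
  show "polynomial_time star_greedy"
    unfolding polynomial_time_def
  proof
    show "polynomial_time_on (\<lambda>_. 1) {G. input_network G} star_greedy"
      by (rule polynomial_time_onI[where c = "16000 * (1 + 20)" and d = 8]) (metis star_greedy_real mem_Collect_eq)
    show "polynomial_time_on bit_size
        {G. input_network G \<and> (\<forall>e \<in> verts G \<times> verts G. prob G e \<in> \<rat> \<and> cost G e \<in> \<rat>)} star_greedy"
      by (rule polynomial_time_onI[where c = "16000 * (20 + 20)" and d = 8]) (metis (no_types, lifting) star_greedy_rational mem_Collect_eq)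
  qed
  show "BIMA_approximation 0.09 star_greedy"
    unfolding BIMA_approximation_def
  proof (intro allI impI)
    fix G :: "nat network" and k
    assume "input_network G"
    then show "\<exists>m t. runs (\<lambda>_. 1) star_greedy G k m t \<and>
        feasible G k (output_nodes G m) (output_edges G m) \<and>
        (\<forall>A S. optimal G k A S \<longrightarrow>
          0.09 * spread G A S \<le> spread G (output_nodes G m) (output_edges G m))"
      by (rule star_greedy_real[where k = k]) blast
  qed
qed

end
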